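(* Let $d\ge 2$. Suppose that $\lambda$ is a nonnegative compactly supported Borel measure on $\mathbb{R}^d$ and suppose that for some $\alpha\in(0,(d-1)/2)$ and some constant $C_0<\infty$ the measure $\lambda$ satisfies $$\lambda\big(B(x,\delta)\big)\le C_0\,\delta^{\alpha}\qquad\text{for all }x\in\mathbb{R}^d,\ \delta>0 .$$ Then, for every $\epsilon>0$, $0<q<2$, and $0<r_0<R_0<\infty$, there is a constant $C$ such that $$\Big(\int_{\mathbb{R}^d}\big(\sup_{r_0<r<R_0}|Sf(x,r)|\big)^{q}\,d\lambda(x)\Big)^{1/q}\le C\,\|f\|_{W^{2,(1-\alpha)/2+\epsilon}}$$ for all Schwartz functions $f$ on $\mathbb{R}^d$. The constant $C$ depends only on $d$, $\alpha$, the size of the support of $\lambda$ (i.e. on a number $M$ such that $\lambda$ is supported in $B(0,M)$), $C_0$, $\epsilon$, $q$, $r_0$, and $R_0$.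
   Context: $S$ is the spherical averaging operator, defined for nice functions $f$ on $\mathbb{R}^d$, $x\in\mathbb{R}^d$ and $r>0$ by $Sf(x,r)=\int_{S^{d-1}}f(x-r\sigma)\,d\sigma$, where $d\sigma$ is Lebesgue (surface) measure on the unit sphere $S^{d-1}\subset\mathbb{R}^d$. For real $s$, $W^{2,s}$ is the $L^2$-based Sobolev space of smoothness $s$, with norm $\|f\|_{W^{2,s}}=\big(\int_{\mathbb{R}^d}(1+|\xi|^2)^{s}|\hat f(\xi)|^2\,d\xi\big)^{1/2}$. $B(x,\delta)$ is the ball of radius $\delta$ centered at $x$. *)

theory Defs
  imports "HOL-Analysis.Analysis"
begin

text \<open>Powers with real exponent on \<open>[0, \<infinity>]\<close>, intended for exponents \<open>p > 0\<close>
  (so that \<open>\<infinity>\<close> is sent to \<open>\<infinity>\<close>).\<close>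

definition ennreal_powr :: "ennreal \<Rightarrow> real \<Rightarrow> ennreal" where
  "ennreal_powr a p = (if a = \<infinity> then \<infinity> else ennreal (enn2real a powr p))"

subsection \<open>Schwartz functions\<close>

definition partial_deriv :: "'n::finite \<Rightarrow> (real^'n \<Rightarrow> complex) \<Rightarrow> real^'n \<Rightarrow> complex" where
  "partial_deriv i f x = frechet_derivative f (at x) (axis i 1)"

text \<open>\<open>iter_partial [i\<^sub>1, \<dots>, i\<^sub>k] f\<close> is \<open>\<partial>\<^bsub>i\<^sub>1\<^esub> \<dots> \<partial>\<^bsub>i\<^sub>k\<^esub> f\<close>; iterated partial derivatives are indexed by
  lists rather than multi-indices, which makes no difference for smooth functions.\<close>

primrec iter_partial :: "'n::finite list \<Rightarrow> (real^'n \<Rightarrow> complex) \<Rightarrow> real^'n \<Rightarrow> complex" where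
  "iter_partial [] f = f"
| "iter_partial (i # is) f = partial_deriv i (iter_partial is f)"

text \<open>The first conjunct says that \<open>f\<close> is \<open>C\<^sup>\<infinity>\<close>: differentiability of all iterated partial
  derivatives also makes all of them continuous. The second one bounds \<open>x\<^sup>\<beta> \<partial>\<^sup>\<gamma> f\<close>.\<close>

definition schwartz :: "(real^'n::finite \<Rightarrow> complex) \<Rightarrow> bool" where
  "schwartz f \<longleftrightarrow>
     (\<forall>is x. iter_partial is f differentiable (at x)) \<and>
     (\<forall>(\<beta> :: 'n \<Rightarrow> nat) is. bounded (range (\<lambda>x. (\<Prod>j\<in>UNIV. x $ j ^ \<beta> j) *\<^sub>R iter_partial is f x)))"

subsection \<open>Sobolev norms\<close>

text \<open>Normalisation: the frequency variable carries the factor \<open>2\<pi>\<close>.\<close>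

definition fourier_transform :: "(real^'n::finite \<Rightarrow> complex) \<Rightarrow> real^'n \<Rightarrow> complex" where
  "fourier_transform f \<xi> = (\<integral>x. f x * cis (- 2 * pi * (x \<bullet> \<xi>)) \<partial>lborel)"

definition sobolev_norm :: "real \<Rightarrow> (real^'n::finite \<Rightarrow> complex) \<Rightarrow> ennreal" where
  "sobolev_norm s f =
     ennreal_powr
       (\<integral>\<^sup>+\<xi>. ennreal ((1 + (norm \<xi>)\<^sup>2) powr s * (norm (fourier_transform f \<xi>))\<^sup>2) \<partial>lborel) (1 / 2)"

subsection \<open>Surface measure on the unit sphere and spherical averages\<close>

text \<open>The surface measure of \<open>A\<close> is \<open>d\<close> times the Lebesgue measure of the cone
  \<open>{t a | 0 < t < 1, a \<in> A}\<close>, as dictated by integration in polar coordinates: the measure is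
  \<open>d\<close> times the image of Lebesgue measure on the punctured unit ball under the radial projection.\<close>

definition sphere_measure :: "(real^'n::finite) measure" where
  "sphere_measure =
     scale_measure (of_nat CARD('n))
       (distr (restrict_space lborel (ball 0 1 - {0})) (restrict_space borel (sphere 0 1))
          (\<lambda>x. x /\<^sub>R norm x))"

lemma emeasure_sphere_measure:
  fixes A :: "(real^'n::finite) set"
  assumes "A \<in> sets borel" "A \<subseteq> sphere 0 1"
  shows "emeasure sphere_measure A =
    of_nat CARD('n) * emeasure lborel {t *\<^sub>R a | t a. 0 < t \<and> t < 1 \<and> a \<in> A}"
proof -
  let ?B = "ball 0 1 - {0} :: (real^'n) set"
  let ?g = "\<lambda>x::real^'n. x /\<^sub>R norm x"
  let ?R = "restrict_space lborel ?B :: (real^'n) measure"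
  have B: "?B \<in> sets lborel" by simp
  have g: "?g \<in> measurable ?R (restrict_space borel (sphere 0 1))"
    by (intro measurable_restrict_space2 measurable_restrict_space1)
       (auto simp: space_restrict_space)
  have A: "A \<in> sets (restrict_space borel (sphere 0 1))"
    using assms by (auto simp: sets_restrict_space_iff)
  have eq: "?g -` A \<inter> space ?R = {t *\<^sub>R a | t a. 0 < t \<and> t < 1 \<and> a \<in> A}" (is "?L = ?C")
  proof (intro set_eqI iffI)
    fix x assume x: "x \<in> ?L"
    then have "x = norm x *\<^sub>R ?g x" "0 < norm x" "norm x < 1" "?g x \<in> A"
      by (auto simp: space_restrict_space)
    then show "x \<in> ?C" by blast
  next
    fix x assume "x \<in> ?C"
    then obtain t a where x: "x = t *\<^sub>R a" "0 < t" "t < 1" "a \<in> A" by blast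
    have "norm a = 1" using x(4) assms(2) by auto
    with x show "x \<in> ?L" by (auto simp: space_restrict_space)
  qed
  have "emeasure (distr ?R (restrict_space borel (sphere 0 1)) ?g) A = emeasure ?R ?C"
    by (subst emeasure_distr[OF g A]) (simp only: eq)
  also have "\<dots> = emeasure lborel ?C"
    by (rule emeasure_restrict_space) (use B eq[symmetric] in \<open>auto simp: space_restrict_space\<close>)
  finally show ?thesis by (simp add: sphere_measure_def)
qed

definition spherical_avg :: "(real^'n::finite \<Rightarrow> complex) \<Rightarrow> real^'n \<Rightarrow> real \<Rightarrow> complex" where
  "spherical_avg f x r = (\<integral>\<sigma>. f (x - r *\<^sub>R \<sigma>) \<partial>sphere_measure)"

subsection \<open>Support of a measure\<close>

definition measure_support :: "'a::topological_space measure \<Rightarrow> 'a set" where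
  "measure_support \<mu> = {x. \<forall>U. open U \<longrightarrow> x \<in> U \<longrightarrow> emeasure \<mu> U > 0}"

end

theory Submission
  imports Defs "HOL-Probability.Characteristic_Functions"
begin

text \<open>Write \<open>d\<close> for the dimension, \<open>\<sigma>\<close> for surface measure on the unit sphere, \<open>\<beta> = (d - 1) / 2\<close>,
\<open>s = (1 - \<alpha>) / 2 + \<epsilon>\<close> and \<open>e(t) = cis (2 \<pi> t)\<close>. The estimate holds because \<open>\<sigma>\<close> has a decaying Fourier transform,
\<open>\<bar>\<sigma>^(\<xi>)\<bar> \<le> A (1 + \<bar>\<xi>\<bar>) powr - \<beta>\<close>, and this decay is used three times at each frequency.

Choosing for every \<open>x\<close> a radius \<open>r(x)\<close> at which the supremum is almost attained replaces the maximal
function by the linear operator \<open>T f(x) = S f(x, r(x))\<close>, which is to be bounded from \<open>W\<^bsup>2,s\<^esup>\<close> to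
\<open>L\<^sup>2(\<mu>)\<close> with a constant independent of \<open>r\<close>. Fourier inversion turns \<open>T f(x)\<close> into the integral of
\<open>f^(\<xi>) \<sigma>^(r(x) \<xi>) e(x \<bullet> \<xi>)\<close>. Pairing with \<open>g = cnj (T f)\<close> and separating \<open>f^\<close> from the rest leaves the
dual inequality: for \<open>G(\<xi>) = \<integral> g(x) \<sigma>^(r(x) \<xi>) e(x \<bullet> \<xi>) d\<mu>(x)\<close>, the integral of
\<open>(1 + \<bar>\<xi>\<bar>\<^sup>2) powr - s * \<bar>G(\<xi>)\<bar>\<^sup>2\<close> is at most a constant times \<open>\<integral> \<bar>g\<bar>\<^sup>2 d\<mu>\<close>
(\<open>weighted_extension_dual\<close>).

In polar coordinates \<open>\<xi> = \<rho> \<omega>\<close> the factor \<open>\<sigma>^(r(x) \<rho> \<omega>)\<close> does not depend on \<open>\<omega>\<close>, so it can be absorbed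
into \<open>g\<close>; the integral over the sphere becomes a quadratic form with kernel \<open>\<sigma>^(\<rho> (x - y))\<close>. As
\<open>\<alpha> < \<beta>\<close>, the ball condition gives \<open>\<integral> (1 + \<rho> \<bar>x - y\<bar>) powr - \<beta> d\<mu>(y) \<le> K (1 + \<rho>) powr - \<alpha>\<close>, and the
Schur test bounds the quadratic form by this number (\<open>sphere_restriction\<close>). The two absorbed factors
contribute \<open>\<rho> powr - 2 \<beta>\<close>, since \<open>r(x)\<close> stays away from \<open>0\<close>, and cancel the Jacobian \<open>\<rho> ^ (d - 1)\<close>. There
remains the integral of \<open>(1 + \<rho>) powr (- 2 s - \<alpha>)\<close> over \<open>\<rho> > 0\<close>, which converges because
\<open>2 s + \<alpha> = 1 + 2 \<epsilon>\<close>.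

The decay of \<open>\<sigma>^\<close> is read off a differential equation: its radial profile \<open>J\<close> solves
\<open>J'' + (d - 1) / R J' + J = 0\<close>, so that \<open>v = R powr \<beta> * J\<close> is a small perturbation of a harmonic
oscillator and has bounded energy (\<open>sphere_cos_decay\<close>).

Inversion is applied to Gaussian mollifications of \<open>f\<close> only, where it is Fubini's theorem and the
Fourier transform of a Gaussian. All bounds are uniform in the mollification parameter, which is
removed by Fatou's lemma. The passage from the exponent \<open>2\<close> to \<open>q < 2\<close> costs a factor that depends on
the total mass of \<open>\<mu>\<close>.\<close>

section \<open>Surface measure on the sphere\<close>

text \<open>Surface measure as a Borel measure on the whole space, so that Borel functions on \<open>real^'n\<close> can be
integrated against it without restricting them to the sphere.\<close>

definition surf :: "(real^'n::finite) measure" where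
  "surf = distr sphere_measure borel (\<lambda>x. x)"

lemma sets_surf [simp, measurable_cong]: "sets surf = sets borel"
  and space_surf [simp]: "space surf = UNIV"
  by (simp_all add: surf_def)

lemma sets_sphere_measure:
  "sets (sphere_measure :: (real^'n::finite) measure) = sets (restrict_space borel (sphere 0 1))"
  by (simp add: sphere_measure_def)

lemma measurable_sphere_measure:
  "h \<in> measurable borel N \<Longrightarrow> h \<in> measurable sphere_measure N"
  using measurable_cong_sets[OF sets_sphere_measure refl] measurable_restrict_space1 by blast

lemma nn_integral_surf:
  fixes h :: "real^'n::finite \<Rightarrow> ennreal"
  assumes [measurable]: "h \<in> borel_measurable borel"
  shows "(\<integral>\<^sup>+\<omega>. h \<omega> \<partial>surf) =
    of_nat CARD('n) * (\<integral>\<^sup>+x. h (x /\<^sub>R norm x) * indicator (ball 0 1 - {0}) x \<partial>lborel)"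
proof -
  let ?B = "ball 0 1 - {0} :: (real^'n) set"
  let ?g = "\<lambda>x::real^'n. x /\<^sub>R norm x"
  let ?R = "restrict_space lborel ?B :: (real^'n) measure"
  have g: "?g \<in> measurable ?R (restrict_space borel (sphere 0 1))"
    by (intro measurable_restrict_space2 measurable_restrict_space1)
       (auto simp: space_restrict_space)
  have h: "h \<in> borel_measurable (restrict_space borel (sphere 0 1))"
    by (intro measurable_restrict_space1) simp
  have "(\<integral>\<^sup>+\<omega>. h \<omega> \<partial>surf) = (\<integral>\<^sup>+\<omega>. h \<omega> \<partial>sphere_measure)"
    unfolding surf_def
    by (rule nn_integral_distr) (use measurable_sphere_measure[of "\<lambda>x. x" borel] in simp_all)
  also have "\<dots> = of_nat CARD('n) *
      (\<integral>\<^sup>+\<omega>. h \<omega> \<partial>distr ?R (restrict_space borel (sphere 0 1)) ?g)"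
    unfolding sphere_measure_def by (subst nn_integral_scale_measure) (use h in auto)
  also have "(\<integral>\<^sup>+\<omega>. h \<omega> \<partial>distr ?R (restrict_space borel (sphere 0 1)) ?g)
      = (\<integral>\<^sup>+x. h (?g x) \<partial>?R)"
    by (rule nn_integral_distr[OF g]) (use h in auto)
  also have "\<dots> = (\<integral>\<^sup>+x. h (?g x) * indicator ?B x \<partial>lborel)"
    by (rule nn_integral_restrict_space) auto
  finally show ?thesis .
qed

lemma AE_surf: "AE \<omega> in (surf :: (real^'n::finite) measure). norm \<omega> = 1"
proof -
  have "emeasure (surf :: (real^'n) measure) {\<omega>. norm \<omega> \<noteq> 1}
      = (\<integral>\<^sup>+\<omega>. indicator {\<omega>. norm \<omega> \<noteq> 1} \<omega> \<partial>(surf :: (real^'n) measure))"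
    by (subst nn_integral_indicator) auto
  also have "\<dots> = of_nat CARD('n) * (\<integral>\<^sup>+x. 0 \<partial>(lborel :: (real^'n) measure))"
  proof -
    have "indicator {\<omega>. norm \<omega> \<noteq> 1} (x /\<^sub>R norm x) * indicator (ball 0 1 - {0}) x = (0::ennreal)"
      for x :: "real^'n"
      by (auto simp: indicator_def)
    then show ?thesis by (subst nn_integral_surf[of "indicator {\<omega>. norm \<omega> \<noteq> 1}"]) (measurable, simp only:)
  qed
  finally have "{\<omega>::real^'n. norm \<omega> \<noteq> 1} \<in> null_sets surf"
    by (auto simp: null_sets_def)
  then show ?thesis by (rule AE_I') auto
qed

lemma finite_measure_surf: "finite_measure (surf :: (real^'n::finite) measure)"
proof
  have "emeasure (surf :: (real^'n) measure) (space surf) = (\<integral>\<^sup>+\<omega>. 1 \<partial>(surf :: (real^'n) measure))"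
    by simp
  also have "\<dots> = of_nat CARD('n) * (\<integral>\<^sup>+x. 1 * indicator (ball 0 1 - {0}) x \<partial>(lborel :: (real^'n) measure))"
    by (subst nn_integral_surf) auto
  also have "(\<integral>\<^sup>+x. 1 * indicator (ball 0 1 - {0}) x \<partial>(lborel :: (real^'n) measure))
      = emeasure lborel (ball 0 1 - {0 :: real^'n})"
    by simp
  finally have "emeasure (surf :: (real^'n) measure) (space surf)
      = of_nat CARD('n) * emeasure lborel (ball 0 1 - {0 :: real^'n})" .
  moreover have "emeasure lborel (ball 0 1 - {0 :: real^'n}) < \<infinity>"
    using emeasure_mono[of "ball 0 1 - {0 :: real^'n}" "ball 0 1" lborel]
      emeasure_lborel_ball_finite[of "0::real^'n" 1] by (auto simp: less_le_trans le_less_trans)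
  ultimately show "emeasure (surf :: (real^'n) measure) (space surf) \<noteq> \<infinity>"
    by (auto simp: ennreal_mult_eq_top_iff)
qed

interpretation surf: finite_measure "surf :: (real^'n::finite) measure"
  by (rule finite_measure_surf)

lemma spherical_avg_eq_surf:
  fixes f :: "real^'n::finite \<Rightarrow> complex"
  assumes [measurable]: "f \<in> borel_measurable borel"
  shows "spherical_avg f x r = (\<integral>\<omega>. f (x - r *\<^sub>R \<omega>) \<partial>surf)"
  unfolding spherical_avg_def surf_def
  by (rule integral_distr[symmetric]) (use measurable_sphere_measure[of "\<lambda>x. x" borel] in simp_all)

text \<open>An orthogonal image of Lebesgue measure is translation invariant, and a translation invariant measure
is determined by its value on the unit ball, which orthogonal maps preserve.
Uniqueness is seen by evaluating one double integral in two ways.\<close>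

lemma lborel_orthogonal:
  fixes T :: "real^'n::finite \<Rightarrow> real^'n"
  assumes T: "orthogonal_transformation T"
  shows "distr lborel borel T = lborel"
proof (rule measure_eqI)
  have lin: "linear T" using T by (simp add: orthogonal_transformation_linear)
  then have "continuous_on UNIV T" by (simp add: linear_continuous_on linear_conv_bounded_linear)
  then have [measurable]: "T \<in> borel_measurable borel" by (rule borel_measurable_continuous_onI)
  have nT: "norm (T x) = norm x" for x using orthogonal_transformation_norm[OF T] .
  let ?\<mu> = "distr lborel borel T"
  let ?B = "ball 0 1 :: (real^'n) set"
  have translate: "(\<integral>\<^sup>+x. h (x + a) \<partial>lborel) = (\<integral>\<^sup>+x. h x \<partial>lborel)"
    if [measurable]: "h \<in> borel_measurable borel" for h :: "real^'n \<Rightarrow> ennreal" and a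
  proof -
    have "(\<integral>\<^sup>+x. h x \<partial>lborel) = (\<integral>\<^sup>+x. h x \<partial>distr lborel borel ((+) a))"
      by (simp add: lborel_distr_plus)
    then show ?thesis by (simp add: nn_integral_distr add.commute)
  qed
  have translate\<mu>: "(\<integral>\<^sup>+x. h (x + a) \<partial>?\<mu>) = (\<integral>\<^sup>+x. h x \<partial>?\<mu>)"
    if [measurable]: "h \<in> borel_measurable borel" for h :: "real^'n \<Rightarrow> ennreal" and a
  proof -
    obtain b where b: "T b = a" using orthogonal_transformation_surj[OF T] by (metis surjD)
    have "(\<integral>\<^sup>+x. h (x + a) \<partial>?\<mu>) = (\<integral>\<^sup>+x. h (T (x + b)) \<partial>lborel)"
      using lin b by (simp add: nn_integral_distr linear_add)
    also have "\<dots> = (\<integral>\<^sup>+x. h (T x) \<partial>lborel)" by (rule translate) measurable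
    finally show ?thesis by (simp add: nn_integral_distr)
  qed
  interpret \<mu>: sigma_finite_measure ?\<mu>
  proof
    let ?A = "range (\<lambda>n. ball 0 (real n)) :: (real^'n) set set"
    have "emeasure ?\<mu> (ball 0 (real n)) \<noteq> \<infinity>" for n
    proof -
      have "T -` ball 0 (real n) = ball 0 (real n)" by (auto simp: nT)
      then show ?thesis using emeasure_lborel_ball_finite[of "0::real^'n" "real n"]
        by (simp add: emeasure_distr)
    qed
    moreover have "\<Union>?A = space ?\<mu>" by (auto intro: reals_Archimedean2)
    ultimately show "\<exists>A. countable A \<and> A \<subseteq> sets ?\<mu> \<and> \<Union>A = space ?\<mu> \<and> (\<forall>a\<in>A. emeasure ?\<mu> a \<noteq> \<infinity>)"
      by (intro exI[of _ ?A]) auto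
  qed
  interpret P: pair_sigma_finite lborel ?\<mu> by standard
  have pair: "measurable (lborel \<Otimes>\<^sub>M ?\<mu>) N = measurable (borel \<Otimes>\<^sub>M borel) N" for N :: "ennreal measure"
    by (rule measurable_cong_sets) (auto intro: sets_pair_measure_cong)
  fix A assume "A \<in> sets ?\<mu>"
  then have [measurable]: "A \<in> sets borel" by simp
  have [measurable]: "?B \<in> sets borel" by simp
  \<comment> \<open>The two ways of evaluating the double integral of \<open>1\<^sub>B(x) 1\<^sub>A(x + y)\<close>: over \<open>y\<close> first, or after shifting \<open>x\<close> by \<open>y\<close>.\<close>
  have "emeasure ?\<mu> ?B * emeasure lborel A
      = (\<integral>\<^sup>+x. indicator ?B x * emeasure lborel A \<partial>?\<mu>)"
  proof -
    have "(indicator ?B :: _ \<Rightarrow> ennreal) \<in> borel_measurable ?\<mu>"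
      by (rule borel_measurable_indicator) simp
    then show ?thesis
      by (subst nn_integral_multc) simp_all
  qed
  also have "\<dots> = (\<integral>\<^sup>+x. (\<integral>\<^sup>+y. indicator ?B x * indicator A (y + x) \<partial>lborel) \<partial>?\<mu>)"
    using translate[of "indicator A"] by (simp add: nn_integral_cmult)
  also have "\<dots> = (\<integral>\<^sup>+y. (\<integral>\<^sup>+x. indicator ?B x * indicator A (y + x) \<partial>?\<mu>) \<partial>lborel)"
    by (rule P.Fubini', unfold pair) measurable
  also have "\<dots> = (\<integral>\<^sup>+y. (\<integral>\<^sup>+x. indicator ?B (y - x) * indicator A x \<partial>?\<mu>) \<partial>lborel)"
  proof (rule nn_integral_cong)
    fix y :: "real^'n"
    have "indicator ?B x * indicator A (y + x) = indicator ?B (y - (x + y)) * (indicator A (x + y) :: ennreal)" for x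
      by (simp add: add.commute indicator_def)
    then show "(\<integral>\<^sup>+x. indicator ?B x * indicator A (y + x) \<partial>?\<mu>)
        = (\<integral>\<^sup>+x. indicator ?B (y - x) * indicator A x \<partial>?\<mu>)"
      using translate\<mu>[of "\<lambda>x. indicator ?B (y - x) * indicator A x" y] by simp
  qed
  also have "\<dots> = (\<integral>\<^sup>+x. (\<integral>\<^sup>+y. indicator ?B (y - x) * indicator A x \<partial>lborel) \<partial>?\<mu>)"
    by (rule P.Fubini'[symmetric], unfold pair) measurable
  also have "\<dots> = (\<integral>\<^sup>+x. emeasure lborel ?B * indicator A x \<partial>?\<mu>)"
    using translate[of "indicator ?B" "- x" for x] by (simp add: nn_integral_multc)
  also have "\<dots> = emeasure lborel ?B * emeasure ?\<mu> A"
    by (simp add: nn_integral_cmult)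
  finally have "emeasure ?\<mu> ?B * emeasure lborel A = emeasure lborel ?B * emeasure ?\<mu> A" .
  moreover have "emeasure ?\<mu> ?B = emeasure lborel ?B"
  proof -
    have "T -` ?B = ?B" by (auto simp: nT)
    then show ?thesis by (simp add: emeasure_distr)
  qed
  moreover have "emeasure lborel ?B \<noteq> 0"
    using emeasure_ball[of 1 "0::real^'n"] less_imp_neq[OF unit_ball_vol_pos[of "real CARD('n)"]] by simp
  moreover have "emeasure lborel ?B \<noteq> top"
    using emeasure_lborel_ball_finite[of "0::real^'n" 1] by simp
  ultimately show "emeasure ?\<mu> A = emeasure lborel A"
    by (simp add: ennreal_mult_cancel_left)
qed simp

text \<open>Orthogonal maps commute with the radial projection onto the sphere.\<close>

lemma surf_orthogonal:
  fixes T :: "real^'n::finite \<Rightarrow> real^'n"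
  assumes T: "orthogonal_transformation T"
  shows "distr surf borel T = surf"
proof (rule measure_eqI)
  have lin: "linear T" using T by (simp add: orthogonal_transformation_linear)
  then have "continuous_on UNIV T" by (simp add: linear_continuous_on linear_conv_bounded_linear)
  then have [measurable]: "T \<in> borel_measurable borel" by (rule borel_measurable_continuous_onI)
  fix A assume "A \<in> sets (distr surf borel T)"
  then have [measurable]: "A \<in> sets borel" by simp
  let ?B = "ball 0 1 - {0} :: (real^'n) set"
  have [measurable]: "?B \<in> sets borel" by simp
  have nT: "norm (T x) = norm x" for x using orthogonal_transformation_norm[OF T] .
  have sc: "T (x /\<^sub>R norm x) = T x /\<^sub>R norm (T x)" for x
    using lin by (simp add: nT linear_scale)
  have "emeasure (distr surf borel T) A = (\<integral>\<^sup>+\<omega>. indicator A \<omega> \<partial>distr surf borel T)"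
    by simp
  also have "\<dots> = (\<integral>\<^sup>+\<omega>. indicator A (T \<omega>) \<partial>surf)"
    by (rule nn_integral_distr) auto
  also have "\<dots> = of_nat CARD('n) * (\<integral>\<^sup>+x. indicator A (T (x /\<^sub>R norm x)) * indicator ?B x \<partial>lborel)"
    by (subst nn_integral_surf) auto
  also have "(\<integral>\<^sup>+x. indicator A (T (x /\<^sub>R norm x)) * indicator ?B x \<partial>lborel)
      = (\<integral>\<^sup>+x. indicator A (T x /\<^sub>R norm (T x)) * indicator ?B (T x) \<partial>lborel)"
  proof (rule nn_integral_cong)
    fix x
    have "indicator ?B (T x) = (indicator ?B x :: ennreal)"
      using nT[of x] by (auto simp: indicator_def)
    then show "indicator A (T (x /\<^sub>R norm x)) * indicator ?B x
        = (indicator A (T x /\<^sub>R norm (T x)) * indicator ?B (T x) :: ennreal)"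
      by (simp add: sc)
  qed
  also have "\<dots> = (\<integral>\<^sup>+x. indicator A (x /\<^sub>R norm x) * indicator ?B x \<partial>distr lborel borel T)"
    by (rule nn_integral_distr[symmetric]) (simp, measurable)
  also have "\<dots> = (\<integral>\<^sup>+x. indicator A (x /\<^sub>R norm x) * indicator ?B x \<partial>lborel)"
    by (simp add: lborel_orthogonal[OF T])
  also have "of_nat CARD('n) * \<dots> = (\<integral>\<^sup>+\<omega>. indicator A \<omega> \<partial>surf)"
    by (rule nn_integral_surf[symmetric]) auto
  finally show "emeasure (distr surf borel T) A = emeasure surf A"
    by simp
qed simp

section \<open>Polar coordinates\<close>

lemma nn_integral_powr_tail:
  fixes a p :: real
  assumes "0 < a" "1 < p"
  shows "(\<integral>\<^sup>+t. ennreal (t powr (- p)) * indicator {a<..} t \<partial>lborel)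
    = ennreal (a powr (1 - p) / (p - 1))"
proof -
  have "(\<integral>\<^sup>+t. ennreal (t powr (- p)) * indicator {a<..} t \<partial>lborel)
      = (\<integral>\<^sup>+t. ennreal (t powr (- p)) * indicator {a..} t \<partial>lborel)"
    by (rule nn_integral_cong_AE) (use AE_lborel_singleton[of a] in eventually_elim, auto simp: indicator_def)
  also have "\<dots> = ennreal (0 - (- (a powr (1 - p) / (p - 1))))"
  proof (rule nn_integral_FTC_atLeast)
    fix x assume "a \<le> x"
    then have "((\<lambda>x. x powr (1 - p)) has_real_derivative (1 - p) * x powr (1 - p - 1)) (at x)"
      using assms by (intro has_real_derivative_powr) auto
    from DERIV_minus[OF DERIV_cdivide[OF this, of "p - 1"]]
    show "((\<lambda>x. - (x powr (1 - p) / (p - 1))) has_real_derivative x powr - p) (at x)"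
      using assms by (auto elim!: DERIV_cong simp: field_simps)
    show "0 \<le> x powr - p" by simp
  next
    have "((\<lambda>x. x powr (1 - p)) \<longlongrightarrow> 0) at_top"
      by (rule tendsto_neg_powr) (use assms in \<open>auto intro: filterlim_ident\<close>)
    then have "((\<lambda>x. - (x powr (1 - p) / (p - 1))) \<longlongrightarrow> - (0 / (p - 1))) at_top"
      by (intro tendsto_intros) (use assms in auto)
    then show "((\<lambda>x. - (x powr (1 - p) / (p - 1))) \<longlongrightarrow> 0) at_top" by simp
  qed simp
  finally show ?thesis by simp
qed

text \<open>By definition \<open>surf\<close> integrates over the punctured unit ball after radial projection, so the right-hand
side is a double integral over \<open>\<rho> > 0\<close> and \<open>\<bar>x\<bar> < 1\<close>. Substituting \<open>\<rho> = t \<bar>x\<bar>\<close> and then \<open>x = y / t\<close>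
makes \<open>F\<close> depend on \<open>y\<close> alone; the remaining integral over \<open>t > \<bar>y\<bar>\<close> is
\<open>\<bar>y\<bar> ^ d * \<integral> t powr - (d + 1) = 1 / d\<close>, which cancels the factor \<open>d\<close> in the definition of \<open>surf\<close>.\<close>

theorem nn_integral_polar:
  fixes F :: "real^'n::finite \<Rightarrow> ennreal"
  assumes [measurable]: "F \<in> borel_measurable borel"
  shows "(\<integral>\<^sup>+x. F x \<partial>lborel) =
    (\<integral>\<^sup>+\<rho>. ennreal (\<rho> ^ (CARD('n) - 1)) * indicator {0<..} \<rho> * (\<integral>\<^sup>+\<omega>. F (\<rho> *\<^sub>R \<omega>) \<partial>surf) \<partial>lborel)"
proof -
  let ?d = "CARD('n)"
  let ?D = "of_nat ?d :: ennreal"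
  let ?B = "ball 0 1 - {0} :: (real^'n) set"
  let ?P = "{0<..} :: real set"
  have d: "?d = Suc (?d - 1)" by simp
  have [measurable]: "?B \<in> sets borel" by simp
  have cancel_powers: "(1 / t) ^ Suc m * (t ^ m * (a / t) ^ Suc m) = a ^ Suc m / t ^ (Suc m + 1)"
    if "0 < t" for m and t a :: real
    using that by (simp add: power_divide field_simps)
  have pull: "(\<integral>\<^sup>+x. F (\<rho> *\<^sub>R (x /\<^sub>R norm x)) * indicator ?B x \<partial>lborel) * c
     = (\<integral>\<^sup>+x. c * F (\<rho> *\<^sub>R (x /\<^sub>R norm x)) * indicator ?B x \<partial>lborel)" for \<rho> c
    by (subst nn_integral_multc[symmetric]) (auto simp: ac_simps)
  have radial: "(\<integral>\<^sup>+\<rho>. ennreal (\<rho> ^ (?d - 1)) * indicator ?P \<rho> * F (\<rho> *\<^sub>R (x /\<^sub>R norm x)) * indicator ?B x \<partial>lborel)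
      = (\<integral>\<^sup>+t. ennreal (t ^ (?d - 1)) * indicator ?P t * ennreal (norm x ^ ?d) * F (t *\<^sub>R x) * indicator ?B x \<partial>lborel)" for x
  proof (cases "x \<in> ?B")
    case True
    then have x: "0 < norm x" by auto
    have "(\<integral>\<^sup>+\<rho>. ennreal (\<rho> ^ (?d - 1)) * indicator ?P \<rho> * F (\<rho> *\<^sub>R (x /\<^sub>R norm x)) * indicator ?B x \<partial>lborel)
       = ennreal \<bar>norm x\<bar> * (\<integral>\<^sup>+t. ennreal ((0 + norm x * t) ^ (?d - 1)) * indicator ?P (0 + norm x * t)
          * F ((0 + norm x * t) *\<^sub>R (x /\<^sub>R norm x)) * indicator ?B x \<partial>lborel)"
      by (rule nn_integral_real_affine) (use x in auto)
    also have "\<dots> = (\<integral>\<^sup>+t. ennreal (norm x) * (ennreal ((norm x * t) ^ (?d - 1)) * indicator ?P (norm x * t)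
          * F ((norm x * t) *\<^sub>R (x /\<^sub>R norm x)) * indicator ?B x) \<partial>lborel)"
      by (subst nn_integral_cmult[symmetric]) auto
    also have "\<dots> = (\<integral>\<^sup>+t. ennreal (t ^ (?d - 1)) * indicator ?P t * ennreal (norm x ^ ?d) * F (t *\<^sub>R x) * indicator ?B x \<partial>lborel)"
    proof (rule nn_integral_cong)
      fix t
      show "ennreal (norm x) * (ennreal ((norm x * t) ^ (?d - 1)) * indicator ?P (norm x * t)
          * F ((norm x * t) *\<^sub>R (x /\<^sub>R norm x)) * indicator ?B x)
        = ennreal (t ^ (?d - 1)) * indicator ?P t * ennreal (norm x ^ ?d) * F (t *\<^sub>R x) * indicator ?B x"
      proof (cases "0 < t")
        case True
        have "ennreal (norm x) * ennreal ((norm x * t) ^ (?d - 1)) = ennreal (t ^ (?d - 1)) * ennreal (norm x ^ ?d)"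
          using x True by (subst (2) d) (simp add: ennreal_mult[symmetric] power_mult_distrib ac_simps del: Suc_pred)
        moreover have "(norm x * t) *\<^sub>R (x /\<^sub>R norm x) = t *\<^sub>R x" using x by simp
        moreover have "indicator ?P (norm x * t) = (1::ennreal)" "indicator ?P t = (1::ennreal)"
          using x True by (auto simp: indicator_def)
        ultimately show ?thesis by (simp only: mult.assoc[symmetric] mult_1_right)
      next
        case False
        then have "indicator ?P (norm x * t) = (0::ennreal)" "indicator ?P t = (0::ennreal)"
          using x by (auto simp: indicator_def zero_less_mult_iff)
        then show ?thesis by simp
      qed
    qed
    finally show ?thesis .
  next
    case False
    then have "indicator ?B x = (0::ennreal)" by (rule indicator_simps(2))
    then show ?thesis by simp
  qed
  have scale: "(\<integral>\<^sup>+x. ennreal (t ^ (?d - 1)) * indicator ?P t * ennreal (norm x ^ ?d) * F (t *\<^sub>R x) * indicator ?B x \<partial>lborel)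
      = (\<integral>\<^sup>+y. ennreal (t powr (- (real ?d + 1))) * indicator {norm y<..} t * (ennreal (norm y ^ ?d) * F y * indicator (- {0}) y) \<partial>lborel)" for t
  proof (cases "0 < t")
    case True
    let ?h = "\<lambda>x. ennreal (t ^ (?d - 1)) * indicator ?P t * ennreal (norm x ^ ?d) * F (t *\<^sub>R x) * indicator ?B x"
    have "(\<integral>\<^sup>+x. ?h x \<partial>lborel)
        = (\<integral>\<^sup>+x. ?h x \<partial>density (distr lborel borel (\<lambda>x. 0 + (1 / t) *\<^sub>R x)) (\<lambda>_. ennreal (\<bar>1 / t\<bar> ^ DIM(real^'n))))"
      using True by (subst lborel_affine[of "1 / t" 0]) auto
    also have "\<dots> = (\<integral>\<^sup>+y. ennreal (\<bar>1 / t\<bar> ^ ?d) * ?h ((1 / t) *\<^sub>R y) \<partial>lborel)"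
      by (subst nn_integral_density) (auto simp: nn_integral_distr)
    also have "\<dots> = (\<integral>\<^sup>+y. ennreal (t powr (- (real ?d + 1))) * indicator {norm y<..} t * (ennreal (norm y ^ ?d) * F y * indicator (- {0}) y) \<partial>lborel)"
    proof (rule nn_integral_cong)
      fix y :: "real^'n"
      have "indicator ?B ((1 / t) *\<^sub>R y) = indicator {norm y<..} t * (indicator (- {0}) y :: ennreal)"
        using True by (auto simp: indicator_def)
      moreover have "ennreal (\<bar>1 / t\<bar> ^ ?d) * (ennreal (t ^ (?d - 1)) * ennreal (norm ((1 / t) *\<^sub>R y) ^ ?d))
          = ennreal (t powr (- (real ?d + 1))) * ennreal (norm y ^ ?d)"
      proof -
        have "(1 / t) ^ ?d * (t ^ (?d - 1) * (norm y / t) ^ ?d) = norm y ^ ?d / t ^ (?d + 1)"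
          using cancel_powers[OF True, of "?d - 1" "norm y"] by simp
        also have "\<dots> = t powr (- (real ?d + 1)) * norm y ^ ?d"
          using powr_realpow[OF True, of "?d + 1"]
          by (simp only: powr_minus of_nat_add of_nat_1 divide_inverse mult.commute)
        finally show ?thesis using True by (simp add: ennreal_mult[symmetric])
      qed
      moreover have "F (t *\<^sub>R (1 / t) *\<^sub>R y) = F y" using True by simp
      moreover have "indicator ?P t = (1 :: ennreal)" using True by simp
      ultimately show "ennreal (\<bar>1 / t\<bar> ^ ?d) * ?h ((1 / t) *\<^sub>R y)
        = ennreal (t powr (- (real ?d + 1))) * indicator {norm y<..} t * (ennreal (norm y ^ ?d) * F y * indicator (- {0}) y)"
        by (simp add: ac_simps)
    qed
    finally show ?thesis .
  next
    case False
    then have "indicator {norm y<..} t = (0::ennreal)" for y :: "real^'n"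
      using norm_ge_zero[of y] by (auto simp: indicator_def simp del: norm_ge_zero)
    then show ?thesis using False by simp
  qed
  have "(\<integral>\<^sup>+\<rho>. ennreal (\<rho> ^ (?d - 1)) * indicator ?P \<rho> * (\<integral>\<^sup>+\<omega>. F (\<rho> *\<^sub>R \<omega>) \<partial>surf) \<partial>lborel)
      = (\<integral>\<^sup>+\<rho>. ?D * (\<integral>\<^sup>+x. ennreal (\<rho> ^ (?d - 1)) * indicator ?P \<rho> * F (\<rho> *\<^sub>R (x /\<^sub>R norm x)) * indicator ?B x \<partial>lborel) \<partial>lborel)"
  proof (rule nn_integral_cong)
    fix \<rho> :: real
    let ?c = "ennreal (\<rho> ^ (?d - 1)) * indicator ?P \<rho>"
    have "(\<integral>\<^sup>+\<omega>. F (\<rho> *\<^sub>R \<omega>) \<partial>surf)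
        = ?D * (\<integral>\<^sup>+x. F (\<rho> *\<^sub>R (x /\<^sub>R norm x)) * indicator ?B x \<partial>lborel)"
      by (rule nn_integral_surf) measurable
    then show "?c * (\<integral>\<^sup>+\<omega>. F (\<rho> *\<^sub>R \<omega>) \<partial>surf)
        = ?D * (\<integral>\<^sup>+x. ?c * F (\<rho> *\<^sub>R (x /\<^sub>R norm x)) * indicator ?B x \<partial>lborel)"
      by (simp only: pull[symmetric]) (simp only: ac_simps)
  qed
  also have "\<dots> = ?D * (\<integral>\<^sup>+\<rho>. (\<integral>\<^sup>+x. ennreal (\<rho> ^ (?d - 1)) * indicator ?P \<rho> * F (\<rho> *\<^sub>R (x /\<^sub>R norm x)) * indicator ?B x \<partial>lborel) \<partial>lborel)"
    by (rule nn_integral_cmult) measurable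
  also have "(\<integral>\<^sup>+\<rho>. (\<integral>\<^sup>+x. ennreal (\<rho> ^ (?d - 1)) * indicator ?P \<rho> * F (\<rho> *\<^sub>R (x /\<^sub>R norm x)) * indicator ?B x \<partial>lborel) \<partial>lborel)
      = (\<integral>\<^sup>+x. (\<integral>\<^sup>+\<rho>. ennreal (\<rho> ^ (?d - 1)) * indicator ?P \<rho> * F (\<rho> *\<^sub>R (x /\<^sub>R norm x)) * indicator ?B x \<partial>lborel) \<partial>lborel)"
    by (rule lborel_pair.Fubini') measurable
  also have "\<dots> = (\<integral>\<^sup>+x. (\<integral>\<^sup>+t. ennreal (t ^ (?d - 1)) * indicator ?P t * ennreal (norm x ^ ?d) * F (t *\<^sub>R x) * indicator ?B x \<partial>lborel) \<partial>lborel)"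
    by (simp only: radial)
  also have "\<dots> = (\<integral>\<^sup>+t. (\<integral>\<^sup>+x. ennreal (t ^ (?d - 1)) * indicator ?P t * ennreal (norm x ^ ?d) * F (t *\<^sub>R x) * indicator ?B x \<partial>lborel) \<partial>lborel)"
    by (rule lborel_pair.Fubini') measurable
  also have "\<dots> = (\<integral>\<^sup>+t. (\<integral>\<^sup>+y. ennreal (t powr (- (real ?d + 1))) * indicator {norm y<..} t * (ennreal (norm y ^ ?d) * F y * indicator (- {0}) y) \<partial>lborel) \<partial>lborel)"
    by (simp only: scale)
  also have "\<dots> = (\<integral>\<^sup>+y. (\<integral>\<^sup>+t. ennreal (t powr (- (real ?d + 1))) * indicator {norm y<..} t * (ennreal (norm y ^ ?d) * F y * indicator (- {0}) y) \<partial>lborel) \<partial>lborel)"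
    unfolding indicator_def[of "{norm _<..}"] greaterThan_iff
    by (rule lborel_pair.Fubini') measurable
  also have "\<dots> = (\<integral>\<^sup>+y. (\<integral>\<^sup>+t. ennreal (t powr (- (real ?d + 1))) * indicator {norm y<..} t \<partial>lborel) * (ennreal (norm y ^ ?d) * F y * indicator (- {0}) y) \<partial>lborel)"
    by (subst nn_integral_multc) auto
  also have "?D * \<dots> = (\<integral>\<^sup>+y. ?D * ((\<integral>\<^sup>+t. ennreal (t powr (- (real ?d + 1))) * indicator {norm y<..} t \<partial>lborel) * (ennreal (norm y ^ ?d) * F y * indicator (- {0}) y)) \<partial>lborel)"
    unfolding indicator_def[of "{norm _<..}"] greaterThan_iff
    by (rule nn_integral_cmult[symmetric]) measurable
  also have "\<dots> = (\<integral>\<^sup>+y. F y \<partial>lborel)"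
  proof (rule nn_integral_cong_AE, use AE_lborel_singleton[of "0::real^'n"] in eventually_elim)
    fix y :: "real^'n" assume "y \<noteq> 0"
    then have y: "0 < norm y" by simp
    have "(\<integral>\<^sup>+t. ennreal (t powr (- (real ?d + 1))) * indicator {norm y<..} t \<partial>lborel)
        = ennreal (norm y powr (- real ?d) / real ?d)"
      using nn_integral_powr_tail[OF y, of "real ?d + 1"] by simp
    moreover have "?D * ennreal (norm y powr (- real ?d) / real ?d) * ennreal (norm y ^ ?d) = 1"
      using y by (simp add: ennreal_of_nat_eq_real_of_nat ennreal_mult[symmetric] powr_minus powr_realpow field_simps)
    ultimately show "?D * ((\<integral>\<^sup>+t. ennreal (t powr (- (real ?d + 1))) * indicator {norm y<..} t \<partial>lborel) * (ennreal (norm y ^ ?d) * F y * indicator (- {0}) y)) = F y"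
      using y by (simp add: mult.assoc[symmetric])
  qed
  finally show ?thesis ..
qed

section \<open>The Fourier transform of surface measure\<close>

lemma DERIV_of_quadratic_remainder:
  fixes f :: "real \<Rightarrow> real"
  assumes "\<And>h. \<bar>f (x + h) - f x - h * D\<bar> \<le> K * h\<^sup>2"
  shows "(f has_real_derivative D) (at x)"
  unfolding DERIV_def
proof (rule Lim_transform2[of "\<lambda>_. D" D])
  have "((\<lambda>h. D - (f (x + h) - f x) / h) \<longlongrightarrow> 0) (at 0)"
  proof (rule Lim_null_comparison)
    show "\<forall>\<^sub>F h in at 0. norm (D - (f (x + h) - f x) / h) \<le> K * \<bar>h\<bar>"
    proof (rule eventually_at_filter[THEN iffD2, OF always_eventually], intro allI impI)
      fix h :: real assume h: "h \<noteq> 0"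
      have "norm (D - (f (x + h) - f x) / h) = \<bar>f (x + h) - f x - h * D\<bar> / \<bar>h\<bar>"
        using h by (simp add: abs_divide[symmetric] diff_divide_distrib abs_minus_commute)
      also have "\<dots> \<le> K * h\<^sup>2 / \<bar>h\<bar>" using assms by (intro divide_right_mono) auto
      also have "\<dots> = K * \<bar>h\<bar>" using h by (simp add: power2_eq_square field_simps abs_if)
      finally show "norm (D - (f (x + h) - f x) / h) \<le> K * \<bar>h\<bar>" .
    qed
    show "((\<lambda>h. K * \<bar>h\<bar>) \<longlongrightarrow> 0) (at (0::real))"
      by (auto intro!: tendsto_eq_intros)
  qed
  then show "((\<lambda>h. D - (f (x + h) - f x) / h) \<longlongrightarrow> 0) (at 0)" .
qed simp

lemma cos_quadratic_remainder: "\<bar>cos (x + h) - cos x + h * sin x\<bar> \<le> (h::real)\<^sup>2"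
proof -
  have "cos (x + h) - cos x + h * sin x = cos x * (cos h - 1) + sin x * (h - sin h)"
    by (simp add: cos_add algebra_simps)
  moreover have "\<bar>cos h - 1\<bar> \<le> h\<^sup>2 / 2"
    using cos_double_sin[of "h / 2"] abs_sin_x_le_abs_x[of "h / 2"] abs_le_square_iff[of "sin (h / 2)" "h / 2"]
    by (simp add: power_divide)
  moreover have "\<bar>h - sin h\<bar> \<le> h\<^sup>2 / 2"
    using Maclaurin_sin_bound[of h 2] by (simp add: numeral_2_eq_2 sin_coeff_def abs_minus_commute)
  moreover have "\<bar>cos x * (cos h - 1)\<bar> \<le> \<bar>cos h - 1\<bar>" "\<bar>sin x * (h - sin h)\<bar> \<le> \<bar>h - sin h\<bar>"
    by (simp_all add: abs_mult mult_left_le_one_le)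
  ultimately show ?thesis by linarith
qed

context finite_measure
begin

lemma integrable_trig:
  fixes m a :: "'a \<Rightarrow> real"
  assumes [measurable]: "m \<in> borel_measurable M" "a \<in> borel_measurable M"
    and m: "AE \<omega> in M. \<bar>m \<omega>\<bar> \<le> 1"
  shows integrable_cos_weight: "integrable M (\<lambda>\<omega>. m \<omega> * cos (a \<omega>))"
    and integrable_sin_weight: "integrable M (\<lambda>\<omega>. m \<omega> * sin (a \<omega>))"
proof -
  show "integrable M (\<lambda>\<omega>. m \<omega> * cos (a \<omega>))"
    by (rule integrable_const_bound[of _ 1])
       (use m in \<open>auto elim!: eventually_mono simp: abs_mult intro!: mult_le_one\<close>)
  show "integrable M (\<lambda>\<omega>. m \<omega> * sin (a \<omega>))"
    by (rule integrable_const_bound[of _ 1])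
       (use m in \<open>auto elim!: eventually_mono simp: abs_mult intro!: mult_le_one\<close>)
qed

text \<open>Differentiation under the integral sign; the remainder is quadratic uniformly in \<open>\<omega>\<close>, so no limit
theorem for integrals is involved.\<close>

lemma DERIV_integral_cos:
  fixes m a k :: "'a \<Rightarrow> real"
  assumes [measurable]: "m \<in> borel_measurable M" "a \<in> borel_measurable M" "k \<in> borel_measurable M"
    and m: "AE \<omega> in M. \<bar>m \<omega>\<bar> \<le> 1" and k: "AE \<omega> in M. \<bar>k \<omega>\<bar> \<le> 1"
  shows "((\<lambda>t. \<integral>\<omega>. m \<omega> * cos (a \<omega> + t * k \<omega>) \<partial>M) has_real_derivative
     - (\<integral>\<omega>. m \<omega> * k \<omega> * sin (a \<omega> + x * k \<omega>) \<partial>M)) (at x)"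
proof (rule DERIV_of_quadratic_remainder)
  fix h
  have mk: "AE \<omega> in M. \<bar>m \<omega> * k \<omega>\<bar> \<le> 1"
    using m k by eventually_elim (auto simp: abs_mult intro!: mult_le_one)
  note i = integrable_cos_weight[OF _ _ m] integrable_sin_weight[OF _ _ mk]
  let ?r = "\<lambda>\<omega>. m \<omega> * cos (a \<omega> + (x + h) * k \<omega>) - m \<omega> * cos (a \<omega> + x * k \<omega>)
     - h * - (m \<omega> * k \<omega> * sin (a \<omega> + x * k \<omega>))"
  have int: "integrable M ?r" 
    by (intro Bochner_Integration.integrable_diff integrable_mult_right Bochner_Integration.integrable_minus i)
      measurable
  have "\<bar>(\<integral>\<omega>. ?r \<omega> \<partial>M)\<bar> \<le> (\<integral>\<omega>. h\<^sup>2 \<partial>M)"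
    unfolding real_norm_def[symmetric]
  proof (rule order_trans[OF integral_norm_bound integral_mono_AE[OF integrable_norm[OF int]]])
    show "AE \<omega> in M. norm (?r \<omega>) \<le> h\<^sup>2"
      using m k
    proof eventually_elim
      fix \<omega> assume b: "\<bar>m \<omega>\<bar> \<le> 1" "\<bar>k \<omega>\<bar> \<le> 1"
      let ?u = "a \<omega> + x * k \<omega>" and ?v = "h * k \<omega>"
      have "?r \<omega> = m \<omega> * (cos (?u + ?v) - cos ?u + ?v * sin ?u)"
        by (simp add: algebra_simps)
      then have "norm (?r \<omega>) \<le> 1 * (h * k \<omega>)\<^sup>2"
        unfolding real_norm_def abs_mult
        using b(1) cos_quadratic_remainder[of ?u ?v] by (metis abs_ge_zero abs_mult mult_mono zero_le_one)
      also have "\<dots> \<le> h\<^sup>2"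
        using b(2) abs_square_le_1[of "k \<omega>"] by (simp add: power_mult_distrib mult_left_le)
      finally show "norm (?r \<omega>) \<le> h\<^sup>2" .
    qed
  qed simp
  also have "(\<integral>\<omega>. ?r \<omega> \<partial>M) = (\<integral>\<omega>. m \<omega> * cos (a \<omega> + (x + h) * k \<omega>) \<partial>M)
      - (\<integral>\<omega>. m \<omega> * cos (a \<omega> + x * k \<omega>) \<partial>M) - h * - (\<integral>\<omega>. m \<omega> * k \<omega> * sin (a \<omega> + x * k \<omega>) \<partial>M)"
    using i by (simp add: integral_mult_right_zero)
  finally show "\<bar>(\<integral>\<omega>. m \<omega> * cos (a \<omega> + (x + h) * k \<omega>) \<partial>M)
      - (\<integral>\<omega>. m \<omega> * cos (a \<omega> + x * k \<omega>) \<partial>M) - h * - (\<integral>\<omega>. m \<omega> * k \<omega> * sin (a \<omega> + x * k \<omega>) \<partial>M)\<bar>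
      \<le> measure M (space M) * h\<^sup>2" by simp
qed

lemma DERIV_integral_sin:
  fixes m a k :: "'a \<Rightarrow> real"
  assumes [measurable]: "m \<in> borel_measurable M" "a \<in> borel_measurable M" "k \<in> borel_measurable M"
    and m: "AE \<omega> in M. \<bar>m \<omega>\<bar> \<le> 1" and k: "AE \<omega> in M. \<bar>k \<omega>\<bar> \<le> 1"
  shows "((\<lambda>t. \<integral>\<omega>. m \<omega> * sin (a \<omega> + t * k \<omega>) \<partial>M) has_real_derivative
     (\<integral>\<omega>. m \<omega> * k \<omega> * cos (a \<omega> + x * k \<omega>) \<partial>M)) (at x)"
proof -
  have s: "cos (a \<omega> - pi / 2 + t * k \<omega>) = sin (a \<omega> + t * k \<omega>)" for \<omega> t
    using sin_cos_eq[of "a \<omega> + t * k \<omega>"] cos_minus[of "pi / 2 - (a \<omega> + t * k \<omega>)"]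
    by (simp add: algebra_simps)
  have c: "sin (a \<omega> - pi / 2 + t * k \<omega>) = - cos (a \<omega> + t * k \<omega>)" for \<omega> t
    using cos_sin_eq[of "a \<omega> + t * k \<omega>"] sin_minus[of "pi / 2 - (a \<omega> + t * k \<omega>)"]
    by (simp add: algebra_simps)
  show ?thesis
    using DERIV_integral_cos[OF assms(1) _ assms(3) m k, of "\<lambda>\<omega>. a \<omega> - pi / 2" x] by (simp add: s c)
qed

end

text \<open>This is the Fourier transform of surface measure, up to a dilation of the frequency by \<open>2 \<pi>\<close>.\<close>

definition sphere_cos :: "real^'n::finite \<Rightarrow> real" where
  "sphere_cos \<eta> = (\<integral>\<omega>. cos (\<omega> \<bullet> \<eta>) \<partial>surf)"

lemma AE_surf_component: "AE \<omega> in surf. \<bar>(\<omega> :: real^'n::finite) $ i\<bar> \<le> 1"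
  using AE_surf by eventually_elim (metis component_le_norm_cart)

lemma sphere_cos_radial:
  fixes \<eta> \<eta>' :: "real^'n::finite"
  assumes "norm \<eta> = norm \<eta>'"
  shows "sphere_cos \<eta> = sphere_cos \<eta>'"
proof -
  obtain T where T: "orthogonal_transformation T" "T \<eta>' = \<eta>"
    using orthogonal_transformation_exists[of \<eta>' \<eta>] assms by metis
  have "continuous_on UNIV T"
    using T(1) by (simp add: orthogonal_transformation_linear linear_continuous_on linear_conv_bounded_linear[symmetric])
  then have [measurable]: "T \<in> borel_measurable borel" by (rule borel_measurable_continuous_onI)
  have "sphere_cos \<eta> = (\<integral>\<omega>. cos (\<omega> \<bullet> \<eta>) \<partial>distr surf borel T)"
    by (simp add: sphere_cos_def surf_orthogonal[OF T(1)])
  also have "\<dots> = (\<integral>\<omega>. cos (T \<omega> \<bullet> T \<eta>') \<partial>surf)" by (simp add: integral_distr T(2))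
  also have "\<dots> = sphere_cos \<eta>'" using T(1) by (simp add: sphere_cos_def orthogonal_transformation_def)
  finally show ?thesis .
qed

lemma abs_sphere_cos_le: "\<bar>sphere_cos (\<eta> :: real^'n::finite)\<bar> \<le> measure (surf :: (real^'n) measure) UNIV"
proof -
  have "norm (\<integral>\<omega>. cos (\<omega> \<bullet> \<eta>) \<partial>surf) \<le> (\<integral>\<omega>. 1 \<partial>(surf :: (real^'n) measure))"
    by (intro order_trans[OF integral_norm_bound] integral_mono_AE surf.integrable_const_bound[of _ 1]) auto
  then show ?thesis by (simp add: sphere_cos_def)
qed

text \<open>The antipodal symmetry of the sphere removes the imaginary part.\<close>

lemma integral_cis_surf:
  fixes \<eta> :: "real^'n::finite"
  shows "(\<integral>\<omega>. cis (\<omega> \<bullet> \<eta>) \<partial>surf) = of_real (sphere_cos \<eta>)"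
proof -
  have T: "orthogonal_transformation (\<lambda>x::real^'n. - x)"
    by (simp add: orthogonal_transformation_def linear_uminus)
  have int: "integrable surf (\<lambda>\<omega>. cis (\<omega> \<bullet> \<eta>))"
    by (rule surf.integrable_const_bound[of _ 1]) (auto simp: cis_conv_exp)
  have "(\<integral>\<omega>. sin (\<omega> \<bullet> \<eta>) \<partial>surf) = (\<integral>\<omega>. sin (\<omega> \<bullet> \<eta>) \<partial>distr surf borel (\<lambda>x. - x))"
    by (simp add: surf_orthogonal[OF T])
  also have "\<dots> = - (\<integral>\<omega>. sin (\<omega> \<bullet> \<eta>) \<partial>surf)" by (simp add: integral_distr)
  finally have "(\<integral>\<omega>. sin (\<omega> \<bullet> \<eta>) \<partial>surf) = 0" by simp
  then show ?thesis
    using integral_Re[OF int] integral_Im[OF int] by (auto simp: complex_eq_iff sphere_cos_def)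
qed

section \<open>Decay of the Fourier transform of surface measure\<close>

text \<open>The equation expresses that \<open>sphere_cos\<close> is a radial eigenfunction of the Laplacian. Differentiating
twice along the \<open>k\<close>-th axis brings down \<open>- \<omega>\<^sub>k\<^sup>2\<close>; differentiating at \<open>R e\<^sub>k\<close> in an orthogonal direction \<open>e\<^sub>i\<close>
brings down \<open>- \<omega>\<^sub>i\<^sup>2\<close> and, since the function is radial, gives \<open>J' R / R\<close>. The squares add up to \<open>1\<close>.\<close>

lemma sphere_cos_ode:
  fixes k :: "'n::finite"
  defines "J \<equiv> \<lambda>R. sphere_cos (R *\<^sub>R axis k 1 :: real^'n)"
  obtains J' J'' where "\<And>R. (J has_real_derivative J' R) (at R)"
    "\<And>R. (J' has_real_derivative J'' R) (at R)"
    "\<And>R. 0 < R \<Longrightarrow> J'' R = - J R - (real CARD('n) - 1) / R * J' R"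
proof -
  let ?S = "surf :: (real^'n) measure"
  define J' where "J' R = - (\<integral>\<omega>. \<omega> $ k * sin (R * \<omega> $ k) \<partial>?S)" for R
  define J'' where "J'' R = - (\<integral>\<omega>. \<omega> $ k * \<omega> $ k * cos (R * \<omega> $ k) \<partial>?S)" for R
  note [simp] = AE_surf_component
  have J_eq: "J = (\<lambda>R. \<integral>\<omega>. 1 * cos (0 + R * \<omega> $ k) \<partial>?S)"
    by (simp add: J_def sphere_cos_def inner_axis)
  have d1: "(J has_real_derivative J' R) (at R)" for R
    using surf.DERIV_integral_cos[of "\<lambda>_. 1" "\<lambda>_. 0" "\<lambda>\<omega>::real^'n. \<omega> $ k" R] unfolding J_eq J'_def by simp
  have d2: "(J' has_real_derivative J'' R) (at R)" for R
    using DERIV_minus[OF surf.DERIV_integral_sin[of "\<lambda>\<omega>::real^'n. \<omega> $ k" "\<lambda>_. 0" "\<lambda>\<omega>. \<omega> $ k" R]]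
    unfolding J'_def J''_def by simp
  have tangential: "(\<integral>\<omega>. \<omega> $ i * \<omega> $ i * cos (R * \<omega> $ k) \<partial>?S) = - J' R / R"
    if R: "0 < R" and i: "i \<noteq> k" for R i
  proof -
    let ?s = "\<lambda>h. sqrt (R\<^sup>2 + h\<^sup>2)"
    have s: "0 < ?s h" for h using R by (simp add: pos_add_strict add_pos_nonneg)
    \<comment> \<open>The function \<open>h \<mapsto> J (?s h)\<close> is differentiated twice at \<open>0\<close>, once through \<open>J\<close> and once under the integral.\<close>
    have radial: "(\<integral>\<omega>. 1 * cos (R * \<omega> $ k + h * \<omega> $ i) \<partial>?S) = J (?s h)" for h
    proof -
      have orth: "orthogonal (R *\<^sub>R axis k 1 :: real^'n) (h *\<^sub>R axis i 1)"
        using i by (simp add: orthogonal_def inner_axis_axis)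
      have "(norm (R *\<^sub>R axis k 1 + h *\<^sub>R axis i 1 :: real^'n))\<^sup>2 = R\<^sup>2 + h\<^sup>2"
        using norm_add_Pythagorean[OF orth] by (simp add: norm_axis_1)
      then have "norm (R *\<^sub>R axis k 1 + h *\<^sub>R axis i 1 :: real^'n) = ?s h"
        by (intro real_sqrt_unique[symmetric]) auto
      then have "sphere_cos (R *\<^sub>R axis k 1 + h *\<^sub>R axis i 1 :: real^'n) = J (?s h)"
        unfolding J_def by (intro sphere_cos_radial) (use s[of h] in simp)
      then show ?thesis by (simp add: sphere_cos_def inner_axis inner_add_right)
    qed
    have s': "(?s has_real_derivative h / ?s h) (at h)" for h
      using s[of h] by (auto intro!: derivative_eq_intros simp: field_simps)
    have K': "((\<lambda>h. J (?s h)) has_real_derivative - (\<integral>\<omega>. \<omega> $ i * sin (R * \<omega> $ k + h * \<omega> $ i) \<partial>?S)) (at h)" for h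
      using surf.DERIV_integral_cos[of "\<lambda>_. 1" "\<lambda>\<omega>::real^'n. R * \<omega> $ k" "\<lambda>\<omega>. \<omega> $ i" h] by (simp add: radial[simplified])
    have "((\<lambda>h. J (?s h)) has_real_derivative J' (?s h) * (h / ?s h)) (at h)" for h
      by (rule DERIV_chain2[OF d1 s'])
    from DERIV_unique[OF K' this]
    have eq: "(\<lambda>h. - (\<integral>\<omega>. \<omega> $ i * sin (R * \<omega> $ k + h * \<omega> $ i) \<partial>?S)) = (\<lambda>h. h * (J' (?s h) / ?s h))"
      by (simp add: fun_eq_iff ac_simps)
    have "((\<lambda>h. - (\<integral>\<omega>. \<omega> $ i * sin (R * \<omega> $ k + h * \<omega> $ i) \<partial>?S))
        has_real_derivative - (\<integral>\<omega>. \<omega> $ i * \<omega> $ i * cos (R * \<omega> $ k + 0 * \<omega> $ i) \<partial>?S)) (at 0)"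
      by (intro DERIV_minus surf.DERIV_integral_sin) auto
    moreover have "((\<lambda>h. h * (J' (?s h) / ?s h)) has_real_derivative J' (?s 0) / ?s 0) (at 0)"
    proof -
      have "((\<lambda>h. J' (?s h) / ?s h) has_real_derivative
          (J'' (?s 0) * (0 / ?s 0) * ?s 0 - J' (?s 0) * (0 / ?s 0)) / (?s 0 * ?s 0)) (at 0)"
        using s[of 0] by (intro DERIV_divide DERIV_chain2[OF d2] s') auto
      from DERIV_mult[OF DERIV_ident this] show ?thesis by simp
    qed
    ultimately have "- (\<integral>\<omega>. \<omega> $ i * \<omega> $ i * cos (R * \<omega> $ k + 0 * \<omega> $ i) \<partial>?S) = J' (?s 0) / ?s 0"
      unfolding eq by (rule DERIV_unique)
    then show ?thesis using R by simp
  qed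
  have "J'' R = - J R - (real CARD('n) - 1) / R * J' R" if R: "0 < R" for R
  proof -
    have int: "integrable ?S (\<lambda>\<omega>. \<omega> $ i * \<omega> $ i * cos (R * \<omega> $ k))" for i
      by (rule surf.integrable_cos_weight)
         (auto intro!: eventually_mono[OF AE_surf_component[of i]] simp: power2_eq_square[symmetric] abs_square_le_1)
    have "J R = (\<integral>\<omega>. (\<Sum>i\<in>UNIV. \<omega> $ i * \<omega> $ i * cos (R * \<omega> $ k)) \<partial>?S)"
      unfolding J_eq
    proof (rule integral_cong_AE)
      show "AE \<omega> in ?S. 1 * cos (0 + R * \<omega> $ k) = (\<Sum>i\<in>UNIV. \<omega> $ i * \<omega> $ i * cos (R * \<omega> $ k))"
        using AE_surf
      proof eventually_elim
        fix \<omega> :: "real^'n" assume "norm \<omega> = 1"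
        then have "(\<Sum>i\<in>UNIV. \<omega> $ i * \<omega> $ i) = 1"
          by (metis inner_vec_def inner_real_def norm_eq_1)
        then show "1 * cos (0 + R * \<omega> $ k) = (\<Sum>i\<in>UNIV. \<omega> $ i * \<omega> $ i * cos (R * \<omega> $ k))"
          by (simp add: sum_distrib_right[symmetric])
      qed
    qed auto
    also have "\<dots> = (\<Sum>i\<in>UNIV. \<integral>\<omega>. \<omega> $ i * \<omega> $ i * cos (R * \<omega> $ k) \<partial>?S)"
      by (rule Bochner_Integration.integral_sum) (rule int)
    also have "\<dots> = - J'' R + (\<Sum>i\<in>UNIV - {k}. - J' R / R)"
      by (subst sum.remove[of _ k]) (auto simp: J''_def tangential[OF R])
    also have "(\<Sum>i\<in>UNIV - {k}. - J' R / R) = (real CARD('n) - 1) * (- J' R / R)"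
      by (simp add: of_nat_diff)
    finally show ?thesis by (simp add: field_simps)
  qed
  with d1 d2 show thesis by (rule that)
qed

text \<open>With \<open>v = R powr \<beta> * J\<close> and \<open>c = \<beta> (\<beta> - 1)\<close> the equation becomes \<open>v'' = (c / R\<^sup>2 - 1) v\<close>. The energy
\<open>v\<^sup>2 + v'\<^sup>2\<close> has logarithmic derivative at most \<open>\<bar>c\<bar> / R\<^sup>2\<close>, which is integrable at infinity; hence \<open>v\<close> is
bounded on \<open>[1, \<infinity>)\<close>.\<close>

theorem sphere_cos_decay:
  obtains A where "0 < A"
    "\<And>\<eta> :: real^'n::finite. \<bar>sphere_cos \<eta>\<bar> \<le> A * (1 + norm \<eta>) powr (- ((real CARD('n) - 1) / 2))"
proof -
  define \<beta> where "\<beta> = (real CARD('n) - 1) / 2"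
  have d: "real CARD('n) \<ge> 1"
    using zero_less_card_finite[where 'a='n] by linarith
  then have \<beta>: "0 \<le> \<beta>" by (simp add: \<beta>_def)
  obtain k :: 'n where True by simp
  define J where "J R = sphere_cos (R *\<^sub>R axis k 1 :: real^'n)" for R
  obtain J' J'' where d1: "\<And>R. (J has_real_derivative J' R) (at R)"
    and d2: "\<And>R. (J' has_real_derivative J'' R) (at R)"
    and ode: "\<And>R. 0 < R \<Longrightarrow> J'' R = - J R - (real CARD('n) - 1) / R * J' R"
    using sphere_cos_ode[of k] unfolding J_def by metis
  define c where "c = \<beta> * (\<beta> - 1)"
  define v where "v R = R powr \<beta> * J R" for R
  define w where "w R = R powr \<beta> * (J' R + \<beta> * J R / R)" for R
  \<comment> \<open>The exponential makes the energy decreasing; it lies between \<open>1\<close> and \<open>exp \<bar>c\<bar>\<close> on \<open>[1, \<infinity>)\<close>.\<close>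
  define E where "E R = ((v R)\<^sup>2 + (w R)\<^sup>2) * exp (\<bar>c\<bar> / R)" for R
  have dp: "((\<lambda>R. R powr \<beta>) has_real_derivative \<beta> / R * R powr \<beta>) (at R)" if "0 < R" for R
    using has_real_derivative_powr[OF that, of \<beta>] that by (simp add: powr_diff)
  have dv: "(v has_real_derivative w R) (at R)" if "0 < R" for R
    unfolding v_def using DERIV_mult[OF dp[OF that] d1[of R]] that
    by (auto elim!: DERIV_cong simp: w_def algebra_simps)
  have dw: "(w has_real_derivative (c / R\<^sup>2 - 1) * v R) (at R)" if R: "0 < R" for R
  proof -
    have "((\<lambda>R. J' R + \<beta> * J R / R) has_real_derivative
        J'' R + (\<beta> * J' R * R - \<beta> * J R * 1) / (R * R)) (at R)"
      using R by (intro DERIV_add d2 DERIV_divide DERIV_cmult d1 DERIV_ident) auto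
    from DERIV_mult[OF dp[OF R] this]
    have "(w has_real_derivative \<beta> / R * R powr \<beta> * (J' R + \<beta> * J R / R)
        + (J'' R + (\<beta> * J' R * R - \<beta> * J R * 1) / (R * R)) * R powr \<beta>) (at R)"
      unfolding w_def .
    moreover have "\<beta> / R * R powr \<beta> * (J' R + \<beta> * J R / R)
        + (J'' R + (\<beta> * J' R * R - \<beta> * J R * 1) / (R * R)) * R powr \<beta> = (c / R\<^sup>2 - 1) * v R"
    proof -
      have "real CARD('n) - 1 = 2 * \<beta>" by (simp add: \<beta>_def)
      then have J'': "J'' R = - J R - 2 * \<beta> / R * J' R" using ode[OF R] by simp
      show ?thesis unfolding J'' v_def c_def using R by (simp add: field_simps power2_eq_square)
    qed
    ultimately show ?thesis by simp
  qed
  have dE: "\<exists>y. (E has_real_derivative y) (at R) \<and> y \<le> 0" if "1 \<le> R" for R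
  proof -
    have R: "0 < R" using that by simp
    define e where "e = exp (\<bar>c\<bar> / R)"
    have "((\<lambda>R. \<bar>c\<bar> / R) has_real_derivative - \<bar>c\<bar> / R\<^sup>2) (at R)"
      using R by (auto intro!: derivative_eq_intros simp: power2_eq_square)
    then have "((\<lambda>R. exp (\<bar>c\<bar> / R)) has_real_derivative e * (- \<bar>c\<bar> / R\<^sup>2)) (at R)"
      unfolding e_def by (rule DERIV_fun_exp)
    note de = this
    have dq: "((\<lambda>R. (v R)\<^sup>2 + (w R)\<^sup>2) has_real_derivative
        2 * v R * w R + 2 * w R * ((c / R\<^sup>2 - 1) * v R)) (at R)"
      using dv[OF R] dw[OF R] by (auto intro!: derivative_eq_intros)
    have "(E has_real_derivative
        (2 * v R * w R + 2 * w R * ((c / R\<^sup>2 - 1) * v R)) * e + e * (- \<bar>c\<bar> / R\<^sup>2) * ((v R)\<^sup>2 + (w R)\<^sup>2)) (at R)"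
      using DERIV_mult[OF dq de] unfolding E_def e_def .
    moreover have "(2 * v R * w R + 2 * w R * ((c / R\<^sup>2 - 1) * v R)) * e + e * (- \<bar>c\<bar> / R\<^sup>2) * ((v R)\<^sup>2 + (w R)\<^sup>2)
       = - (e / R\<^sup>2) * (\<bar>c\<bar> * ((v R)\<^sup>2 + (w R)\<^sup>2) - c * (2 * v R * w R))"
      using R by (simp add: field_simps)
    moreover have "c * (2 * v R * w R) \<le> \<bar>c\<bar> * ((v R)\<^sup>2 + (w R)\<^sup>2)"
    proof -
      have "\<bar>2 * v R * w R\<bar> \<le> (v R)\<^sup>2 + (w R)\<^sup>2"
        using sum_squares_bound[of "v R" "w R"] sum_squares_bound[of "v R" "- w R"] by (simp add: abs_le_iff)
      then have "\<bar>c * (2 * v R * w R)\<bar> \<le> \<bar>c\<bar> * ((v R)\<^sup>2 + (w R)\<^sup>2)"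
        by (subst abs_mult) (rule mult_left_mono, auto)
      then show ?thesis by linarith
    qed
    moreover have "0 \<le> e" by (simp add: e_def)
    ultimately show ?thesis
      by (intro exI[of _ "- (e / R\<^sup>2) * (\<bar>c\<bar> * ((v R)\<^sup>2 + (w R)\<^sup>2) - c * (2 * v R * w R))"])
         (auto intro!: divide_nonneg_nonneg mult_nonneg_nonneg)
  qed
  have vE: "\<bar>v R\<bar> \<le> sqrt (E 1)" if "1 \<le> R" for R
  proof -
    have "(v R)\<^sup>2 \<le> ((v R)\<^sup>2 + (w R)\<^sup>2) * 1" by simp
    also have "\<dots> \<le> E R" unfolding E_def using that by (intro mult_left_mono) auto
    also have "E R \<le> E 1"
      by (rule DERIV_nonpos_imp_nonincreasing[OF that]) (use dE in auto)
    finally show ?thesis using real_le_rsqrt by (metis power2_abs)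
  qed
  define m where "m = measure (surf :: (real^'n) measure) UNIV"
  define A where "A = (m + sqrt (E 1) + 1) * 2 powr \<beta>"
  have E1: "0 \<le> sqrt (E 1)" by (simp add: E_def)
  have m: "0 \<le> m" by (simp add: m_def)
  show thesis
  proof (rule that)
    show "0 < A" using E1 m by (simp add: A_def add_nonneg_pos)
    fix \<eta> :: "real^'n"
    define R where "R = norm \<eta>"
    have J: "sphere_cos \<eta> = J R" unfolding J_def R_def by (rule sphere_cos_radial) simp
    have R0: "0 \<le> R" by (simp add: R_def)
    have "\<bar>J R\<bar> \<le> A * (1 + R) powr (- \<beta>)"
    proof (cases "1 \<le> R")
      case True
      have "\<bar>J R\<bar> = R powr (- \<beta>) * \<bar>v R\<bar>"
        using True by (simp add: v_def abs_mult powr_minus)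
      also have "\<dots> \<le> R powr (- \<beta>) * (m + sqrt (E 1) + 1)"
        using vE[OF True] m by (intro mult_left_mono) auto
      also have "R powr (- \<beta>) = 2 powr \<beta> * (2 * R) powr (- \<beta>)"
        using True by (simp add: powr_mult powr_minus)
      also have "2 powr \<beta> * (2 * R) powr (- \<beta>) * (m + sqrt (E 1) + 1) = A * (2 * R) powr (- \<beta>)"
        by (simp add: A_def)
      also have "\<dots> \<le> A * (1 + R) powr (- \<beta>)"
        using True E1 m \<beta> by (intro mult_left_mono powr_mono2') (auto simp: A_def)
      finally show ?thesis .
    next
      case False
      have "\<bar>J R\<bar> \<le> m" unfolding J_def m_def by (rule abs_sphere_cos_le)
      also have "\<dots> \<le> (m + sqrt (E 1) + 1) * (2 powr \<beta> * 2 powr (- \<beta>))"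
        using E1 by (simp add: powr_minus)
      also have "\<dots> = A * 2 powr (- \<beta>)" by (simp add: A_def)
      also have "\<dots> \<le> A * (1 + R) powr (- \<beta>)"
        using False R0 E1 m \<beta> by (intro mult_left_mono powr_mono2') (auto simp: A_def)
      finally show ?thesis .
    qed
    then show "\<bar>sphere_cos \<eta>\<bar> \<le> A * (1 + norm \<eta>) powr (- ((real CARD('n) - 1) / 2))"
      by (simp add: J R_def \<beta>_def)
  qed
qed

section \<open>Measures with a power bound on balls\<close>

text \<open>Compact support of \<open>\<mu>\<close> is replaced by its consequence for the total mass, so that constants
depend on \<open>\<mu>\<close> only through the numbers \<open>m\<close>, \<open>C\<close> and \<open>\<alpha>\<close>.\<close>

locale ball_regular_measure =
  fixes \<mu> :: "(real^'n::finite) measure" and m C \<alpha> :: real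
  assumes sets_mu [simp, measurable_cong]: "sets \<mu> = sets borel"
    and mass: "emeasure \<mu> UNIV \<le> ennreal m"
    and ball: "\<And>x \<delta>. 0 < \<delta> \<Longrightarrow> emeasure \<mu> (ball x \<delta>) \<le> ennreal (C * \<delta> powr \<alpha>)"
    and nonneg: "0 \<le> m" "0 \<le> C" "0 < \<alpha>"
begin

lemma space_mu [simp]: "space \<mu> = UNIV"
  using sets_eq_imp_space_eq[OF sets_mu] by simp

sublocale finite_measure \<mu>
  using mass by (intro finite_measureI) (auto simp: top_unique)

text \<open>For \<open>\<rho> > 1\<close>, cover the space by the balls of radius \<open>2 ^ k / \<rho>\<close>. On the \<open>k\<close>-th dyadic shell the
integrand is about \<open>2 powr (- \<beta> k)\<close> and the mass at most \<open>C 2 powr (\<alpha> k) \<rho> powr - \<alpha>\<close>; the series converges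
as \<open>\<alpha> < \<beta>\<close>. For \<open>\<rho> \<le> 1\<close> the total mass is a sufficient bound.\<close>

lemma nn_integral_decay:
  fixes x :: "real^'n"
  assumes \<beta>: "\<alpha> < \<beta>" and \<rho>: "0 \<le> \<rho>"
  shows "(\<integral>\<^sup>+y. ennreal ((1 + \<rho> * norm (x - y)) powr (- \<beta>)) \<partial>\<mu>)
    \<le> ennreal ((m + C * 2 powr \<beta> / (1 - 2 powr (\<alpha> - \<beta>))) * 2 powr \<alpha> * (1 + \<rho>) powr (- \<alpha>))"
proof -
  define q where "q = 2 powr (\<alpha> - \<beta>)"
  have q: "0 < q" "q < 1" using \<beta> powr_less_mono[of "\<alpha> - \<beta>" 0 2] by (auto simp: q_def)
  define D where "D = C * 2 powr \<beta> / (1 - q)"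
  have D: "0 \<le> D" using q nonneg by (simp add: D_def)
  have *: "(\<integral>\<^sup>+y. ennreal ((1 + \<rho> * norm (x - y)) powr (- \<beta>)) \<partial>\<mu>) \<le> ennreal ((m + D) * 2 powr \<alpha> * (1 + \<rho>) powr (- \<alpha>))"
  proof (cases "\<rho> \<le> 1")
    case True
    have "(\<integral>\<^sup>+y. ennreal ((1 + \<rho> * norm (x - y)) powr (- \<beta>)) \<partial>\<mu>) \<le> (\<integral>\<^sup>+y. 1 \<partial>\<mu>)"
    proof (rule nn_integral_mono)
      fix y
      have "(1 + \<rho> * norm (x - y)) powr (- \<beta>) \<le> 1 powr (- \<beta>)"
        using \<rho> \<beta> nonneg by (intro powr_mono2') auto
      then show "ennreal ((1 + \<rho> * norm (x - y)) powr (- \<beta>)) \<le> 1" by simp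
    qed
    also have "\<dots> \<le> ennreal m" using mass by simp
    also have "m \<le> (m + D) * 2 powr \<alpha> * (1 + \<rho>) powr (- \<alpha>)"
    proof -
      have "(2::real) powr (- \<alpha>) \<le> (1 + \<rho>) powr (- \<alpha>)"
        using \<rho> True nonneg by (intro powr_mono2') auto
      then have "2 powr \<alpha> * 2 powr (- \<alpha>) \<le> 2 powr \<alpha> * (1 + \<rho>) powr (- \<alpha>)"
        by (intro mult_left_mono) auto
      then have "1 \<le> 2 powr \<alpha> * (1 + \<rho>) powr (- \<alpha>)" by (simp add: powr_minus)
      then have "(m + D) * 1 \<le> (m + D) * (2 powr \<alpha> * (1 + \<rho>) powr (- \<alpha>))"
        using D nonneg by (intro mult_left_mono) auto
      then show ?thesis using D by (simp add: mult.assoc)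
    qed
    then have "ennreal m \<le> ennreal ((m + D) * 2 powr \<alpha> * (1 + \<rho>) powr (- \<alpha>))" by (rule ennreal_leI)
    finally show ?thesis .
  next
    case False
    then have \<rho>1: "1 < \<rho>" by simp
    have single_le: "f k \<le> (\<Sum>k. f k)" for f :: "nat \<Rightarrow> ennreal" and k
      using sum_le_suminf[of f "{k}"] by simp
    have dyadic: "ennreal ((1 + \<rho> * norm (x - y)) powr (- \<beta>))
        \<le> (\<Sum>k. ennreal (2 powr (- \<beta> * (real k - 1))) * indicator (ball x (2 ^ k / \<rho>)) y)" for y
    proof -
      define z where "z = \<rho> * norm (x - y)"
      have z: "0 \<le> z" using \<rho> by (simp add: z_def)
      \<comment> \<open>The dyadic shell of \<open>y\<close>; the lower bound also holds for \<open>k = 0\<close> because of the summand \<open>1\<close>.\<close>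
      obtain k where k: "z < 2 ^ k" "2 powr (real k - 1) \<le> 1 + z"
      proof -
        define k where "k = (LEAST k. z < 2 ^ k)"
        obtain j where "z < 2 ^ j" using real_arch_pow[of 2 z] by auto
        then have k: "z < 2 ^ k" unfolding k_def by (rule LeastI)
        have "2 powr (real k - 1) \<le> 1 + z"
        proof (cases k)
          case 0
          have "2 powr (real 0 - 1) \<le> (2::real) powr 0" by (rule powr_mono) auto
          then show ?thesis using z 0 by simp
        next
          case (Suc l)
          then have "\<not> z < 2 ^ l" unfolding k_def by (metis lessI not_less_Least)
          then show ?thesis using Suc by (simp add: powr_realpow)
        qed
        with k show thesis by (rule that)
      qed
      have "(1 + z) powr (- \<beta>) \<le> (2 powr (real k - 1)) powr (- \<beta>)"
        using k \<beta> nonneg by (intro powr_mono2') auto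
      also have "\<dots> = 2 powr (- \<beta> * (real k - 1))" by (simp add: powr_powr ac_simps)
      finally have "ennreal ((1 + z) powr (- \<beta>)) \<le> ennreal (2 powr (- \<beta> * (real k - 1))) * indicator (ball x (2 ^ k / \<rho>)) y"
        using k(1) \<rho>1 by (auto simp: indicator_def z_def dist_norm field_simps intro: ennreal_leI)
      also have "\<dots> \<le> (\<Sum>k. ennreal (2 powr (- \<beta> * (real k - 1))) * indicator (ball x (2 ^ k / \<rho>)) y)"
        by (rule single_le)
      finally show ?thesis by (simp add: z_def)
    qed
    have "(\<integral>\<^sup>+y. ennreal ((1 + \<rho> * norm (x - y)) powr (- \<beta>)) \<partial>\<mu>)
        \<le> (\<integral>\<^sup>+y. (\<Sum>k. ennreal (2 powr (- \<beta> * (real k - 1))) * indicator (ball x (2 ^ k / \<rho>)) y) \<partial>\<mu>)"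
      by (rule nn_integral_mono) (rule dyadic)
    also have "\<dots> = (\<Sum>k. \<integral>\<^sup>+y. ennreal (2 powr (- \<beta> * (real k - 1))) * indicator (ball x (2 ^ k / \<rho>)) y \<partial>\<mu>)"
    proof (rule nn_integral_suminf)
      fix k
      have "ball x (2 ^ k / \<rho>) \<in> sets \<mu>" by simp
      then show "(\<lambda>y. ennreal (2 powr (- \<beta> * (real k - 1))) * indicator (ball x (2 ^ k / \<rho>)) y) \<in> borel_measurable \<mu>"
        by (intro borel_measurable_times_ennreal borel_measurable_const borel_measurable_indicator)
    qed
    also have "\<dots> = (\<Sum>k. ennreal (2 powr (- \<beta> * (real k - 1))) * emeasure \<mu> (ball x (2 ^ k / \<rho>)))"
      by (intro suminf_cong nn_integral_cmult_indicator) simp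
    also have "\<dots> \<le> (\<Sum>k. ennreal (C * 2 powr \<beta> * \<rho> powr (- \<alpha>) * q ^ k))"
    proof (intro suminf_le summableI)
      fix k
      have "ennreal (2 powr (- \<beta> * (real k - 1))) * emeasure \<mu> (ball x (2 ^ k / \<rho>))
          \<le> ennreal (2 powr (- \<beta> * (real k - 1))) * ennreal (C * (2 ^ k / \<rho>) powr \<alpha>)"
        using \<rho>1 by (intro mult_left_mono ball) auto
      also have "\<dots> = ennreal (2 powr (- \<beta> * (real k - 1)) * (C * (2 ^ k / \<rho>) powr \<alpha>))"
        using nonneg by (simp add: ennreal_mult)
      also have "2 powr (- \<beta> * (real k - 1)) * (C * (2 ^ k / \<rho>) powr \<alpha>)
          = C * 2 powr \<beta> * \<rho> powr (- \<alpha>) * q ^ k"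
      proof -
        have "(2 ^ k / \<rho>) powr \<alpha> = 2 powr (real k * \<alpha>) * \<rho> powr (- \<alpha>)"
        proof -
          have "(2 ^ k / \<rho>) powr \<alpha> = (2 powr real k) powr \<alpha> / \<rho> powr \<alpha>"
            using \<rho>1 by (subst powr_divide) (auto simp: powr_realpow)
          then show ?thesis by (simp add: powr_powr powr_minus divide_inverse)
        qed
        moreover have "q ^ k = 2 powr ((\<alpha> - \<beta>) * real k)"
          using powr_realpow[OF q(1), of k] by (simp add: q_def powr_powr)
        moreover have "2 powr (- \<beta> * (real k - 1)) * 2 powr (real k * \<alpha>) = 2 powr \<beta> * (2::real) powr ((\<alpha> - \<beta>) * real k)"
          by (simp add: powr_add[symmetric] algebra_simps)
        ultimately show ?thesis by (simp add: ac_simps)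
      qed
      finally show "ennreal (2 powr (- \<beta> * (real k - 1))) * emeasure \<mu> (ball x (2 ^ k / \<rho>))
          \<le> ennreal (C * 2 powr \<beta> * \<rho> powr (- \<alpha>) * q ^ k)" .
    qed
    also have "\<dots> = ennreal (C * 2 powr \<beta> * \<rho> powr (- \<alpha>) * (1 / (1 - q)))"
      using q nonneg by (intro suminf_ennreal_eq sums_mult geometric_sums) auto
    also have "\<dots> \<le> ennreal ((m + D) * 2 powr \<alpha> * (1 + \<rho>) powr (- \<alpha>))"
    proof (rule ennreal_leI)
      have "\<rho> powr (- \<alpha>) = 2 powr \<alpha> * (2 * \<rho>) powr (- \<alpha>)"
        using \<rho>1 by (simp add: powr_mult powr_minus)
      also have "\<dots> \<le> 2 powr \<alpha> * (1 + \<rho>) powr (- \<alpha>)"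
        using \<rho>1 nonneg by (intro mult_left_mono powr_mono2') auto
      finally have "D * \<rho> powr (- \<alpha>) \<le> (m + D) * (2 powr \<alpha> * (1 + \<rho>) powr (- \<alpha>))"
        using D nonneg by (intro mult_mono) auto
      then show "C * 2 powr \<beta> * \<rho> powr (- \<alpha>) * (1 / (1 - q)) \<le> (m + D) * 2 powr \<alpha> * (1 + \<rho>) powr (- \<alpha>)"
        by (simp add: D_def ac_simps)
    qed
    finally show ?thesis .
  qed
  show ?thesis using * unfolding D_def q_def .
qed

text \<open>The Schur test for a symmetric kernel: replace \<open>\<bar>h x\<bar> \<bar>h y\<bar>\<close> by \<open>(h x)\<^sup>2 / 2 + (h y)\<^sup>2 / 2\<close>. Both halves
contribute the same by symmetry.\<close>

lemma schur_test:
  fixes h S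
  assumes [measurable]: "h \<in> borel_measurable borel" "(\<lambda>(x, y). S x y) \<in> borel_measurable (borel \<Otimes>\<^sub>M borel)"
    and sym: "\<And>x y. S x y = S y x" and S: "\<And>x y. 0 \<le> S x y" and B: "\<And>x. (\<integral>\<^sup>+y. ennreal (S x y) \<partial>\<mu>) \<le> B"
  shows "(\<integral>\<^sup>+x. \<integral>\<^sup>+y. ennreal (\<bar>h x\<bar> * \<bar>h y\<bar> * S x y) \<partial>\<mu> \<partial>\<mu>) \<le> B * (\<integral>\<^sup>+x. ennreal ((h x)\<^sup>2) \<partial>\<mu>)"
proof -
  interpret P: pair_sigma_finite \<mu> \<mu> by standard
  have [measurable]: "(\<lambda>p. S (fst p) (snd p)) \<in> borel_measurable (borel \<Otimes>\<^sub>M borel)"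
    using assms(2) by (simp add: case_prod_beta')
  define c :: real where "c = 1 / 2"
  have c: "0 \<le> c" "c + c = 1" by (simp_all add: c_def)
  have half: "ennreal (\<bar>h x\<bar> * \<bar>h y\<bar> * S x y)
      \<le> ennreal c * (ennreal ((h x)\<^sup>2) * ennreal (S x y)) + ennreal c * (ennreal ((h y)\<^sup>2) * ennreal (S x y))" for x y
  proof -
    have "\<bar>h x\<bar> * \<bar>h y\<bar> \<le> c * (h x)\<^sup>2 + c * (h y)\<^sup>2"
      using sum_squares_bound[of "\<bar>h x\<bar>" "\<bar>h y\<bar>"] by (simp add: c_def)
    then have "\<bar>h x\<bar> * \<bar>h y\<bar> * S x y \<le> (c * (h x)\<^sup>2 + c * (h y)\<^sup>2) * S x y"
      using S by (rule mult_right_mono)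
    also have "\<dots> = c * ((h x)\<^sup>2 * S x y) + c * ((h y)\<^sup>2 * S x y)" by (simp add: algebra_simps)
    finally have "ennreal (\<bar>h x\<bar> * \<bar>h y\<bar> * S x y) \<le> ennreal (c * ((h x)\<^sup>2 * S x y) + c * ((h y)\<^sup>2 * S x y))"
      by (rule ennreal_leI)
    also have "\<dots> = ennreal c * (ennreal ((h x)\<^sup>2) * ennreal (S x y)) + ennreal c * (ennreal ((h y)\<^sup>2) * ennreal (S x y))"
      using S[of x y] c by (simp add: ennreal_mult)
    finally show ?thesis .
  qed
  let ?I = "\<integral>\<^sup>+x. \<integral>\<^sup>+y. ennreal ((h x)\<^sup>2) * ennreal (S x y) \<partial>\<mu> \<partial>\<mu>"
  have I: "?I \<le> B * (\<integral>\<^sup>+x. ennreal ((h x)\<^sup>2) \<partial>\<mu>)"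
  proof -
    have "?I = (\<integral>\<^sup>+x. ennreal ((h x)\<^sup>2) * (\<integral>\<^sup>+y. ennreal (S x y) \<partial>\<mu>) \<partial>\<mu>)"
      by (subst nn_integral_cmult) auto
    also have "\<dots> \<le> (\<integral>\<^sup>+x. ennreal ((h x)\<^sup>2) * B \<partial>\<mu>)"
      by (intro nn_integral_mono mult_left_mono B) auto
    also have "\<dots> = B * (\<integral>\<^sup>+x. ennreal ((h x)\<^sup>2) \<partial>\<mu>)"
      by (subst nn_integral_multc) (auto simp: mult.commute)
    finally show ?thesis .
  qed
  have I': "(\<integral>\<^sup>+x. \<integral>\<^sup>+y. ennreal ((h y)\<^sup>2) * ennreal (S x y) \<partial>\<mu> \<partial>\<mu>) = ?I"
    by (subst P.Fubini'[symmetric]) (auto simp: sym)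
  have "(\<integral>\<^sup>+x. \<integral>\<^sup>+y. ennreal (\<bar>h x\<bar> * \<bar>h y\<bar> * S x y) \<partial>\<mu> \<partial>\<mu>)
      \<le> (\<integral>\<^sup>+x. \<integral>\<^sup>+y. ennreal c * (ennreal ((h x)\<^sup>2) * ennreal (S x y))
          + ennreal c * (ennreal ((h y)\<^sup>2) * ennreal (S x y)) \<partial>\<mu> \<partial>\<mu>)"
    by (intro nn_integral_mono half)
  also have "\<dots> = ennreal c * ?I + ennreal c * (\<integral>\<^sup>+x. \<integral>\<^sup>+y. ennreal ((h y)\<^sup>2) * ennreal (S x y) \<partial>\<mu> \<partial>\<mu>)"
    by (simp add: nn_integral_add nn_integral_cmult)
  also have "\<dots> = ?I"
    unfolding I' using c by (simp add: distrib_right[symmetric] ennreal_plus[symmetric] del: ennreal_plus)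
  finally show ?thesis using I by (rule order_trans)
qed

end

section \<open>The dual inequality\<close>

lemma borel_measurable_sphere_cos [measurable]: "sphere_cos \<in> borel_measurable borel"
  unfolding sphere_cos_def[abs_def] by measurable

text \<open>For a function that is not integrable the left-hand side is \<open>0\<close> by convention.\<close>

lemma norm_integral_le_nn_integral:
  fixes f :: "'a \<Rightarrow> 'b::{banach, second_countable_topology}"
  shows "ennreal (norm (integral\<^sup>L M f)) \<le> (\<integral>\<^sup>+x. ennreal (norm (f x)) \<partial>M)"
  by (cases "integrable M f") (auto simp: integral_norm_bound_ennreal not_integrable_integral_eq)

lemma borel_measurable_cis [measurable (raw)]:
  "u \<in> borel_measurable N \<Longrightarrow> (\<lambda>x. cis (u x)) \<in> borel_measurable N"
  by (rule measurable_compose[of u N borel], assumption)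
     (intro borel_measurable_continuous_onI continuous_intros)

lemma nn_integral_one_plus_powr:
  fixes p :: real
  assumes "1 < p"
  shows "(\<integral>\<^sup>+t. indicator {0<..} t * ennreal ((1 + t) powr (- p)) \<partial>lborel) = ennreal (1 / (p - 1))"
proof -
  have "(\<integral>\<^sup>+t. ennreal (t powr (- p)) * indicator {1<..} t \<partial>lborel)
      = ennreal \<bar>1\<bar> * (\<integral>\<^sup>+t. ennreal ((1 + 1 * t) powr (- p)) * indicator {1<..} (1 + 1 * t) \<partial>lborel)"
    by (rule nn_integral_real_affine) auto
  also have "\<dots> = (\<integral>\<^sup>+t. indicator {0<..} t * ennreal ((1 + t) powr (- p)) \<partial>lborel)"
    by (simp, intro nn_integral_cong) (auto simp: indicator_def)
  finally show ?thesis using nn_integral_powr_tail[of 1 p] assms by simp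
qed

text \<open>Turns the Sobolev weight into a power of \<open>1 + \<rho>\<close>, ready to be combined with \<open>(1 + \<rho>) powr - \<alpha>\<close>. The
factor \<open>2 powr \<bar>s\<bar>\<close> covers both signs of \<open>s\<close>; the exponent is negative when \<open>\<alpha>\<close> is large.\<close>

lemma sobolev_weight_le:
  fixes \<rho> s :: real
  assumes "0 \<le> \<rho>"
  shows "(1 + \<rho>\<^sup>2) powr (- s) \<le> 2 powr \<bar>s\<bar> * (1 + \<rho>) powr (- 2 * s)"
proof -
  have sq: "(1 + \<rho>) powr (- 2 * s) = ((1 + \<rho>)\<^sup>2) powr (- s)"
    using assms powr_powr[of "1 + \<rho>" 2 "- s"] powr_numeral[of "1 + \<rho>"] by simp
  show ?thesis
  proof (cases "0 \<le> s")
    case True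
    have "(1 + \<rho>)\<^sup>2 / 2 \<le> 1 + \<rho>\<^sup>2"
      using sum_squares_bound[of 1 \<rho>] by (simp add: power2_eq_square algebra_simps)
    then have "(1 + \<rho>\<^sup>2) powr (- s) \<le> ((1 + \<rho>)\<^sup>2 / 2) powr (- s)"
      using True assms by (intro powr_mono2') (auto simp: add_pos_nonneg)
    also have "\<dots> = ((1 + \<rho>)\<^sup>2) powr (- s) / 2 powr (- s)"
      by (rule powr_divide)
    also have "\<dots> = 2 powr \<bar>s\<bar> * (1 + \<rho>) powr (- 2 * s)"
      unfolding sq by (simp only: powr_minus[of 2 s] divide_inverse inverse_inverse_eq mult.commute abs_of_nonneg[OF True])
    finally show ?thesis .
  next
    case False
    have "(1 + \<rho>\<^sup>2) powr (- s) \<le> ((1 + \<rho>)\<^sup>2) powr (- s)"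
      using False assms by (intro powr_mono2) (auto simp: power2_eq_square algebra_simps)
    also have "\<dots> \<le> 2 powr \<bar>s\<bar> * ((1 + \<rho>)\<^sup>2) powr (- s)"
      using powr_mono[of 0 "\<bar>s\<bar>" 2] by (subst mult_le_cancel_right1) auto
    finally show ?thesis by (simp only: sq)
  qed
qed

context ball_regular_measure
begin

text \<open>The constant of \<open>nn_integral_decay\<close>.\<close>

definition decay_const :: "real \<Rightarrow> real" where
  "decay_const \<beta> = (m + C * 2 powr \<beta> / (1 - 2 powr (\<alpha> - \<beta>))) * 2 powr \<alpha>"

lemma decay_const_nonneg:
  assumes "\<alpha> < \<beta>"
  shows "0 \<le> decay_const \<beta>"
  using powr_less_mono[of "\<alpha> - \<beta>" 0 2] assms nonneg by (auto simp: decay_const_def)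

text \<open>Expand the square and integrate over the sphere first: this produces the quadratic form with kernel
\<open>sphere_cos (2 \<pi> \<rho> (x - y))\<close>, to which the decay, the ball condition and the Schur test apply.\<close>

lemma sphere_restriction:
  fixes h :: "real^'n \<Rightarrow> complex"
  assumes [measurable]: "h \<in> borel_measurable borel" and b: "\<And>x. norm (h x) \<le> b"
    and A: "0 < A" "\<And>\<eta> :: real^'n. \<bar>sphere_cos \<eta>\<bar> \<le> A * (1 + norm \<eta>) powr (- \<beta>)"
    and \<alpha>: "\<alpha> < \<beta>" and \<rho>: "0 \<le> \<rho>"
  shows "(\<integral>\<^sup>+\<omega>. ennreal ((norm (\<integral>x. h x * cis (2 * pi * \<rho> * (x \<bullet> \<omega>)) \<partial>\<mu>))\<^sup>2) \<partial>surf)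
    \<le> ennreal (A * (decay_const \<beta> * (1 + \<rho>) powr (- \<alpha>))) * (\<integral>\<^sup>+x. ennreal ((norm (h x))\<^sup>2) \<partial>\<mu>)"
proof -
  interpret S\<mu>: pair_sigma_finite surf \<mu> by standard
  interpret PS: finite_measure "surf \<Otimes>\<^sub>M \<mu>" 
    by (rule finite_measure_pair_measure) (rule finite_measure_axioms finite_measure_surf)+
  have b0: "0 \<le> b" using order_trans[OF norm_ge_zero b] .
  let ?e = "\<lambda>x \<omega>. cis (2 * pi * \<rho> * (x \<bullet> \<omega>))"
  let ?I = "\<lambda>\<omega>. \<integral>x. h x * ?e x \<omega> \<partial>\<mu>"
  let ?F = "\<lambda>\<omega> x y. h x * ?e x \<omega> * cnj (h y * ?e y \<omega>)"
  have [measurable]: "cnj \<in> borel_measurable borel"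
    by (intro borel_measurable_continuous_onI continuous_intros)
  have inth: "integrable \<mu> (\<lambda>x. h x * ?e x \<omega>)" for \<omega>
    by (rule integrable_const_bound[of _ b]) (auto simp: norm_mult b)
  have square: "complex_of_real ((norm (?I \<omega>))\<^sup>2) = (\<integral>x. \<integral>y. ?F \<omega> x y \<partial>\<mu> \<partial>\<mu>)" for \<omega>
  proof -
    have "(\<integral>y. cnj (h y * ?e y \<omega>) \<partial>\<mu>) = cnj (?I \<omega>)" by (rule Bochner_Integration.integral_cnj)
    then have "(\<integral>x. \<integral>y. ?F \<omega> x y \<partial>\<mu> \<partial>\<mu>) = ?I \<omega> * cnj (?I \<omega>)"
      by (simp only: integral_mult_right_zero integral_mult_left_zero)
    then show ?thesis by (simp add: complex_norm_square[symmetric] del: complex_cnj_mult)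
  qed
  have Fb: "norm (?F \<omega> x y) \<le> b * b" for \<omega> x y
    using b0 by (simp add: norm_mult b mult_mono)
  have int1: "integrable (surf \<Otimes>\<^sub>M \<mu>) (\<lambda>(\<omega>, x). \<integral>y. ?F \<omega> x y \<partial>\<mu>)"
  proof (rule PS.integrable_const_bound[of _ "measure \<mu> UNIV * (b * b)"])
    have "norm (\<integral>y. ?F \<omega> x y \<partial>\<mu>) \<le> measure \<mu> UNIV * (b * b)" for \<omega> x
    proof -
      have "integrable \<mu> (\<lambda>y. ?F \<omega> x y)"
        by (rule integrable_const_bound[of _ "b * b"]) (auto intro: Fb simp del: complex_cnj_mult)
      then have "norm (\<integral>y. ?F \<omega> x y \<partial>\<mu>) \<le> (\<integral>y. b * b \<partial>\<mu>)"
        by (intro order_trans[OF integral_norm_bound] integral_mono Fb) (auto intro: integrable_norm)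
      then show ?thesis by simp
    qed
    then show "AE p in surf \<Otimes>\<^sub>M \<mu>. norm (case p of (\<omega>, x) \<Rightarrow> \<integral>y. ?F \<omega> x y \<partial>\<mu>) \<le> measure \<mu> UNIV * (b * b)"
      by (auto split: prod.split)
  qed measurable
  have int2: "integrable (surf \<Otimes>\<^sub>M \<mu>) (\<lambda>(\<omega>, y). ?F \<omega> x y)" for x
    by (rule PS.integrable_const_bound[of _ "b * b"])
       (auto simp: Fb simp del: complex_cnj_mult split: prod.split)
  have inner: "(\<integral>\<omega>. ?F \<omega> x y \<partial>surf) = h x * cnj (h y) * of_real (sphere_cos ((2 * pi * \<rho>) *\<^sub>R (x - y)))" for x y
  proof -
    have "?F \<omega> x y = h x * cnj (h y) * cis (\<omega> \<bullet> ((2 * pi * \<rho>) *\<^sub>R (x - y)))" for \<omega>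
      by (simp add: cis_cnj cis_mult[symmetric] inner_diff_right inner_commute algebra_simps diff_conv_add_uminus del: add_uminus_conv_diff)
    then show ?thesis by (simp only: integral_mult_right_zero integral_cis_surf)
  qed
  have "complex_of_real (\<integral>\<omega>. (norm (?I \<omega>))\<^sup>2 \<partial>surf) = (\<integral>\<omega>. \<integral>x. \<integral>y. ?F \<omega> x y \<partial>\<mu> \<partial>\<mu> \<partial>surf)"
    by (simp only: square[symmetric] integral_complex_of_real)
  also have "\<dots> = (\<integral>x. \<integral>\<omega>. \<integral>y. ?F \<omega> x y \<partial>\<mu> \<partial>surf \<partial>\<mu>)"
    by (rule S\<mu>.Fubini_integral[OF int1, symmetric])
  also have "\<dots> = (\<integral>x. \<integral>y. \<integral>\<omega>. ?F \<omega> x y \<partial>surf \<partial>\<mu> \<partial>\<mu>)"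
    by (intro Bochner_Integration.integral_cong refl S\<mu>.Fubini_integral[OF int2, symmetric])
  finally have eq: "complex_of_real (\<integral>\<omega>. (norm (?I \<omega>))\<^sup>2 \<partial>surf)
     = (\<integral>x. \<integral>y. h x * cnj (h y) * of_real (sphere_cos ((2 * pi * \<rho>) *\<^sub>R (x - y))) \<partial>\<mu> \<partial>\<mu>)"
    by (simp only: inner)
  let ?S = "\<lambda>x y. A * (1 + \<rho> * norm (x - y)) powr (- \<beta>)"
  let ?f = "\<lambda>x y. h x * cnj (h y) * of_real (sphere_cos ((2 * pi * \<rho>) *\<^sub>R (x - y)))"
  have fS: "norm (?f x y) \<le> \<bar>norm (h x)\<bar> * \<bar>norm (h y)\<bar> * ?S x y" for x y
  proof -
    have "\<bar>sphere_cos ((2 * pi * \<rho>) *\<^sub>R (x - y))\<bar> \<le> A * (1 + norm ((2 * pi * \<rho>) *\<^sub>R (x - y))) powr (- \<beta>)"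
      by (rule A)
    also have "\<dots> \<le> ?S x y"
    proof (intro mult_left_mono powr_mono2')
      have "1 * (\<rho> * norm (x - y)) \<le> (2 * pi) * (\<rho> * norm (x - y))"
        using \<rho> pi_gt3 by (intro mult_right_mono) auto
      then show "1 + \<rho> * norm (x - y) \<le> 1 + norm ((2 * pi * \<rho>) *\<^sub>R (x - y))"
        using \<rho> by (simp add: abs_mult)
    qed (use A \<alpha> nonneg \<rho> in \<open>auto intro: add_pos_nonneg\<close>)
    finally show ?thesis by (simp add: norm_mult mult_left_mono)
  qed
  have "(\<integral>\<^sup>+\<omega>. ennreal ((norm (?I \<omega>))\<^sup>2) \<partial>surf) = ennreal (\<integral>\<omega>. (norm (?I \<omega>))\<^sup>2 \<partial>surf)"
  proof (rule nn_integral_eq_integral)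
    have "norm (?I \<omega>) \<le> measure \<mu> UNIV * b" for \<omega>
    proof -
      have "norm (?I \<omega>) \<le> (\<integral>y. b \<partial>\<mu>)"
        by (intro order_trans[OF integral_norm_bound] integral_mono integrable_norm inth) (auto simp: norm_mult b)
      then show ?thesis by simp
    qed
    then show "integrable surf (\<lambda>\<omega>. (norm (?I \<omega>))\<^sup>2)"
      by (intro surf.integrable_const_bound[of _ "(measure \<mu> UNIV * b)\<^sup>2"]) (auto intro!: power_mono)
  qed simp
  also have "(\<integral>\<omega>. (norm (?I \<omega>))\<^sup>2 \<partial>surf) = norm (complex_of_real (\<integral>\<omega>. (norm (?I \<omega>))\<^sup>2 \<partial>surf))"
    by (simp add: integral_nonneg)
  also have "\<dots> = norm (\<integral>x. \<integral>y. ?f x y \<partial>\<mu> \<partial>\<mu>)" by (simp only: eq)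
  also have "ennreal \<dots> \<le> (\<integral>\<^sup>+x. \<integral>\<^sup>+y. ennreal (norm (?f x y)) \<partial>\<mu> \<partial>\<mu>)"
    by (rule order_trans[OF norm_integral_le_nn_integral nn_integral_mono[OF norm_integral_le_nn_integral]])
  also have "\<dots> \<le> (\<integral>\<^sup>+x. \<integral>\<^sup>+y. ennreal (\<bar>norm (h x)\<bar> * \<bar>norm (h y)\<bar> * ?S x y) \<partial>\<mu> \<partial>\<mu>)"
    by (intro nn_integral_mono ennreal_leI fS)
  also have "\<dots> \<le> ennreal (A * (decay_const \<beta> * (1 + \<rho>) powr (- \<alpha>))) * (\<integral>\<^sup>+x. ennreal ((norm (h x))\<^sup>2) \<partial>\<mu>)"
  proof (rule schur_test)
    fix x
    have "(\<integral>\<^sup>+y. ennreal (?S x y) \<partial>\<mu>) = ennreal A * (\<integral>\<^sup>+y. ennreal ((1 + \<rho> * norm (x - y)) powr (- \<beta>)) \<partial>\<mu>)"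
      using A by (subst nn_integral_cmult[symmetric]) (auto simp: ennreal_mult)
    also have "\<dots> \<le> ennreal A * ennreal (decay_const \<beta> * (1 + \<rho>) powr (- \<alpha>))"
      unfolding decay_const_def by (intro mult_left_mono nn_integral_decay \<alpha> \<rho>) auto
    also have "\<dots> = ennreal (A * (decay_const \<beta> * (1 + \<rho>) powr (- \<alpha>)))"
      using A decay_const_nonneg[OF \<alpha>] by (simp add: ennreal_mult)
    finally show "(\<integral>\<^sup>+y. ennreal (?S x y) \<partial>\<mu>) \<le> ennreal (A * (decay_const \<beta> * (1 + \<rho>) powr (- \<alpha>)))" .
  qed (use A in \<open>auto simp: norm_minus_commute\<close>)
  finally show ?thesis .
qed

text \<open>This is the adjoint of the linearised operator \<open>f \<mapsto> S f(x, r x)\<close>, in weighted form. On the sphere of radius \<open>\<rho>\<close>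
the factor \<open>sphere_cos (2 \<pi> r x \<rho> \<omega>)\<close> depends on \<open>x\<close> only and is at most
\<open>A (1 + r\<^sub>0 \<rho>) powr - \<beta>\<close>; its square compensates \<open>\<rho> ^ (d - 1)\<close>.\<close>

lemma weighted_extension_dual:
  fixes g :: "real^'n \<Rightarrow> complex" and r :: "real^'n \<Rightarrow> real"
  assumes [measurable]: "g \<in> borel_measurable borel" "r \<in> borel_measurable borel"
    and b: "\<And>x. norm (g x) \<le> b" and r: "\<And>x. r\<^sub>0 \<le> r x" "0 < r\<^sub>0"
    and \<beta>: "\<beta> = (real CARD('n) - 1) / 2" "\<alpha> < \<beta>"
    and A: "0 < A" "\<And>\<eta> :: real^'n. \<bar>sphere_cos \<eta>\<bar> \<le> A * (1 + norm \<eta>) powr (- \<beta>)"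
    and s: "s = (1 - \<alpha>) / 2 + \<epsilon>" "0 < \<epsilon>"
  shows "(\<integral>\<^sup>+\<xi>. ennreal ((1 + (norm \<xi>)\<^sup>2) powr (- s) * (norm (\<integral>x. g x *
        of_real (sphere_cos ((2 * pi * r x) *\<^sub>R \<xi>)) * cis (2 * pi * (x \<bullet> \<xi>)) \<partial>\<mu>))\<^sup>2) \<partial>lborel)
    \<le> ennreal (A ^ 3 * decay_const \<beta> * r\<^sub>0 powr (- 2 * \<beta>) * 2 powr \<bar>s\<bar> / (2 * \<epsilon>)) * (\<integral>\<^sup>+x. ennreal ((norm (g x))\<^sup>2) \<partial>\<mu>)"
proof -
  define G where "G \<xi> = (\<integral>x. g x * of_real (sphere_cos ((2 * pi * r x) *\<^sub>R \<xi>)) * cis (2 * pi * (x \<bullet> \<xi>)) \<partial>\<mu>)" for \<xi> :: "real^'n"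
  have [measurable]: "G \<in> borel_measurable borel"
    unfolding G_def[abs_def] by measurable
  define X where "X = (\<integral>\<^sup>+x. ennreal ((norm (g x))\<^sup>2) \<partial>\<mu>)"
  define K where "K = A ^ 3 * decay_const \<beta> * r\<^sub>0 powr (- 2 * \<beta>)"
  have dc: "0 \<le> decay_const \<beta>" using \<beta>(2) by (rule decay_const_nonneg)
  have \<beta>0: "0 < \<beta>" using \<beta>(2) nonneg by simp
  have K: "0 \<le> K" using A dc by (simp add: K_def)
  obtain k :: 'n where True by simp
  have shell: "ennreal (\<rho> ^ (CARD('n) - 1)) * indicator {0<..} \<rho> *
      (\<integral>\<^sup>+\<omega>. ennreal ((1 + (norm (\<rho> *\<^sub>R \<omega>))\<^sup>2) powr (- s) * (norm (G (\<rho> *\<^sub>R \<omega>)))\<^sup>2) \<partial>surf)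
    \<le> ennreal (K * 2 powr \<bar>s\<bar>) * X * (indicator {0<..} \<rho> * ennreal ((1 + \<rho>) powr (- (1 + 2 * \<epsilon>))))" for \<rho>
  proof (cases "0 < \<rho>")
    case \<rho>: True
    define h where "h x = g x * of_real (sphere_cos ((2 * pi * r x * \<rho>) *\<^sub>R axis k 1 :: real^'n))" for x
    have [measurable]: "h \<in> borel_measurable borel" unfolding h_def[abs_def] by measurable
    have hb: "norm (h x) \<le> norm (g x) * (A * (1 + r\<^sub>0 * \<rho>) powr (- \<beta>))" for x
    proof -
      have "\<bar>sphere_cos ((2 * pi * r x * \<rho>) *\<^sub>R axis k 1 :: real^'n)\<bar>
          \<le> A * (1 + norm ((2 * pi * r x * \<rho>) *\<^sub>R axis k 1 :: real^'n)) powr (- \<beta>)" by (rule A)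
      also have "\<dots> \<le> A * (1 + r\<^sub>0 * \<rho>) powr (- \<beta>)"
      proof (intro mult_left_mono powr_mono2')
        have "1 * (r\<^sub>0 * \<rho>) \<le> (2 * pi) * (r x * \<rho>)"
          using \<rho> pi_gt3 r(1)[of x] r(2) by (intro mult_mono) auto
        also have "\<dots> \<le> \<bar>2 * pi * r x * \<rho>\<bar>" by simp
        finally show "1 + r\<^sub>0 * \<rho> \<le> 1 + norm ((2 * pi * r x * \<rho>) *\<^sub>R axis k 1 :: real^'n)"
          by simp
      qed (use A \<beta>0 r \<rho> in \<open>auto intro: add_pos_nonneg\<close>)
      finally show ?thesis by (simp add: h_def norm_mult mult_left_mono)
    qed
    have hb': "norm (h x) \<le> b * A" for x
    proof -
      have "(1 + r\<^sub>0 * \<rho>) powr (- \<beta>) \<le> 1 powr (- \<beta>)"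
        using \<rho> r \<beta>0 by (intro powr_mono2') auto
      then have "A * (1 + r\<^sub>0 * \<rho>) powr (- \<beta>) \<le> A" using A by simp
      then show ?thesis using b[of x] A by (intro order_trans[OF hb] mult_mono) (auto intro: order_trans[OF norm_ge_zero])
    qed
    have "(\<integral>\<^sup>+\<omega>. ennreal ((1 + (norm (\<rho> *\<^sub>R \<omega>))\<^sup>2) powr (- s) * (norm (G (\<rho> *\<^sub>R \<omega>)))\<^sup>2) \<partial>surf)
        = (\<integral>\<^sup>+\<omega>. ennreal ((1 + \<rho>\<^sup>2) powr (- s)) * ennreal ((norm (\<integral>x. h x * cis (2 * pi * \<rho> * (x \<bullet> \<omega>)) \<partial>\<mu>))\<^sup>2) \<partial>surf)"
    proof (rule nn_integral_cong_AE, use AE_surf in eventually_elim)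
      fix \<omega> :: "real^'n" assume \<omega>: "norm \<omega> = 1"
      have "sphere_cos ((2 * pi * r x) *\<^sub>R \<rho> *\<^sub>R \<omega>) = sphere_cos ((2 * pi * r x * \<rho>) *\<^sub>R axis k 1 :: real^'n)" for x
        by (rule sphere_cos_radial) (simp add: \<omega> abs_mult)
      then have "G (\<rho> *\<^sub>R \<omega>) = (\<integral>x. h x * cis (2 * pi * \<rho> * (x \<bullet> \<omega>)) \<partial>\<mu>)"
        unfolding G_def h_def by (simp add: mult.assoc)
      then show "ennreal ((1 + (norm (\<rho> *\<^sub>R \<omega>))\<^sup>2) powr (- s) * (norm (G (\<rho> *\<^sub>R \<omega>)))\<^sup>2)
          = ennreal ((1 + \<rho>\<^sup>2) powr (- s)) * ennreal ((norm (\<integral>x. h x * cis (2 * pi * \<rho> * (x \<bullet> \<omega>)) \<partial>\<mu>))\<^sup>2)"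
        using \<rho> by (simp add: \<omega> ennreal_mult)
    qed
    also have "\<dots> = ennreal ((1 + \<rho>\<^sup>2) powr (- s)) * (\<integral>\<^sup>+\<omega>. ennreal ((norm (\<integral>x. h x * cis (2 * pi * \<rho> * (x \<bullet> \<omega>)) \<partial>\<mu>))\<^sup>2) \<partial>surf)"
      by (rule nn_integral_cmult) measurable
    also have "\<dots> \<le> ennreal ((1 + \<rho>\<^sup>2) powr (- s)) *
        (ennreal (A * (decay_const \<beta> * (1 + \<rho>) powr (- \<alpha>))) * (\<integral>\<^sup>+x. ennreal ((norm (h x))\<^sup>2) \<partial>\<mu>))"
      using \<rho> by (intro mult_left_mono sphere_restriction[where b = "b * A"] hb' A \<beta>) auto
    also have "(\<integral>\<^sup>+x. ennreal ((norm (h x))\<^sup>2) \<partial>\<mu>) \<le> (\<integral>\<^sup>+x. ennreal (A\<^sup>2 * (1 + r\<^sub>0 * \<rho>) powr (- 2 * \<beta>)) * ennreal ((norm (g x))\<^sup>2) \<partial>\<mu>)"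
    proof (rule nn_integral_mono)
      fix x
      have "(norm (h x))\<^sup>2 \<le> (norm (g x) * (A * (1 + r\<^sub>0 * \<rho>) powr (- \<beta>)))\<^sup>2"
        by (rule power_mono[OF hb]) simp
      also have "\<dots> = A\<^sup>2 * (1 + r\<^sub>0 * \<rho>) powr (- 2 * \<beta>) * (norm (g x))\<^sup>2"
        by (simp add: power_mult_distrib power2_eq_square powr_add[symmetric])
      finally show "ennreal ((norm (h x))\<^sup>2) \<le> ennreal (A\<^sup>2 * (1 + r\<^sub>0 * \<rho>) powr (- 2 * \<beta>)) * ennreal ((norm (g x))\<^sup>2)"
        by (simp add: ennreal_mult[symmetric] ennreal_leI)
    qed
    also have "\<dots> = ennreal (A\<^sup>2 * (1 + r\<^sub>0 * \<rho>) powr (- 2 * \<beta>)) * X"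
      unfolding X_def by (rule nn_integral_cmult) measurable
    finally have inner: "(\<integral>\<^sup>+\<omega>. ennreal ((1 + (norm (\<rho> *\<^sub>R \<omega>))\<^sup>2) powr (- s) * (norm (G (\<rho> *\<^sub>R \<omega>)))\<^sup>2) \<partial>surf)
      \<le> ennreal ((1 + \<rho>\<^sup>2) powr (- s)) * (ennreal (A * (decay_const \<beta> * (1 + \<rho>) powr (- \<alpha>))) *
        (ennreal (A\<^sup>2 * (1 + r\<^sub>0 * \<rho>) powr (- 2 * \<beta>)) * X))"
      by (simp add: mult_left_mono)
    let ?c = "\<rho> ^ (CARD('n) - 1) * ((1 + \<rho>\<^sup>2) powr (- s) * (A * (decay_const \<beta> * (1 + \<rho>) powr (- \<alpha>)) *
        (A\<^sup>2 * (1 + r\<^sub>0 * \<rho>) powr (- 2 * \<beta>))))"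
    have c: "?c \<le> K * 2 powr \<bar>s\<bar> * (1 + \<rho>) powr (- (1 + 2 * \<epsilon>))"
    proof -
      have "2 * \<beta> = real (CARD('n) - 1)" by (simp add: \<beta>(1) of_nat_diff)
      then have pow: "\<rho> ^ (CARD('n) - 1) = \<rho> powr (2 * \<beta>)"
        using powr_realpow[OF \<rho>, of "CARD('n) - 1"] by (simp only:)
      have "\<rho> ^ (CARD('n) - 1) * (1 + r\<^sub>0 * \<rho>) powr (- 2 * \<beta>) \<le> \<rho> powr (2 * \<beta>) * (r\<^sub>0 * \<rho>) powr (- 2 * \<beta>)"
        unfolding pow using r \<rho> \<beta>0 by (intro mult_left_mono powr_mono2') auto
      also have "\<dots> = r\<^sub>0 powr (- 2 * \<beta>)"
        using r \<rho> by (simp add: powr_mult powr_minus)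
      finally have p1: "\<rho> ^ (CARD('n) - 1) * (1 + r\<^sub>0 * \<rho>) powr (- 2 * \<beta>) \<le> r\<^sub>0 powr (- 2 * \<beta>)" .
      have "(1 + \<rho>\<^sup>2) powr (- s) * (1 + \<rho>) powr (- \<alpha>) \<le> 2 powr \<bar>s\<bar> * (1 + \<rho>) powr (- 2 * s) * (1 + \<rho>) powr (- \<alpha>)"
        using \<rho> by (intro mult_right_mono sobolev_weight_le) auto
      also have "\<dots> = 2 powr \<bar>s\<bar> * (1 + \<rho>) powr (- (1 + 2 * \<epsilon>))"
      proof -
        have "- 2 * s + - \<alpha> = - (1 + 2 * \<epsilon>)" by (simp add: s field_simps)
        then show ?thesis by (simp only: mult.assoc powr_add[symmetric])
      qed
      finally have p2: "(1 + \<rho>\<^sup>2) powr (- s) * (1 + \<rho>) powr (- \<alpha>) \<le> 2 powr \<bar>s\<bar> * (1 + \<rho>) powr (- (1 + 2 * \<epsilon>))" .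
      have "?c = A ^ 3 * decay_const \<beta> * ((\<rho> ^ (CARD('n) - 1) * (1 + r\<^sub>0 * \<rho>) powr (- 2 * \<beta>)) *
          ((1 + \<rho>\<^sup>2) powr (- s) * (1 + \<rho>) powr (- \<alpha>)))"
        by (simp add: power3_eq_cube power2_eq_square ac_simps)
      also have "\<dots> \<le> A ^ 3 * decay_const \<beta> * (r\<^sub>0 powr (- 2 * \<beta>) * (2 powr \<bar>s\<bar> * (1 + \<rho>) powr (- (1 + 2 * \<epsilon>))))"
        using A dc by (intro mult_left_mono mult_mono p1 p2) auto
      finally show ?thesis by (simp only: K_def mult.assoc)
    qed
    have "ennreal (\<rho> ^ (CARD('n) - 1)) * (\<integral>\<^sup>+\<omega>. ennreal ((1 + (norm (\<rho> *\<^sub>R \<omega>))\<^sup>2) powr (- s) * (norm (G (\<rho> *\<^sub>R \<omega>)))\<^sup>2) \<partial>surf)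
        \<le> ennreal (\<rho> ^ (CARD('n) - 1)) * (ennreal ((1 + \<rho>\<^sup>2) powr (- s)) * (ennreal (A * (decay_const \<beta> * (1 + \<rho>) powr (- \<alpha>))) *
        (ennreal (A\<^sup>2 * (1 + r\<^sub>0 * \<rho>) powr (- 2 * \<beta>)) * X)))"
      by (intro mult_left_mono inner) auto
    also have "\<dots> = ennreal ?c * X"
      using \<rho> A dc by (simp add: ennreal_mult mult.assoc)
    also have "\<dots> \<le> ennreal (K * 2 powr \<bar>s\<bar> * (1 + \<rho>) powr (- (1 + 2 * \<epsilon>))) * X"
      by (intro mult_right_mono ennreal_leI c) auto
    also have "\<dots> = ennreal (K * 2 powr \<bar>s\<bar>) * X * ennreal ((1 + \<rho>) powr (- (1 + 2 * \<epsilon>)))"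
      using K by (simp add: ennreal_mult ac_simps)
    finally show ?thesis using \<rho> by simp
  qed simp
  have "(\<integral>\<^sup>+\<xi>. ennreal ((1 + (norm \<xi>)\<^sup>2) powr (- s) * (norm (G \<xi>))\<^sup>2) \<partial>lborel)
    = (\<integral>\<^sup>+\<rho>. ennreal (\<rho> ^ (CARD('n) - 1)) * indicator {0<..} \<rho> *
      (\<integral>\<^sup>+\<omega>. ennreal ((1 + (norm (\<rho> *\<^sub>R \<omega>))\<^sup>2) powr (- s) * (norm (G (\<rho> *\<^sub>R \<omega>)))\<^sup>2) \<partial>surf) \<partial>lborel)"
    by (rule nn_integral_polar) measurable
  also have "\<dots> \<le> (\<integral>\<^sup>+\<rho>. ennreal (K * 2 powr \<bar>s\<bar>) * X * (indicator {0<..} \<rho> * ennreal ((1 + \<rho>) powr (- (1 + 2 * \<epsilon>)))) \<partial>lborel)"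
    by (rule nn_integral_mono) (rule shell)
  also have "\<dots> = ennreal (K * 2 powr \<bar>s\<bar>) * X * ennreal (1 / (2 * \<epsilon>))"
    using nn_integral_one_plus_powr[of "1 + 2 * \<epsilon>"] s by (subst nn_integral_cmult) auto
  also have "\<dots> = ennreal (K * 2 powr \<bar>s\<bar> / (2 * \<epsilon>)) * X"
  proof -
    have "ennreal (u * c) * X = ennreal u * X * ennreal c" if "0 \<le> u" "0 \<le> c" for u c
      using that by (simp add: ennreal_mult ac_simps)
    from this[of "K * 2 powr \<bar>s\<bar>" "1 / (2 * \<epsilon>)"] show ?thesis using K s(2) by simp
  qed
  finally show ?thesis unfolding G_def X_def K_def .
qed

end

section \<open>Gaussian mollification\<close>

lemma lebesgue_integral_lborel_prod:
  fixes f :: "'a::euclidean_space \<Rightarrow> real \<Rightarrow> complex"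
  assumes f: "\<And>b. b \<in> Basis \<Longrightarrow> integrable lborel (f b)"
  shows "integrable lborel (\<lambda>x. \<Prod>b\<in>Basis. f b (x \<bullet> b))"
    and "(\<integral>x. (\<Prod>b\<in>Basis. f b (x \<bullet> b)) \<partial>lborel) = (\<Prod>b\<in>Basis. \<integral>t. f b t \<partial>lborel)"
proof -
  interpret product_sigma_finite "\<lambda>_::'a. lborel :: real measure" by standard
  have [measurable]: "f b \<in> borel_measurable borel" if "b \<in> Basis" for b
    using f[OF that] by simp
  let ?P = "\<Pi>\<^sub>M b\<in>(Basis::'a set). (lborel :: real measure)"
  let ?T = "\<lambda>t. \<Sum>b\<in>Basis. t b *\<^sub>R (b::'a)"
  have T: "?T \<in> measurable ?P borel" by measurable
  have m: "(\<lambda>x. \<Prod>b\<in>Basis. f b (x \<bullet> b)) \<in> borel_measurable borel" by measurable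
  have eq: "(\<Prod>b\<in>Basis. f b (?T t \<bullet> b)) = (\<Prod>b\<in>Basis. f b (t b))" for t
    by (intro prod.cong refl) simp
  have I: "integrable ?P (\<lambda>t. \<Prod>b\<in>Basis. f b (t b))"
    by (rule product_integrable_prod) (use f in auto)
  show "integrable lborel (\<lambda>x. \<Prod>b\<in>Basis. f b (x \<bullet> b))"
    by (subst lborel_eq, subst integrable_distr_eq[OF T m]) (simp only: eq I)
  have "(\<integral>x. (\<Prod>b\<in>Basis. f b (x \<bullet> b)) \<partial>lborel) = (\<integral>t. (\<Prod>b\<in>Basis. f b (t b)) \<partial>?P)"
    by (subst lborel_eq, subst integral_distr[OF T m]) (simp only: eq)
  also have "\<dots> = (\<Prod>b\<in>Basis. \<integral>t. f b t \<partial>lborel)"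
    by (rule product_integral_prod) (use f in auto)
  finally show "(\<integral>x. (\<Prod>b\<in>Basis. f b (x \<bullet> b)) \<partial>lborel) = (\<Prod>b\<in>Basis. \<integral>t. f b t \<partial>lborel)" .
qed

lemma lebesgue_integral_affine:
  fixes F :: "'a::euclidean_space \<Rightarrow> complex"
  assumes [measurable]: "F \<in> borel_measurable borel" and c: "c \<noteq> 0"
  shows "(\<integral>x. F x \<partial>lborel) = of_real (\<bar>c\<bar> ^ DIM('a)) * (\<integral>x. F (t + c *\<^sub>R x) \<partial>lborel)"
    and "integrable lborel F \<Longrightarrow> integrable lborel (\<lambda>x. F (t + c *\<^sub>R x))"
proof -
  let ?k = "\<bar>c\<bar> ^ DIM('a)"
  have k: "?k \<noteq> 0" "0 \<le> ?k" using c by auto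
  have lb: "lborel = density (distr lborel borel (\<lambda>x. t + c *\<^sub>R x)) (\<lambda>_. ennreal ?k)"
    using lborel_affine[OF c, of t] by simp
  have "(\<integral>x. F x \<partial>lborel) = (\<integral>x. F x \<partial>density (distr lborel borel (\<lambda>x. t + c *\<^sub>R x)) (\<lambda>_. ennreal ?k))"
    using lb by simp
  also have "\<dots> = (\<integral>x. ?k *\<^sub>R F x \<partial>distr lborel borel (\<lambda>x. t + c *\<^sub>R x))"
    by (rule integral_density) (use k in auto)
  also have "\<dots> = (\<integral>x. ?k *\<^sub>R F (t + c *\<^sub>R x) \<partial>lborel)"
    by (rule integral_distr) auto
  finally show "(\<integral>x. F x \<partial>lborel) = of_real ?k * (\<integral>x. F (t + c *\<^sub>R x) \<partial>lborel)"
    by (simp add: scaleR_conv_of_real)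
  assume "integrable lborel F"
  then have "integrable (density (distr lborel borel (\<lambda>x. t + c *\<^sub>R x)) (\<lambda>_. ennreal ?k)) F"
    using lb by simp
  then have "integrable (distr lborel borel (\<lambda>x. t + c *\<^sub>R x)) (\<lambda>x. ?k *\<^sub>R F x)"
    by (subst (asm) integrable_density) (use k in auto)
  then have "integrable lborel (\<lambda>x. ?k *\<^sub>R F (t + c *\<^sub>R x))"
    by (subst (asm) integrable_distr_eq) auto
  then have "integrable lborel (\<lambda>x. inverse ?k *\<^sub>R (?k *\<^sub>R F (t + c *\<^sub>R x)))"
    by (rule integrable_scaleR_right)
  then show "integrable lborel (\<lambda>x. F (t + c *\<^sub>R x))"
    by (simp only: scaleR_scaleR left_inverse[OF k(1)] scaleR_one)
qed

text \<open>The density of the standard normal distribution, as a product over the coordinates because its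
Fourier transform is computed coordinatewise.\<close>

definition std_gauss :: "'a::euclidean_space \<Rightarrow> real" where
  "std_gauss v = (\<Prod>b\<in>Basis. std_normal_density (v \<bullet> b))"

lemma std_gauss_eq: "std_gauss (v::'a::euclidean_space) = (1 / sqrt (2 * pi)) ^ DIM('a) * exp (- (norm v)\<^sup>2 / 2)"
proof -
  have "std_gauss v = (\<Prod>b\<in>(Basis::'a set). 1 / sqrt (2 * pi)) * (\<Prod>b\<in>Basis. exp (- (v \<bullet> b)\<^sup>2 / 2))"
    unfolding std_gauss_def std_normal_density_def by (rule prod.distrib)
  also have "(\<Prod>b\<in>Basis. exp (- (v \<bullet> b)\<^sup>2 / 2)) = exp (\<Sum>b\<in>Basis. - (v \<bullet> b)\<^sup>2 / 2)"
    by (rule exp_sum[symmetric]) simp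
  also have "(\<Sum>b\<in>Basis. - (v \<bullet> b)\<^sup>2 / 2) = - (norm v)\<^sup>2 / 2"
    unfolding norm_eq_sqrt_inner euclidean_inner[of v v]
    by (simp add: sum_nonneg power2_eq_square sum_divide_distrib sum_negf)
  finally show ?thesis by simp
qed

lemma std_gauss_nonneg: "0 \<le> std_gauss v"
  by (simp add: std_gauss_eq)

lemma borel_measurable_std_gauss [measurable]: "std_gauss \<in> borel_measurable borel"
  unfolding std_gauss_eq[abs_def] by measurable

lemma std_gauss_fourier:
  fixes u :: "'a::euclidean_space"
  shows "integrable lborel (\<lambda>v. of_real (std_gauss v) * cis (u \<bullet> v))"
    and "(\<integral>v. of_real (std_gauss v) * cis (u \<bullet> v) \<partial>lborel) = of_real (exp (- (norm u)\<^sup>2 / 2))"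
proof -
  let ?f = "\<lambda>b t. complex_of_real (std_normal_density t) * cis ((u \<bullet> b) * t)"
  have int: "integrable lborel (?f b)" for b
    by (rule Bochner_Integration.integrable_bound[OF integrable_normal_density[of 1 0]])
       (auto simp: norm_mult)
  have val: "(\<integral>t. ?f b t \<partial>lborel) = of_real (exp (- (u \<bullet> b)\<^sup>2 / 2))" for b
  proof -
    have "char std_normal_distribution (u \<bullet> b) = (\<integral>t. std_normal_density t *\<^sub>R iexp ((u \<bullet> b) * t) \<partial>lborel)"
      unfolding char_def by (rule integral_density) auto
    also have "\<dots> = (\<integral>t. ?f b t \<partial>lborel)"
      by (simp add: scaleR_conv_of_real cis_conv_exp)
    finally show ?thesis by (simp add: char_std_normal_distribution)
  qed
  have prod: "of_real (std_gauss v) * cis (u \<bullet> v) = (\<Prod>b\<in>Basis. ?f b (v \<bullet> b))" for v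
  proof -
    have "cis (u \<bullet> v) = exp (\<Sum>b\<in>Basis. \<i> * of_real ((u \<bullet> b) * (v \<bullet> b)))"
      by (subst euclidean_inner) (simp add: cis_conv_exp sum_distrib_left)
    also have "\<dots> = (\<Prod>b\<in>Basis. cis ((u \<bullet> b) * (v \<bullet> b)))"
      by (subst exp_sum) (simp_all add: cis_conv_exp)
    finally show ?thesis by (simp add: std_gauss_def prod.distrib)
  qed
  show "integrable lborel (\<lambda>v. of_real (std_gauss v) * cis (u \<bullet> v))"
    unfolding prod by (rule lebesgue_integral_lborel_prod(1)) (rule int)
  have "(\<integral>v. of_real (std_gauss v) * cis (u \<bullet> v) \<partial>lborel) = (\<Prod>b\<in>Basis. of_real (exp (- (u \<bullet> b)\<^sup>2 / 2)))"
    unfolding prod by (subst lebesgue_integral_lborel_prod(2)[of ?f]) (simp_all only: int val)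
  also have "\<dots> = of_real (exp (\<Sum>b\<in>Basis. - (u \<bullet> b)\<^sup>2 / 2))"
    by (subst exp_sum) simp_all
  also have "(\<Sum>b\<in>Basis. - (u \<bullet> b)\<^sup>2 / 2) = - (norm u)\<^sup>2 / 2"
    unfolding norm_eq_sqrt_inner euclidean_inner[of u u]
    by (simp add: sum_nonneg power2_eq_square sum_divide_distrib sum_negf)
  finally show "(\<integral>v. of_real (std_gauss v) * cis (u \<bullet> v) \<partial>lborel) = of_real (exp (- (norm u)\<^sup>2 / 2))" .
qed

lemma integrable_std_gauss: "integrable lborel (std_gauss :: 'a::euclidean_space \<Rightarrow> real)"
  using integrable_norm[OF std_gauss_fourier(1)[of "0::'a"]] by (simp add: norm_mult std_gauss_nonneg)

lemma integral_std_gauss: "(\<integral>v. std_gauss v \<partial>(lborel :: 'a::euclidean_space measure)) = 1"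
proof -
  have "complex_of_real (\<integral>v. std_gauss v \<partial>(lborel :: 'a measure)) = 1"
    using std_gauss_fourier(2)[of "0::'a"] by (simp add: integral_complex_of_real)
  then show ?thesis by (simp only: of_real_eq_1_iff)
qed

text \<open>The Fourier transform of the Gaussian that \<open>mollify \<tau>\<close> convolves with.\<close>

definition gauss_cutoff :: "real \<Rightarrow> 'a::euclidean_space \<Rightarrow> real" where
  "gauss_cutoff \<tau> \<xi> = exp (- (norm ((2 * pi * \<tau>) *\<^sub>R \<xi>))\<^sup>2 / 2)"

lemma borel_measurable_gauss_cutoff [measurable]: "gauss_cutoff \<tau> \<in> borel_measurable borel"
  unfolding gauss_cutoff_def[abs_def] by measurable

lemma gauss_cutoff_bounds: "0 < gauss_cutoff \<tau> \<xi>" "gauss_cutoff \<tau> \<xi> \<le> 1"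
  by (simp_all add: gauss_cutoff_def)

lemma abs_gauss_cutoff [simp]: "\<bar>gauss_cutoff \<tau> \<xi>\<bar> = gauss_cutoff \<tau> \<xi>"
  by (simp add: gauss_cutoff_def)

text \<open>Rescaling \<open>\<xi>\<close> by \<open>2 \<pi> \<tau>\<close> reduces this to the standard Gaussian, which reproduces itself up to the
normalisation \<open>q\<close>.\<close>

lemma gauss_cutoff_fourier:
  fixes z :: "'a::euclidean_space"
  assumes \<tau>: "0 < \<tau>"
  shows "integrable lborel (\<lambda>\<xi>. of_real (gauss_cutoff \<tau> \<xi>) * cis (2 * pi * (z \<bullet> \<xi>)))"
    and "(\<integral>\<xi>. of_real (gauss_cutoff \<tau> \<xi>) * cis (2 * pi * (z \<bullet> \<xi>)) \<partial>lborel)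
      = of_real (std_gauss (z /\<^sub>R \<tau>) / \<tau> ^ DIM('a))"
proof -
  define c where "c = 2 * pi * \<tau>"
  have c: "0 < c" using \<tau> by (simp add: c_def)
  define q where "q = (1 / sqrt (2 * pi)) ^ DIM('a)"
  have q: "0 < q" by (simp add: q_def)
  let ?F = "\<lambda>v. complex_of_real (std_gauss v) * cis ((z /\<^sub>R \<tau>) \<bullet> v)"
  have eq: "of_real (gauss_cutoff \<tau> \<xi>) * cis (2 * pi * (z \<bullet> \<xi>)) = of_real (1 / q) * ?F (0 + c *\<^sub>R \<xi>)" for \<xi>
  proof -
    have "gauss_cutoff \<tau> \<xi> = 1 / q * std_gauss (c *\<^sub>R \<xi>)"
      using q by (simp add: gauss_cutoff_def std_gauss_eq c_def q_def[symmetric])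
    moreover have "(z /\<^sub>R \<tau>) \<bullet> (c *\<^sub>R \<xi>) = 2 * pi * (z \<bullet> \<xi>)" using \<tau> by (simp add: c_def)
    ultimately show ?thesis by (simp only: add_0 of_real_mult mult.assoc)
  qed
  have "integrable lborel (\<lambda>\<xi>. ?F (0 + c *\<^sub>R \<xi>))"
    by (rule lebesgue_integral_affine(2)[OF _ _ std_gauss_fourier(1)[of "z /\<^sub>R \<tau>"]]) (use c in auto)
  then show "integrable lborel (\<lambda>\<xi>. of_real (gauss_cutoff \<tau> \<xi>) * cis (2 * pi * (z \<bullet> \<xi>)))"
    unfolding eq by (rule integrable_mult_right)
  have "(\<integral>\<xi>. of_real (gauss_cutoff \<tau> \<xi>) * cis (2 * pi * (z \<bullet> \<xi>)) \<partial>lborel) = of_real (1 / q) * (\<integral>\<xi>. ?F (0 + c *\<^sub>R \<xi>) \<partial>lborel)"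
    unfolding eq by (rule integral_mult_right_zero)
  also have "(\<integral>\<xi>. ?F (0 + c *\<^sub>R \<xi>) \<partial>lborel) = (\<integral>v. ?F v \<partial>lborel) / of_real (c ^ DIM('a))"
    using lebesgue_integral_affine(1)[of ?F c 0] c by simp
  also have "(\<integral>v. ?F v \<partial>lborel) = of_real (exp (- (norm (z /\<^sub>R \<tau>))\<^sup>2 / 2))"
    by (rule std_gauss_fourier)
  also have "exp (- (norm (z /\<^sub>R \<tau>))\<^sup>2 / 2) = std_gauss (z /\<^sub>R \<tau>) / q"
    using q by (simp add: std_gauss_eq q_def)
  also have "complex_of_real (1 / q) * (of_real (std_gauss (z /\<^sub>R \<tau>) / q) / of_real (c ^ DIM('a)))
      = of_real (std_gauss (z /\<^sub>R \<tau>) / (q * q * c ^ DIM('a)))" by simp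
  also have "q * q * c ^ DIM('a) = \<tau> ^ DIM('a)"
    using \<tau> by (simp add: q_def c_def power_mult_distrib[symmetric])
  finally show "(\<integral>\<xi>. of_real (gauss_cutoff \<tau> \<xi>) * cis (2 * pi * (z \<bullet> \<xi>)) \<partial>lborel)
      = of_real (std_gauss (z /\<^sub>R \<tau>) / \<tau> ^ DIM('a))" .
qed

lemma integrable_gauss_cutoff:
  assumes "0 < \<tau>"
  shows "integrable lborel (gauss_cutoff \<tau> :: 'a::euclidean_space \<Rightarrow> real)"
  using integrable_norm[OF gauss_cutoff_fourier(1)[OF assms, of "0::'a"]]
  by (simp add: norm_mult abs_gauss_cutoff)

definition mollify :: "real \<Rightarrow> (real^'n::finite \<Rightarrow> complex) \<Rightarrow> real^'n \<Rightarrow> complex" where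
  "mollify \<tau> f x = (\<integral>u. f (x - \<tau> *\<^sub>R u) * of_real (std_gauss u) \<partial>lborel)"

lemma borel_measurable_fourier_transform [measurable]:
  fixes f :: "real^'n::finite \<Rightarrow> complex"
  assumes [measurable]: "f \<in> borel_measurable borel"
  shows "fourier_transform f \<in> borel_measurable borel"
  unfolding fourier_transform_def[abs_def] by measurable

lemma norm_fourier_transform_le:
  fixes f :: "real^'n::finite \<Rightarrow> complex"
  assumes "integrable lborel f"
  shows "norm (fourier_transform f \<xi>) \<le> (\<integral>x. norm (f x) \<partial>lborel)"
  unfolding fourier_transform_def
  by (rule order_trans[OF integral_norm_bound]) (simp add: norm_mult)

lemma integrable_fourier_cutoff:
  fixes f :: "real^'n::finite \<Rightarrow> complex"
  assumes f: "integrable lborel f" and \<tau>: "0 < \<tau>"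
  shows "integrable lborel (\<lambda>\<xi>. fourier_transform f \<xi> * of_real (gauss_cutoff \<tau> \<xi>))"
proof (rule Bochner_Integration.integrable_bound)
  have [measurable]: "f \<in> borel_measurable borel" using f by simp
  show "integrable lborel (\<lambda>\<xi>::real^'n. (\<integral>x. norm (f x) \<partial>lborel) * gauss_cutoff \<tau> \<xi>)"
    by (rule integrable_mult_right[OF integrable_gauss_cutoff[OF \<tau>]])
  show "(\<lambda>\<xi>. fourier_transform f \<xi> * of_real (gauss_cutoff \<tau> \<xi>)) \<in> borel_measurable lborel"
    by measurable
  show "AE \<xi> in lborel. norm (fourier_transform f \<xi> * of_real (gauss_cutoff \<tau> \<xi>))
      \<le> norm ((\<integral>x. norm (f x) \<partial>lborel) * gauss_cutoff \<tau> \<xi>)"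
    using norm_fourier_transform_le[OF f] gauss_cutoff_bounds(1)[THEN less_imp_le]
    by (auto simp: norm_mult abs_mult intro!: mult_right_mono order_trans[OF _ abs_ge_self])
qed

text \<open>Fourier inversion with a Gaussian convergence factor. It holds for every integrable \<open>f\<close>, by exchanging
two absolutely convergent integrals.\<close>

lemma mollify_fourier:
  fixes f :: "real^'n::finite \<Rightarrow> complex"
  assumes f: "integrable lborel f" and \<tau>: "0 < \<tau>"
  shows "mollify \<tau> f x =
    (\<integral>\<xi>. fourier_transform f \<xi> * of_real (gauss_cutoff \<tau> \<xi>) * cis (2 * pi * (x \<bullet> \<xi>)) \<partial>lborel)"
proof -
  have [measurable]: "f \<in> borel_measurable borel" using f by simp
  let ?W = "\<lambda>\<xi>. complex_of_real (gauss_cutoff \<tau> \<xi>)"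
  let ?H = "\<lambda>\<xi> y. f y * (?W \<xi> * cis (2 * pi * ((x - y) \<bullet> \<xi>)))"
  have W: "integrable lborel (\<lambda>\<xi>::real^'n. gauss_cutoff \<tau> \<xi>)"
    by (rule integrable_gauss_cutoff[OF \<tau>])
  have int: "integrable (lborel \<Otimes>\<^sub>M lborel) (\<lambda>(\<xi>, y). ?H \<xi> y)"
  proof (rule lborel_pair.Fubini_integrable)
    show "(\<lambda>(\<xi>, y). ?H \<xi> y) \<in> borel_measurable (lborel \<Otimes>\<^sub>M lborel)" by measurable
    have "(\<integral>y. norm (case (\<xi>, y) of (\<xi>, y) \<Rightarrow> ?H \<xi> y) \<partial>lborel) = gauss_cutoff \<tau> \<xi> * (\<integral>y. norm (f y) \<partial>lborel)" for \<xi>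
      by (simp add: norm_mult mult.commute)
    then show "integrable lborel (\<lambda>\<xi>. \<integral>y. norm (case (\<xi>, y) of (\<xi>, y) \<Rightarrow> ?H \<xi> y) \<partial>lborel)"
      using W by simp
    have "integrable lborel (\<lambda>y. ?H \<xi> y)" for \<xi>
      by (rule Bochner_Integration.integrable_bound[OF f])
         (use gauss_cutoff_bounds[of \<tau> \<xi>] in \<open>auto simp: norm_mult mult_left_le\<close>)
    then show "AE \<xi> in lborel. integrable lborel (\<lambda>y. case (\<xi>, y) of (\<xi>, y) \<Rightarrow> ?H \<xi> y)" by simp
  qed
  have "(\<integral>\<xi>. fourier_transform f \<xi> * ?W \<xi> * cis (2 * pi * (x \<bullet> \<xi>)) \<partial>lborel) = (\<integral>\<xi>. \<integral>y. ?H \<xi> y \<partial>lborel \<partial>lborel)"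
  proof (rule Bochner_Integration.integral_cong)
    fix \<xi> :: "real^'n"
    have "?H \<xi> y = f y * cis (- 2 * pi * (y \<bullet> \<xi>)) * (?W \<xi> * cis (2 * pi * (x \<bullet> \<xi>)))" for y
      by (simp add: mult.assoc mult.left_commute cis_mult inner_diff_left algebra_simps)
    then have "(\<integral>y. ?H \<xi> y \<partial>lborel) = fourier_transform f \<xi> * (?W \<xi> * cis (2 * pi * (x \<bullet> \<xi>)))"
      unfolding fourier_transform_def by (simp only: integral_mult_left_zero)
    then show "fourier_transform f \<xi> * ?W \<xi> * cis (2 * pi * (x \<bullet> \<xi>)) = (\<integral>y. ?H \<xi> y \<partial>lborel)"
      by (simp only: mult.assoc)
  qed simp
  also have "\<dots> = (\<integral>y. \<integral>\<xi>. ?H \<xi> y \<partial>lborel \<partial>lborel)"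
    by (rule lborel_pair.Fubini_integral[OF int, symmetric])
  also have "\<dots> = (\<integral>y. f y * of_real (std_gauss ((x - y) /\<^sub>R \<tau>) / \<tau> ^ CARD('n)) \<partial>lborel)"
    by (simp only: integral_mult_right_zero gauss_cutoff_fourier(2)[OF \<tau>]) simp
  also have "\<dots> = of_real (\<bar>- \<tau>\<bar> ^ DIM(real^'n)) *
      (\<integral>u. f (x + (- \<tau>) *\<^sub>R u) * of_real (std_gauss ((x - (x + (- \<tau>) *\<^sub>R u)) /\<^sub>R \<tau>) / \<tau> ^ CARD('n)) \<partial>lborel)"
    by (rule lebesgue_integral_affine(1)) (use \<tau> in auto)
  also have "\<dots> = (\<integral>u. of_real (\<tau> ^ CARD('n)) * (f (x - \<tau> *\<^sub>R u) * of_real (std_gauss u / \<tau> ^ CARD('n))) \<partial>lborel)"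
    using \<tau> by (subst integral_mult_right_zero) simp
  also have "\<dots> = mollify \<tau> f x"
    unfolding mollify_def by (intro Bochner_Integration.integral_cong refl) (use \<tau> in simp)
  finally show ?thesis ..
qed

text \<open>Spherical averages act on frequencies as multiplication by the Fourier transform of surface measure.\<close>

lemma integral_surf_fourier:
  fixes a :: "real^'n::finite \<Rightarrow> complex"
  assumes a: "integrable lborel a"
  shows "(\<integral>\<omega>. \<integral>\<xi>. a \<xi> * cis (2 * pi * ((x - r *\<^sub>R \<omega>) \<bullet> \<xi>)) \<partial>lborel \<partial>surf)
    = (\<integral>\<xi>. a \<xi> * of_real (sphere_cos ((2 * pi * r) *\<^sub>R \<xi>)) * cis (2 * pi * (x \<bullet> \<xi>)) \<partial>lborel)"
proof -
  interpret P: pair_sigma_finite surf "lborel :: (real^'n) measure" by standard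
  have [measurable]: "a \<in> borel_measurable borel" using a by simp
  let ?H = "\<lambda>\<omega> \<xi>. a \<xi> * cis (2 * pi * ((x - r *\<^sub>R \<omega>) \<bullet> \<xi>))"
  have int: "integrable (surf \<Otimes>\<^sub>M lborel) (\<lambda>(\<omega>, \<xi>). ?H \<omega> \<xi>)"
  proof (rule P.Fubini_integrable)
    show "(\<lambda>(\<omega>, \<xi>). ?H \<omega> \<xi>) \<in> borel_measurable (surf \<Otimes>\<^sub>M lborel)" by measurable
    show "integrable surf (\<lambda>\<omega>. \<integral>\<xi>. norm (case (\<omega>, \<xi>) of (\<omega>, \<xi>) \<Rightarrow> ?H \<omega> \<xi>) \<partial>lborel)"
      by (simp add: norm_mult)
    have "integrable lborel (\<lambda>\<xi>. ?H \<omega> \<xi>)" for \<omega>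
      by (rule Bochner_Integration.integrable_bound[OF a]) (auto simp: norm_mult)
    then show "AE \<omega> in surf. integrable lborel (\<lambda>\<xi>. case (\<omega>, \<xi>) of (\<omega>, \<xi>) \<Rightarrow> ?H \<omega> \<xi>)" by simp
  qed
  have "(\<integral>\<omega>. ?H \<omega> \<xi> \<partial>surf) = a \<xi> * of_real (sphere_cos ((2 * pi * r) *\<^sub>R \<xi>)) * cis (2 * pi * (x \<bullet> \<xi>))" for \<xi>
  proof -
    have "?H \<omega> \<xi> = (a \<xi> * cis (2 * pi * (x \<bullet> \<xi>))) * cis (\<omega> \<bullet> ((- 2 * pi * r) *\<^sub>R \<xi>))" for \<omega>
      by (simp add: mult.assoc cis_mult inner_diff_left algebra_simps)
    then have "(\<integral>\<omega>. ?H \<omega> \<xi> \<partial>surf) = (a \<xi> * cis (2 * pi * (x \<bullet> \<xi>))) * of_real (sphere_cos ((- 2 * pi * r) *\<^sub>R \<xi>))"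
      by (simp only: integral_mult_right_zero integral_cis_surf)
    also have "sphere_cos ((- 2 * pi * r) *\<^sub>R \<xi>) = sphere_cos ((2 * pi * r) *\<^sub>R \<xi>)"
      by (rule sphere_cos_radial) simp
    finally show ?thesis by (simp add: ac_simps)
  qed
  then show ?thesis using P.Fubini_integral[OF int] by (simp only:)
qed

section \<open>The bound for mollified functions and a variable radius\<close>

lemma borel_measurable_mollify [measurable]:
  fixes f :: "real^'n::finite \<Rightarrow> complex"
  assumes [measurable]: "f \<in> borel_measurable borel"
  shows "mollify \<tau> f \<in> borel_measurable borel"
  unfolding mollify_def[abs_def] by measurable

context ball_regular_measure
begin

text \<open>With \<open>E\<close> the function in question and \<open>X = \<integral> \<bar>E\<bar>\<^sup>2 d\<mu>\<close>, Fubini's theorem gives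
\<open>X = \<integral> f^(\<xi>) gauss_cutoff \<tau> \<xi> G(\<xi>) d\<xi>\<close>, where \<open>G\<close> is built from \<open>cnj E\<close>. Young's inequality with
parameter \<open>D\<close> bounds this by \<open>D / 2\<close> times the squared Sobolev norm plus \<open>1 / (2 D)\<close> times the left-hand
side of \<open>weighted_extension_dual\<close>, which is at most \<open>D X\<close>. So the last term is at most \<open>X / 2\<close>, and it can be absorbed since
\<open>X\<close> is finite. The cutoff enters only through being at most \<open>1\<close>, whence the independence of \<open>\<tau>\<close>.\<close>

lemma mollified_average_L2_le:
  fixes f :: "real^'n \<Rightarrow> complex" and r :: "real^'n \<Rightarrow> real"
  assumes f: "integrable lborel f" and \<tau>: "0 < \<tau>"
    and [measurable]: "r \<in> borel_measurable borel"
    and r: "\<And>x. r\<^sub>0 \<le> r x" "0 < r\<^sub>0"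
    and \<beta>: "\<beta> = (real CARD('n) - 1) / 2" "\<alpha> < \<beta>"
    and A: "0 < A" "\<And>\<eta> :: real^'n. \<bar>sphere_cos \<eta>\<bar> \<le> A * (1 + norm \<eta>) powr (- \<beta>)"
    and s: "s = (1 - \<alpha>) / 2 + \<epsilon>" "0 < \<epsilon>"
    and D: "A ^ 3 * decay_const \<beta> * r\<^sub>0 powr (- 2 * \<beta>) * 2 powr \<bar>s\<bar> / (2 * \<epsilon>) \<le> D" "0 < D"
  shows "(\<integral>\<^sup>+x. ennreal ((norm (\<integral>\<omega>. mollify \<tau> f (x - r x *\<^sub>R \<omega>) \<partial>surf))\<^sup>2) \<partial>\<mu>)
    \<le> ennreal D * (\<integral>\<^sup>+\<xi>. ennreal ((1 + (norm \<xi>)\<^sup>2) powr s * (norm (fourier_transform f \<xi>))\<^sup>2) \<partial>lborel)"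
proof -
  interpret P: pair_sigma_finite \<mu> "lborel :: (real^'n) measure" by standard
  have [measurable]: "f \<in> borel_measurable borel" using f by simp
  have [measurable]: "cnj \<in> borel_measurable borel"
    by (intro borel_measurable_continuous_onI continuous_intros)
  define a where "a \<xi> = fourier_transform f \<xi> * of_real (gauss_cutoff \<tau> \<xi>)" for \<xi> :: "real^'n"
  have a: "integrable lborel a" unfolding a_def by (rule integrable_fourier_cutoff[OF f \<tau>])
  then have [measurable]: "a \<in> borel_measurable borel" by simp
  define \<kappa> where "\<kappa> = measure (surf :: (real^'n) measure) UNIV"
  have \<kappa>: "0 \<le> \<kappa>" by (simp add: \<kappa>_def)
  let ?k = "\<lambda>x \<xi>. complex_of_real (sphere_cos ((2 * pi * r x) *\<^sub>R \<xi>)) * cis (2 * pi * (x \<bullet> \<xi>))"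
  have k: "norm (?k x \<xi>) \<le> \<kappa>" for x \<xi>
    using abs_sphere_cos_le[of "(2 * pi * r x) *\<^sub>R \<xi>"] by (simp add: norm_mult \<kappa>_def)
  define E where "E x = (\<integral>\<xi>. a \<xi> * ?k x \<xi> \<partial>lborel)" for x
  have E: "(\<integral>\<omega>. mollify \<tau> f (x - r x *\<^sub>R \<omega>) \<partial>surf) = E x" for x
  proof -
    have "(\<integral>\<omega>. mollify \<tau> f (x - r x *\<^sub>R \<omega>) \<partial>surf)
        = (\<integral>\<omega>. \<integral>\<xi>. a \<xi> * cis (2 * pi * ((x - r x *\<^sub>R \<omega>) \<bullet> \<xi>)) \<partial>lborel \<partial>surf)"
      unfolding a_def by (simp only: mollify_fourier[OF f \<tau>])
    also have "\<dots> = E x" unfolding integral_surf_fourier[OF a] E_def by (simp only: mult.assoc)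
    finally show ?thesis .
  qed
  have [measurable]: "E \<in> borel_measurable borel" unfolding E_def[abs_def] by measurable
  define b where "b = \<kappa> * (\<integral>\<xi>. norm (a \<xi>) \<partial>lborel)"
  have Eb: "norm (E x) \<le> b" for x
  proof -
    have ak: "norm (a \<xi> * ?k x \<xi>) \<le> \<kappa> * norm (a \<xi>)" for \<xi>
      unfolding norm_mult[of "a \<xi>"] using mult_left_mono[OF k norm_ge_zero] by (simp only: mult.commute)
    have \<kappa>a: "integrable lborel (\<lambda>\<xi>. \<kappa> * norm (a \<xi>))"
      by (rule integrable_mult_right[OF integrable_norm[OF a]])
    have "integrable lborel (\<lambda>\<xi>. a \<xi> * ?k x \<xi>)"
    proof (rule Bochner_Integration.integrable_bound[OF \<kappa>a])
      show "AE \<xi> in lborel. norm (a \<xi> * ?k x \<xi>) \<le> norm (\<kappa> * norm (a \<xi>))"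
        using ak \<kappa> by (intro always_eventually allI) (simp add: abs_mult)
    qed measurable
    then have "norm (E x) \<le> (\<integral>\<xi>. \<kappa> * norm (a \<xi>) \<partial>lborel)"
      unfolding E_def
      by (intro order_trans[OF integral_norm_bound] integral_mono integrable_norm \<kappa>a ak)
    then show ?thesis by (simp add: b_def)
  qed
  have b: "0 \<le> b" using order_trans[OF norm_ge_zero Eb] .
  define G where "G \<xi> = (\<integral>x. cnj (E x) * of_real (sphere_cos ((2 * pi * r x) *\<^sub>R \<xi>)) * cis (2 * pi * (x \<bullet> \<xi>)) \<partial>\<mu>)" for \<xi> :: "real^'n"
  have [measurable]: "G \<in> borel_measurable borel" unfolding G_def[abs_def] by measurable
  define X where "X = (\<integral>x. (norm (E x))\<^sup>2 \<partial>\<mu>)"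
  have X0: "0 \<le> X" by (simp add: X_def)
  have nnX: "(\<integral>\<^sup>+x. ennreal ((norm (E x))\<^sup>2) \<partial>\<mu>) = ennreal X"
    unfolding X_def
  proof (rule nn_integral_eq_integral)
    show "integrable \<mu> (\<lambda>x. (norm (E x))\<^sup>2)"
      by (rule integrable_const_bound[of _ "b\<^sup>2"]) (use Eb in \<open>auto intro!: power_mono\<close>)
  qed simp
  let ?H = "\<lambda>x \<xi>. cnj (E x) * (a \<xi> * ?k x \<xi>)"
  have int: "integrable (\<mu> \<Otimes>\<^sub>M lborel) (\<lambda>(x, \<xi>). ?H x \<xi>)"
  proof (rule Bochner_Integration.integrable_bound)
    show "integrable (\<mu> \<Otimes>\<^sub>M lborel) (\<lambda>(x, \<xi>). complex_of_real (b * \<kappa>) * a \<xi>)"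
    proof (rule P.Fubini_integrable)
      show "(\<lambda>(x, \<xi>). complex_of_real (b * \<kappa>) * a \<xi>) \<in> borel_measurable (\<mu> \<Otimes>\<^sub>M lborel)" by measurable
    qed (use a in auto)
    show "(\<lambda>(x, \<xi>). ?H x \<xi>) \<in> borel_measurable (\<mu> \<Otimes>\<^sub>M lborel)" by measurable
    have "norm (?H x \<xi>) \<le> norm (complex_of_real (b * \<kappa>) * a \<xi>)" for x \<xi>
    proof -
      have "norm (?H x \<xi>) = norm (E x) * norm (?k x \<xi>) * norm (a \<xi>)" by (simp add: norm_mult)
      also have "\<dots> \<le> b * \<kappa> * norm (a \<xi>)"
        by (intro mult_right_mono mult_mono Eb k b) auto
      finally show ?thesis using b \<kappa> by (simp add: norm_mult)
    qed
    then show "AE p in \<mu> \<Otimes>\<^sub>M lborel. norm (case p of (x, \<xi>) \<Rightarrow> ?H x \<xi>)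
        \<le> norm (case p of (x, \<xi>) \<Rightarrow> complex_of_real (b * \<kappa>) * a \<xi>)"
      by (auto split: prod.split)
  qed
  have "complex_of_real X = (\<integral>x. cnj (E x) * E x \<partial>\<mu>)"
  proof -
    have "complex_of_real ((norm (E x))\<^sup>2) = cnj (E x) * E x" for x
      by (simp only: complex_norm_square mult.commute)
    then show ?thesis unfolding X_def by (simp only: integral_complex_of_real[symmetric])
  qed
  also have "\<dots> = (\<integral>x. \<integral>\<xi>. ?H x \<xi> \<partial>lborel \<partial>\<mu>)"
    by (subst (2) E_def) (simp only: integral_mult_right_zero)
  also have "\<dots> = (\<integral>\<xi>. \<integral>x. ?H x \<xi> \<partial>\<mu> \<partial>lborel)"
    by (rule P.Fubini_integral[OF int, symmetric])
  also have "\<dots> = (\<integral>\<xi>. a \<xi> * G \<xi> \<partial>lborel)"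
  proof (rule Bochner_Integration.integral_cong)
    fix \<xi> :: "real^'n"
    have "?H x \<xi> = a \<xi> * (cnj (E x) * of_real (sphere_cos ((2 * pi * r x) *\<^sub>R \<xi>)) * cis (2 * pi * (x \<bullet> \<xi>)))" for x
      by (simp only: ac_simps)
    then show "(\<integral>x. ?H x \<xi> \<partial>\<mu>) = a \<xi> * G \<xi>"
      unfolding G_def by (simp only: integral_mult_right_zero)
  qed simp
  finally have dual: "complex_of_real X = (\<integral>\<xi>. a \<xi> * G \<xi> \<partial>lborel)" .
  let ?w = "\<lambda>\<xi>::real^'n. (1 + (norm \<xi>)\<^sup>2) powr s"
  let ?N = "\<integral>\<^sup>+\<xi>. ennreal (?w \<xi> * (norm (fourier_transform f \<xi>))\<^sup>2) \<partial>lborel"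
  define K where "K = A ^ 3 * decay_const \<beta> * r\<^sub>0 powr (- 2 * \<beta>) * 2 powr \<bar>s\<bar> / (2 * \<epsilon>)"
  have K: "0 \<le> K" "K \<le> D" using decay_const_nonneg[OF \<beta>(2)] A s D by (auto simp: K_def)
  have GX: "(\<integral>\<^sup>+\<xi>. ennreal ((1 + (norm \<xi>)\<^sup>2) powr (- s) * (norm (G \<xi>))\<^sup>2) \<partial>lborel) \<le> ennreal K * ennreal X"
  proof -
    have "(\<integral>\<^sup>+x. ennreal ((norm (cnj (E x)))\<^sup>2) \<partial>\<mu>) = ennreal X" using nnX by simp
    moreover have "(\<integral>\<^sup>+\<xi>. ennreal ((1 + (norm \<xi>)\<^sup>2) powr (- s) * (norm (G \<xi>))\<^sup>2) \<partial>lborel)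
        \<le> ennreal K * (\<integral>\<^sup>+x. ennreal ((norm (cnj (E x)))\<^sup>2) \<partial>\<mu>)"
      unfolding G_def K_def
      by (rule weighted_extension_dual[where b = b, OF _ _ _ r \<beta> A s]) (use Eb in auto)
    ultimately show ?thesis by simp
  qed
  have young: "norm (a \<xi> * G \<xi>) \<le> D / 2 * (?w \<xi> * (norm (fourier_transform f \<xi>))\<^sup>2)
      + 1 / (2 * D) * ((1 + (norm \<xi>)\<^sup>2) powr (- s) * (norm (G \<xi>))\<^sup>2)" for \<xi>
  proof -
    define p where "p = norm (fourier_transform f \<xi>)"
    define g where "g = norm (G \<xi>)"
    define w where "w = ?w \<xi>"
    have "0 < 1 + (norm \<xi>)\<^sup>2" by (simp add: add_pos_nonneg)
    then have w: "0 < w" "(1 + (norm \<xi>)\<^sup>2) powr (- s) = 1 / w"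
      by (auto simp: w_def powr_minus divide_inverse)
    have "norm (a \<xi> * G \<xi>) \<le> p * g"
      using gauss_cutoff_bounds[of \<tau> \<xi>]
      by (simp add: a_def norm_mult p_def g_def mult_right_mono mult_left_le)
    also have "\<dots> \<le> D / 2 * (w * p\<^sup>2) + 1 / (2 * D) * (1 / w * g\<^sup>2)"
    proof -
      \<comment> \<open>Young's inequality for \<open>p g\<close>, with the Sobolev weight split between the factors.\<close>
      have "0 \<le> (D * w * p - g)\<^sup>2 / (2 * D * w)" using w D by simp
      also have "\<dots> = D / 2 * (w * p\<^sup>2) + 1 / (2 * D) * (1 / w * g\<^sup>2) - p * g"
        using w D by (simp add: field_simps power2_eq_square)
      finally show ?thesis by simp
    qed
    finally show ?thesis unfolding w p_def g_def w_def .
  qed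
  have main: "ennreal X \<le> ennreal (D / 2) * ?N + ennreal (1 / (2 * D)) * (ennreal K * ennreal X)"
  proof -
    have "ennreal X = ennreal (norm (complex_of_real X))" using X0 by simp
    also have "\<dots> \<le> (\<integral>\<^sup>+\<xi>. ennreal (norm (a \<xi> * G \<xi>)) \<partial>lborel)"
      unfolding dual by (rule norm_integral_le_nn_integral)
    also have "\<dots> \<le> (\<integral>\<^sup>+\<xi>. ennreal (D / 2) * ennreal (?w \<xi> * (norm (fourier_transform f \<xi>))\<^sup>2)
      + ennreal (1 / (2 * D)) * ennreal ((1 + (norm \<xi>)\<^sup>2) powr (- s) * (norm (G \<xi>))\<^sup>2) \<partial>lborel)"
    proof (rule nn_integral_mono)
      fix \<xi> :: "real^'n"
      show "ennreal (norm (a \<xi> * G \<xi>)) \<le> ennreal (D / 2) * ennreal (?w \<xi> * (norm (fourier_transform f \<xi>))\<^sup>2)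
        + ennreal (1 / (2 * D)) * ennreal ((1 + (norm \<xi>)\<^sup>2) powr (- s) * (norm (G \<xi>))\<^sup>2)"
        using ennreal_leI[OF young[of \<xi>]] D by (subst (1 2) ennreal_mult[symmetric]) (auto simp: ennreal_plus[symmetric] simp del: ennreal_plus)
    qed
    also have "\<dots> = (\<integral>\<^sup>+\<xi>. ennreal (D / 2) * ennreal (?w \<xi> * (norm (fourier_transform f \<xi>))\<^sup>2) \<partial>lborel)
      + (\<integral>\<^sup>+\<xi>. ennreal (1 / (2 * D)) * ennreal ((1 + (norm \<xi>)\<^sup>2) powr (- s) * (norm (G \<xi>))\<^sup>2) \<partial>lborel)"
      by (rule nn_integral_add) measurable
    also have "(\<integral>\<^sup>+\<xi>. ennreal (D / 2) * ennreal (?w \<xi> * (norm (fourier_transform f \<xi>))\<^sup>2) \<partial>lborel) = ennreal (D / 2) * ?N"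
      by (rule nn_integral_cmult) measurable
    also have "(\<integral>\<^sup>+\<xi>. ennreal (1 / (2 * D)) * ennreal ((1 + (norm \<xi>)\<^sup>2) powr (- s) * (norm (G \<xi>))\<^sup>2) \<partial>lborel)
      = ennreal (1 / (2 * D)) * (\<integral>\<^sup>+\<xi>. ennreal ((1 + (norm \<xi>)\<^sup>2) powr (- s) * (norm (G \<xi>))\<^sup>2) \<partial>lborel)"
      by (rule nn_integral_cmult) measurable
    also have "ennreal (D / 2) * ?N + \<dots> \<le> ennreal (D / 2) * ?N + ennreal (1 / (2 * D)) * (ennreal K * ennreal X)"
      by (intro add_left_mono mult_left_mono GX) auto
    finally show ?thesis .
  qed
  have "ennreal X \<le> ennreal D * ?N"
  proof (cases ?N)
    case (real n)
    have "ennreal u * ennreal n + ennreal v * (ennreal K * ennreal X) = ennreal (u * n + v * (K * X))"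
      if "0 \<le> u" "0 \<le> v" for u v
      using that K X0 real(1) by (simp add: ennreal_mult)
    from this[of "D / 2" "1 / (2 * D)"]
    have "ennreal X \<le> ennreal (D / 2 * n + 1 / (2 * D) * (K * X))"
      using main D by (simp only: real(2)) simp
    then have "X \<le> D / 2 * n + 1 / (2 * D) * (K * X)"
      using D K X0 real by (subst (asm) ennreal_le_iff) auto
    also have "1 / (2 * D) * (K * X) \<le> 1 / (2 * D) * (D * X)"
      using D K X0 by (intro mult_left_mono mult_right_mono) auto
    also have "1 / (2 * D) * (D * X) = X / 2" using D by simp
    finally have "X \<le> D * n" by simp
    then show ?thesis using D real by (simp add: ennreal_mult[symmetric] ennreal_leI)
  next
    case top
    then show ?thesis using D by (simp add: ennreal_mult_top)
  qed
  then show ?thesis unfolding E nnX .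
qed

end

section \<open>Removing the mollification\<close>

lemma norm_mollify_le:
  fixes f :: "real^'n::finite \<Rightarrow> complex"
  assumes [measurable]: "f \<in> borel_measurable borel" and B: "\<And>x. norm (f x) \<le> B"
  shows "norm (mollify \<tau> f x) \<le> B"
proof -
  have g: "integrable lborel (\<lambda>u::real^'n. B * std_gauss u)"
    by (rule integrable_mult_right[OF integrable_std_gauss])
  have le: "norm (f (x - \<tau> *\<^sub>R u) * of_real (std_gauss u)) \<le> B * std_gauss u" for u
    using mult_right_mono[OF B std_gauss_nonneg] by (simp add: norm_mult std_gauss_nonneg)
  have i: "integrable lborel (\<lambda>u. f (x - \<tau> *\<^sub>R u) * of_real (std_gauss u))"
  proof (rule Bochner_Integration.integrable_bound[OF g])
    show "AE u in lborel. norm (f (x - \<tau> *\<^sub>R u) * of_real (std_gauss u)) \<le> norm (B * std_gauss u)"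
      using le by (intro always_eventually allI) (metis abs_ge_self order_trans real_norm_def)
  qed measurable
  have "norm (mollify \<tau> f x) \<le> (\<integral>u. B * std_gauss u \<partial>(lborel :: (real^'n) measure))"
    unfolding mollify_def by (intro order_trans[OF integral_norm_bound] integral_mono integrable_norm g i le)
  then show ?thesis by (simp add: integral_std_gauss)
qed

text \<open>The integral of \<open>f (x - \<tau> u)\<close> against a fixed probability density; dominated convergence.\<close>

lemma mollify_tendsto:
  fixes f :: "real^'n::finite \<Rightarrow> complex"
  assumes f: "continuous_on UNIV f" and B: "\<And>x. norm (f x) \<le> B"
  shows "(\<lambda>n. mollify (1 / real (Suc n)) f x) \<longlonglongrightarrow> f x"
proof -
  have [measurable]: "f \<in> borel_measurable borel" using f by (rule borel_measurable_continuous_onI)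
  have "(\<lambda>n. mollify (1 / real (Suc n)) f x) \<longlonglongrightarrow> (\<integral>u. f x * of_real (std_gauss u) \<partial>(lborel :: (real^'n) measure))"
    unfolding mollify_def
  proof (rule integral_dominated_convergence)
    show "integrable lborel (\<lambda>u::real^'n. B * std_gauss u)"
      by (rule integrable_mult_right[OF integrable_std_gauss])
    show "AE u in lborel. norm (f (x - (1 / real (Suc n)) *\<^sub>R u) * of_real (std_gauss u)) \<le> B * std_gauss u" for n
      by (intro always_eventually allI)
         (simp add: norm_mult std_gauss_nonneg mult_right_mono[OF B std_gauss_nonneg])
    show "AE u in lborel. (\<lambda>n. f (x - (1 / real (Suc n)) *\<^sub>R u) * of_real (std_gauss u)) \<longlonglongrightarrow> f x * of_real (std_gauss u)"
    proof (intro always_eventually allI tendsto_mult tendsto_const)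
      fix u :: "real^'n"
      have "(\<lambda>n. x - (1 / real (Suc n)) *\<^sub>R u) \<longlonglongrightarrow> x - 0 *\<^sub>R u"
        by (intro tendsto_intros LIMSEQ_Suc lim_1_over_n)
      then show "(\<lambda>n. f (x - (1 / real (Suc n)) *\<^sub>R u)) \<longlonglongrightarrow> f x"
        using continuous_on_tendsto_compose[OF f] by simp
    qed
  qed measurable
  moreover have "(\<integral>u. f x * of_real (std_gauss u) \<partial>(lborel :: (real^'n) measure)) = f x"
    by (simp only: integral_mult_right_zero integral_complex_of_real integral_std_gauss of_real_1 mult_1_right)
  ultimately show ?thesis by (simp only:)
qed

lemma surf_average_mollify_tendsto:
  fixes f :: "real^'n::finite \<Rightarrow> complex"
  assumes f: "continuous_on UNIV f" and B: "\<And>x. norm (f x) \<le> B"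
  shows "(\<lambda>n. \<integral>\<omega>. mollify (1 / real (Suc n)) f (x - r *\<^sub>R \<omega>) \<partial>surf) \<longlonglongrightarrow> (\<integral>\<omega>. f (x - r *\<^sub>R \<omega>) \<partial>surf)"
proof (rule integral_dominated_convergence)
  have [measurable]: "f \<in> borel_measurable borel" using f by (rule borel_measurable_continuous_onI)
  show "(\<lambda>\<omega>. f (x - r *\<^sub>R \<omega>)) \<in> borel_measurable surf"
    "\<And>n. (\<lambda>\<omega>. mollify (1 / real (Suc n)) f (x - r *\<^sub>R \<omega>)) \<in> borel_measurable surf" by measurable
  show "AE \<omega> in surf. norm (mollify (1 / real (Suc n)) f (x - r *\<^sub>R \<omega>)) \<le> B" for n
    using norm_mollify_le[of f B] B by simp
qed (use mollify_tendsto[OF f B] in auto)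

lemma continuous_surf_average:
  fixes f :: "real^'n::finite \<Rightarrow> complex"
  assumes f: "continuous_on UNIV f" and B: "\<And>x. norm (f x) \<le> B"
  shows "continuous_on UNIV (\<lambda>r. \<integral>\<omega>. f (x - r *\<^sub>R \<omega>) \<partial>surf)"
  unfolding continuous_on_sequentially comp_def
proof (intro allI ballI impI, elim conjE)
  have [measurable]: "f \<in> borel_measurable borel" using f by (rule borel_measurable_continuous_onI)
  fix r :: "nat \<Rightarrow> real" and l assume r: "r \<longlonglongrightarrow> l"
  show "(\<lambda>n. \<integral>\<omega>. f (x - r n *\<^sub>R \<omega>) \<partial>surf) \<longlonglongrightarrow> (\<integral>\<omega>. f (x - l *\<^sub>R \<omega>) \<partial>surf)"
  proof (rule integral_dominated_convergence[where w = "\<lambda>_. B"])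
    show "AE \<omega> in surf. (\<lambda>n. f (x - r n *\<^sub>R \<omega>)) \<longlonglongrightarrow> f (x - l *\<^sub>R \<omega>)"
      by (intro always_eventually allI continuous_on_tendsto_compose[OF f] tendsto_intros r) auto
  qed (use B in auto)
qed

lemma nn_integral_const_surf:
  assumes "0 \<le> c"
  shows "(\<integral>\<^sup>+\<omega>. ennreal c \<partial>(surf :: (real^'n::finite) measure))
    = ennreal (c * measure (surf :: (real^'n) measure) UNIV)"
  using assms surf.emeasure_eq_measure[where 'n='n] by (simp add: ennreal_mult)

section \<open>Regularity of Schwartz functions\<close>

text \<open>From the Schwartz seminorms only the decay \<open>(1 + \<bar>x\<bar>) ^ (d + 1) \<bar>f x\<bar> \<le> L\<close> is used; the integral of the
majorant is computed in polar coordinates.\<close>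

lemma schwartz_imp_regular:
  fixes f :: "real^'n::finite \<Rightarrow> complex"
  assumes f: "schwartz f"
  obtains B where "continuous_on UNIV f" "\<And>x. norm (f x) \<le> B" "integrable lborel f"
proof -
  let ?d = "CARD('n)"
  let ?N = "?d + 1"
  have diff: "f differentiable (at x)" for x
    using f[unfolded schwartz_def, THEN conjunct1, rule_format, of "[]"] by simp
  then have cont: "continuous_on UNIV f"
    by (simp add: differentiable_imp_continuous_within continuous_at_imp_continuous_on)
  then have [measurable]: "f \<in> borel_measurable borel" by (rule borel_measurable_continuous_onI)
  have bd: "bounded (range (\<lambda>x. (\<Prod>j\<in>UNIV. x $ j ^ \<gamma> j) *\<^sub>R f x))" for \<gamma>
    using f[unfolded schwartz_def, THEN conjunct2, rule_format, of \<gamma> "[]"] by simp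
  obtain B where B: "norm (f x) \<le> B" for x
    using bd[of "\<lambda>_. 0"] unfolding bounded_iff by auto
  have "\<exists>K. \<forall>x. \<bar>x $ i\<bar> ^ ?N * norm (f x) \<le> K" for i
  proof -
    have "(\<Prod>j\<in>UNIV. x $ j ^ (if j = i then ?N else 0)) = x $ i ^ ?N" for x :: "real^'n"
      by (subst prod.remove[of _ i]) auto
    then show ?thesis
      using bd[of "\<lambda>j. if j = i then ?N else 0"] unfolding bounded_iff by (auto simp: power_abs abs_mult)
  qed
  then obtain K where K: "\<bar>x $ i\<bar> ^ ?N * norm (f x) \<le> K i" for x i by metis
  have K0: "0 \<le> K i" for i using order_trans[OF _ K[of 0 i]] by simp
  have B0: "0 \<le> B" using order_trans[OF norm_ge_zero B] .
  define L where "L = 2 ^ ?N * (B + real ?d ^ ?N * (\<Sum>i\<in>UNIV. K i))"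
  have L0: "0 \<le> L" using B0 K0 by (simp add: L_def sum_nonneg)
  have decay: "(1 + norm x) ^ ?N * norm (f x) \<le> L" for x
  proof -
    have "(1 + norm x) ^ ?N * norm (f x) \<le> 2 ^ ?N * (max 1 (norm x) ^ ?N * norm (f x))"
    proof -
      have "(1 + norm x) ^ ?N \<le> (2 * max 1 (norm x)) ^ ?N" by (rule power_mono) auto
      then have "(1 + norm x) ^ ?N * norm (f x) \<le> (2 * max 1 (norm x)) ^ ?N * norm (f x)"
        by (rule mult_right_mono) simp
      then show ?thesis by (simp only: power_mult_distrib mult.assoc)
    qed
    also have "max 1 (norm x) ^ ?N * norm (f x) \<le> B + real ?d ^ ?N * (\<Sum>i\<in>UNIV. K i)"
    proof (cases "norm x \<le> 1")
      case True
      then have "max 1 (norm x) ^ ?N * norm (f x) \<le> B" using B by (simp add: max_def)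
      then show ?thesis using K0 by (simp add: sum_nonneg add_increasing2)
    next
      case False
      obtain i where i: "norm x \<le> real ?d * \<bar>x $ i\<bar>"
      proof -
        have "Max (range (\<lambda>j. \<bar>x $ j\<bar>)) \<in> range (\<lambda>j. \<bar>x $ j\<bar>)" by (rule Max_in) auto
        then obtain i where "Max (range (\<lambda>j. \<bar>x $ j\<bar>)) = \<bar>x $ i\<bar>" by blast
        then have "\<bar>x $ j\<bar> \<le> \<bar>x $ i\<bar>" for j
          using Max_ge[of "range (\<lambda>j. \<bar>x $ j\<bar>)" "\<bar>x $ j\<bar>"] by simp
        then have "(\<Sum>j\<in>UNIV. \<bar>x $ j\<bar>) \<le> (\<Sum>j\<in>(UNIV::'n set). \<bar>x $ i\<bar>)" by (intro sum_mono)
        then have "norm x \<le> real ?d * \<bar>x $ i\<bar>" using norm_le_l1_cart[of x] by simp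
        then show thesis by (rule that)
      qed
      have "max 1 (norm x) ^ ?N * norm (f x) \<le> (real ?d * \<bar>x $ i\<bar>) ^ ?N * norm (f x)"
        using i False by (intro mult_right_mono power_mono) auto
      also have "\<dots> = real ?d ^ ?N * (\<bar>x $ i\<bar> ^ ?N * norm (f x))"
        by (simp only: power_mult_distrib mult.assoc)
      also have "\<dots> \<le> real ?d ^ ?N * (\<Sum>i\<in>UNIV. K i)"
        using K[of x i] member_le_sum[of i UNIV K] K0 by (intro mult_left_mono) auto
      finally show ?thesis using B0 by simp
    qed
    finally show ?thesis by (simp add: L_def mult_left_mono)
  qed
  have "integrable lborel f"
  proof (rule integrableI_bounded)
    have "(\<integral>\<^sup>+x. ennreal (norm (f x)) \<partial>lborel) \<le> (\<integral>\<^sup>+x. ennreal (L / (1 + norm x) ^ ?N) \<partial>(lborel :: (real^'n) measure))"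
    proof (intro nn_integral_mono ennreal_leI)
      fix x :: "real^'n"
      have "0 < (1 + norm x) ^ ?N" by (simp add: add_pos_nonneg)
      then show "norm (f x) \<le> L / (1 + norm x) ^ ?N"
        using decay[of x] by (simp add: pos_le_divide_eq mult.commute)
    qed
    also have "\<dots> = (\<integral>\<^sup>+\<rho>. ennreal (\<rho> ^ (?d - 1)) * indicator {0<..} \<rho> *
        (\<integral>\<^sup>+\<omega>. ennreal (L / (1 + norm (\<rho> *\<^sub>R \<omega>)) ^ ?N) \<partial>(surf :: (real^'n) measure)) \<partial>lborel)"
      by (rule nn_integral_polar) measurable
    also have "\<dots> \<le> (\<integral>\<^sup>+\<rho>. ennreal (L * measure (surf :: (real^'n) measure) UNIV) *
        (indicator {0<..} \<rho> * ennreal ((1 + \<rho>) powr (- 2))) \<partial>lborel)"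
    proof (rule nn_integral_mono)
      fix \<rho> :: real
      show "ennreal (\<rho> ^ (?d - 1)) * indicator {0<..} \<rho> *
          (\<integral>\<^sup>+\<omega>. ennreal (L / (1 + norm (\<rho> *\<^sub>R \<omega>)) ^ ?N) \<partial>(surf :: (real^'n) measure))
        \<le> ennreal (L * measure (surf :: (real^'n) measure) UNIV) * (indicator {0<..} \<rho> * ennreal ((1 + \<rho>) powr (- 2)))"
      proof (cases "0 < \<rho>")
        case \<rho>: True
        have "(\<integral>\<^sup>+\<omega>. ennreal (L / (1 + norm (\<rho> *\<^sub>R \<omega>)) ^ ?N) \<partial>(surf :: (real^'n) measure))
            = (\<integral>\<^sup>+\<omega>. ennreal (L / (1 + \<rho>) ^ ?N) \<partial>(surf :: (real^'n) measure))"
          by (rule nn_integral_cong_AE, use AE_surf in eventually_elim) (use \<rho> in simp)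
        also have "\<dots> = ennreal (L / (1 + \<rho>) ^ ?N * measure (surf :: (real^'n) measure) UNIV)"
          using \<rho> L0 by (intro nn_integral_const_surf) simp
        finally have shell: "(\<integral>\<^sup>+\<omega>. ennreal (L / (1 + norm (\<rho> *\<^sub>R \<omega>)) ^ ?N) \<partial>(surf :: (real^'n) measure))
            = ennreal (L / (1 + \<rho>) ^ ?N * measure (surf :: (real^'n) measure) UNIV)" .
        have "ennreal (\<rho> ^ (?d - 1)) * (\<integral>\<^sup>+\<omega>. ennreal (L / (1 + norm (\<rho> *\<^sub>R \<omega>)) ^ ?N) \<partial>(surf :: (real^'n) measure))
            = ennreal (\<rho> ^ (?d - 1) * (L / (1 + \<rho>) ^ ?N * measure (surf :: (real^'n) measure) UNIV))"
          unfolding shell by (rule ennreal_mult[symmetric]) (use \<rho> L0 in auto)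
        also have "\<dots> \<le> ennreal (L * measure (surf :: (real^'n) measure) UNIV * (1 + \<rho>) powr (- 2))"
        proof (rule ennreal_leI)
          have "\<rho> ^ (?d - 1) / (1 + \<rho>) ^ ?N \<le> (1 + \<rho>) ^ (?d - 1) / (1 + \<rho>) ^ ?N"
            using \<rho> by (intro divide_right_mono power_mono) auto
          also have "\<dots> = (1 + \<rho>) powr (- 2)"
          proof -
            have "?N = (?d - 1) + 2" using zero_less_card_finite[where 'a='n] by linarith
            then have "(1 + \<rho>) ^ ?N = (1 + \<rho>) ^ (?d - 1) * (1 + \<rho>)\<^sup>2" by (metis power_add)
            then show ?thesis using \<rho> by (simp add: powr_minus powr_numeral field_simps)
          qed
          finally have "L * measure (surf :: (real^'n) measure) UNIV * (\<rho> ^ (?d - 1) / (1 + \<rho>) ^ ?N)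
              \<le> L * measure (surf :: (real^'n) measure) UNIV * (1 + \<rho>) powr (- 2)"
            using L0 by (intro mult_left_mono) auto
          then show "\<rho> ^ (?d - 1) * (L / (1 + \<rho>) ^ ?N * measure (surf :: (real^'n) measure) UNIV)
              \<le> L * measure (surf :: (real^'n) measure) UNIV * (1 + \<rho>) powr (- 2)"
            by (simp add: ac_simps)
        qed
        finally show ?thesis using \<rho> L0 by (simp add: ennreal_mult)
      qed simp
    qed
    also have "\<dots> = ennreal (L * measure (surf :: (real^'n) measure) UNIV) * ennreal 1"
      using nn_integral_one_plus_powr[of 2] by (subst nn_integral_cmult) auto
    also have "\<dots> < \<infinity>" by simp
    finally show "(\<integral>\<^sup>+x. ennreal (norm (f x)) \<partial>lborel) < \<infinity>" .
  qed measurable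
  with cont B show thesis by (rule that)
qed

section \<open>The maximal function\<close>

text \<open>A finite supremum is attained at a measurably chosen point: insert the radii one at a time and switch to
the new one where it does better.\<close>

lemma measurable_maximiser:
  fixes H :: "'a \<Rightarrow> real \<Rightarrow> real"
  assumes "finite R" "R \<noteq> {}"
    and H: "\<And>r. r \<in> borel_measurable M \<Longrightarrow> (\<lambda>x. H x (r x)) \<in> borel_measurable M"
  obtains r where "r \<in> borel_measurable M" "\<And>x. r x \<in> R" "\<And>x t. t \<in> R \<Longrightarrow> H x t \<le> H x (r x)"
proof -
  have "\<exists>r \<in> borel_measurable M. (\<forall>x. r x \<in> R) \<and> (\<forall>x. \<forall>t\<in>R. H x t \<le> H x (r x))"
    using assms(1,2)
  proof (induction rule: finite_ne_induct)
    case (singleton t)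
    then show ?case by (intro bexI[of _ "\<lambda>_. t"]) auto
  next
    case (insert t R)
    then obtain r where [measurable]: "r \<in> borel_measurable M"
      and r: "\<And>x. r x \<in> R" "\<And>x t. t \<in> R \<Longrightarrow> H x t \<le> H x (r x)" by auto
    have [measurable]: "(\<lambda>x. H x (r x)) \<in> borel_measurable M" "(\<lambda>x. H x t) \<in> borel_measurable M"
      by (auto intro: H)
    show ?case
    proof (intro bexI[of _ "\<lambda>x. if H x (r x) \<le> H x t then t else r x"] conjI allI ballI)
      fix x u assume "u \<in> insert t R"
      then show "H x u \<le> H x (if H x (r x) \<le> H x t then t else r x)"
        using r(2)[of u x] by auto
    qed (use r in auto)
  qed
  then show thesis using that by blast
qed

text \<open>An elementary substitute for Hoelder's inequality on a finite measure space: distinguish whether \<open>a\<close>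
exceeds \<open>\<theta>\<close>.\<close>

lemma powr_young:
  fixes a \<theta> q :: real
  assumes "0 \<le> a" "0 < \<theta>" "0 < q" "q < 2"
  shows "a powr q \<le> \<theta> powr (q - 2) * a\<^sup>2 + \<theta> powr q"
proof (cases "a \<le> \<theta>")
  case True
  then have "a powr q \<le> \<theta> powr q" using assms by (intro powr_mono2) auto
  then show ?thesis by (simp add: add_increasing)
next
  case False
  have "a powr q = a powr (q - 2) * a\<^sup>2"
    using False assms powr_add[of a "q - 2" 2] by (simp add: powr_numeral)
  also have "\<dots> \<le> \<theta> powr (q - 2) * a\<^sup>2"
    using False assms by (intro mult_right_mono powr_mono2') auto
  finally show ?thesis by (simp add: add_increasing2)
qed

context ball_regular_measure
begin

text \<open>Fatou's lemma along \<open>\<tau> = 1 / (n + 1)\<close>.\<close>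

lemma average_L2_le:
  fixes f :: "real^'n \<Rightarrow> complex" and r :: "real^'n \<Rightarrow> real"
  assumes f: "continuous_on UNIV f" "\<And>x. norm (f x) \<le> B" "integrable lborel f"
    and [measurable]: "r \<in> borel_measurable borel"
    and r: "\<And>x. r\<^sub>0 \<le> r x" "0 < r\<^sub>0"
    and \<beta>: "\<beta> = (real CARD('n) - 1) / 2" "\<alpha> < \<beta>"
    and A: "0 < A" "\<And>\<eta> :: real^'n. \<bar>sphere_cos \<eta>\<bar> \<le> A * (1 + norm \<eta>) powr (- \<beta>)"
    and s: "s = (1 - \<alpha>) / 2 + \<epsilon>" "0 < \<epsilon>"
    and D: "A ^ 3 * decay_const \<beta> * r\<^sub>0 powr (- 2 * \<beta>) * 2 powr \<bar>s\<bar> / (2 * \<epsilon>) \<le> D" "0 < D"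
  shows "(\<integral>\<^sup>+x. ennreal ((norm (\<integral>\<omega>. f (x - r x *\<^sub>R \<omega>) \<partial>surf))\<^sup>2) \<partial>\<mu>)
    \<le> ennreal D * (\<integral>\<^sup>+\<xi>. ennreal ((1 + (norm \<xi>)\<^sup>2) powr s * (norm (fourier_transform f \<xi>))\<^sup>2) \<partial>lborel)"
    (is "_ \<le> ?bound")
proof -
  have [measurable]: "f \<in> borel_measurable borel" using f(1) by (rule borel_measurable_continuous_onI)
  let ?u = "\<lambda>n x. ennreal ((norm (\<integral>\<omega>. mollify (1 / real (Suc n)) f (x - r x *\<^sub>R \<omega>) \<partial>surf))\<^sup>2)"
  have "(\<integral>\<^sup>+x. ennreal ((norm (\<integral>\<omega>. f (x - r x *\<^sub>R \<omega>) \<partial>surf))\<^sup>2) \<partial>\<mu>) = (\<integral>\<^sup>+x. liminf (\<lambda>n. ?u n x) \<partial>\<mu>)"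
  proof (rule nn_integral_cong)
    fix x
    have "(\<lambda>n. ?u n x) \<longlonglongrightarrow> ennreal ((norm (\<integral>\<omega>. f (x - r x *\<^sub>R \<omega>) \<partial>surf))\<^sup>2)"
      by (intro tendsto_ennrealI tendsto_power tendsto_norm surf_average_mollify_tendsto[OF f(1,2)])
    then show "ennreal ((norm (\<integral>\<omega>. f (x - r x *\<^sub>R \<omega>) \<partial>surf))\<^sup>2) = liminf (\<lambda>n. ?u n x)"
      by (intro lim_imp_Liminf[symmetric]) auto
  qed
  also have "\<dots> \<le> liminf (\<lambda>n. \<integral>\<^sup>+x. ?u n x \<partial>\<mu>)"
    by (rule nn_integral_liminf) measurable
  also have "\<dots> \<le> liminf (\<lambda>n. ?bound)"
    by (intro Liminf_mono always_eventually allI mollified_average_L2_le[OF f(3) _ _ r \<beta> A s D]) auto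
  also have "\<dots> = ?bound" by (rule Liminf_const) simp
  finally show ?thesis .
qed

text \<open>The supremum over the interval is the supremum over its rational points, by continuity in the radius,
hence the increasing limit of maxima over finite sets. Each of these is a spherical average with a
measurably chosen radius, to which \<open>average_L2_le\<close> applies.\<close>

lemma maximal_average_le:
  fixes f :: "real^'n \<Rightarrow> complex"
  assumes f: "continuous_on UNIV f" "\<And>x. norm (f x) \<le> B" "integrable lborel f"
    and r\<^sub>0: "0 < r\<^sub>0" "r\<^sub>0 < R\<^sub>0"
    and \<beta>: "\<beta> = (real CARD('n) - 1) / 2" "\<alpha> < \<beta>"
    and A: "0 < A" "\<And>\<eta> :: real^'n. \<bar>sphere_cos \<eta>\<bar> \<le> A * (1 + norm \<eta>) powr (- \<beta>)"
    and s: "s = (1 - \<alpha>) / 2 + \<epsilon>" "0 < \<epsilon>"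
    and D: "A ^ 3 * decay_const \<beta> * r\<^sub>0 powr (- 2 * \<beta>) * 2 powr \<bar>s\<bar> / (2 * \<epsilon>) \<le> D" "0 < D"
    and q: "0 < q" "q < 2" and \<theta>: "0 < \<theta>"
  shows "(\<integral>\<^sup>+x. ennreal_powr (SUP t\<in>{r\<^sub>0<..<R\<^sub>0}. ennreal (norm (\<integral>\<omega>. f (x - t *\<^sub>R \<omega>) \<partial>surf))) q \<partial>\<mu>)
    \<le> ennreal (\<theta> powr (q - 2)) * (ennreal D * (\<integral>\<^sup>+\<xi>. ennreal ((1 + (norm \<xi>)\<^sup>2) powr s * (norm (fourier_transform f \<xi>))\<^sup>2) \<partial>lborel))
      + ennreal (\<theta> powr q * m)"
    (is "_ \<le> ennreal (\<theta> powr (q - 2)) * ?bound + _")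
proof -
  have [measurable]: "f \<in> borel_measurable borel" using f(1) by (rule borel_measurable_continuous_onI)
  define S where "S x t = norm (\<integral>\<omega>. f (x - t *\<^sub>R \<omega>) \<partial>surf)" for x t
  have S0: "0 \<le> S x t" for x t by (simp add: S_def)
  define H where "H x = (SUP t\<in>{r\<^sub>0<..<R\<^sub>0}. ennreal (S x t))" for x
  have SB: "S x t \<le> measure (surf :: (real^'n) measure) UNIV * B" for x t
  proof -
    have "integrable surf (\<lambda>\<omega>. f (x - t *\<^sub>R \<omega>))"
      by (rule surf.integrable_const_bound[of _ B]) (use f in auto)
    then have "S x t \<le> (\<integral>\<omega>. B \<partial>(surf :: (real^'n) measure))"
      unfolding S_def using f(2) by (intro order_trans[OF integral_norm_bound] integral_mono integrable_norm) auto
    then show ?thesis by simp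
  qed
  have H_fin: "H x \<noteq> \<infinity>" for x
  proof -
    have "H x \<le> ennreal (measure (surf :: (real^'n) measure) UNIV * B)"
      unfolding H_def by (intro SUP_least ennreal_leI SB)
    then show ?thesis by (auto simp: top_unique)
  qed
  define Q where "Q = \<rat> \<inter> {r\<^sub>0<..<R\<^sub>0}"
  have Qne: "Q \<noteq> {}" using Rats_dense_in_real[OF r\<^sub>0(2)] by (auto simp: Q_def)
  have Qc: "countable Q" unfolding Q_def by (intro countable_Int1 countable_rat)
  define R where "R n = from_nat_into Q ` {..n}" for n
  have R: "finite (R n)" "R n \<noteq> {}" "R n \<subseteq> {r\<^sub>0<..<R\<^sub>0}" "R n \<subseteq> R (Suc n)" for n
    using from_nat_into[OF Qne] by (auto simp: R_def Q_def)
  have "\<exists>r. r \<in> borel_measurable borel \<and> (\<forall>x. r x \<in> R n) \<and> (\<forall>x. \<forall>t\<in>R n. S x t \<le> S x (r x))" for n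
  proof -
    have "(\<lambda>x. S x (r x)) \<in> borel_measurable borel" if [measurable]: "r \<in> borel_measurable borel" for r :: "real^'n \<Rightarrow> real"
      unfolding S_def by measurable
    from measurable_maximiser[of "R n" borel S, OF R(1,2) this] show ?thesis by metis
  qed
  then obtain r where r_meas [measurable]: "\<And>n. r n \<in> borel_measurable borel"
    and r: "\<And>n x. r n x \<in> R n" "\<And>n x t. t \<in> R n \<Longrightarrow> S x t \<le> S x (r n x)" by metis
  have rge: "r\<^sub>0 \<le> r n x" for n x using r(1)[of n x] R(3)[of n] by auto
  define v where "v n x = S x (r n x)" for n x
  have v_meas [measurable]: "v n \<in> borel_measurable borel" for n
    unfolding v_def[abs_def] S_def by measurable
  have lim: "(\<lambda>n. ennreal (v n x)) \<longlonglongrightarrow> H x" for x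
  proof -
    have inc: "incseq (\<lambda>n. ennreal (v n x))"
      unfolding v_def by (intro incseq_SucI ennreal_leI r(2)) (use r(1) R(4) in blast)
    have "(SUP n. ennreal (v n x)) = H x"
    proof (rule antisym)
      show "(SUP n. ennreal (v n x)) \<le> H x"
        unfolding H_def v_def using r(1) R(3) by (intro SUP_least SUP_upper) blast
      define c where "c = (SUP n. ennreal (v n x))"
      have cle: "c \<le> H x"
        unfolding c_def H_def v_def using r(1) R(3) by (intro SUP_least SUP_upper) blast
      then obtain c' where c': "c = ennreal c'" "0 \<le> c'"
        using H_fin[of x] by (cases c) (auto simp: top_unique)
      have onQ: "S x t \<le> c'" if t: "t \<in> Q" for t
      proof -
        obtain n where "t = from_nat_into Q n" using from_nat_into_surj[OF Qc t] by metis
        then have "t \<in> R n" by (auto simp: R_def)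
        then have "ennreal (S x t) \<le> ennreal (v n x)" unfolding v_def by (intro ennreal_leI r(2))
        also have "\<dots> \<le> c" unfolding c_def by (rule SUP_upper) simp
        finally show ?thesis using c' by simp
      qed
      have cont: "continuous_on UNIV (S x)"
        unfolding S_def by (intro continuous_on_norm continuous_surf_average[OF f(1,2)])
      have "S x t \<le> c'" if t: "t \<in> {r\<^sub>0<..<R\<^sub>0}" for t
      proof (rule ccontr)
        assume "\<not> S x t \<le> c'"
        then have "t \<in> {r\<^sub>0<..<R\<^sub>0} \<inter> {t. c' < S x t}" using t by auto
        moreover have "open ({r\<^sub>0<..<R\<^sub>0} \<inter> {t. c' < S x t})"
          by (intro open_Int open_Collect_less continuous_on_const cont) auto
        ultimately obtain e where e: "0 < e" "ball t e \<subseteq> {r\<^sub>0<..<R\<^sub>0} \<inter> {t. c' < S x t}"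
          by (auto elim: openE)
        obtain u where u: "u \<in> \<rat>" "t < u" "u < t + e" using Rats_dense_in_real[of t "t + e"] e(1) by auto
        then have "u \<in> ball t e" by (simp add: dist_real_def)
        then show False using e(2) u(1) onQ[of u] by (force simp: Q_def)
      qed
      then show "H x \<le> (SUP n. ennreal (v n x))"
        unfolding c_def[symmetric] c'(1) H_def by (intro SUP_least ennreal_leI)
    qed
    then show ?thesis using LIMSEQ_SUP[OF inc] by simp
  qed
  have plim: "(\<lambda>n. ennreal (v n x powr q)) \<longlonglongrightarrow> ennreal_powr (H x) q" for x
  proof -
    have "(\<lambda>n. enn2real (ennreal (v n x))) \<longlonglongrightarrow> enn2real (H x)"
    proof (rule tendsto_enn2real)
      show "(\<lambda>n. ennreal (v n x)) \<longlonglongrightarrow> ennreal (enn2real (H x))"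
        using lim[of x] H_fin[of x] by (simp add: less_top[symmetric])
    qed simp
    then have "(\<lambda>n. v n x) \<longlonglongrightarrow> enn2real (H x)" by (simp add: v_def S0)
    then have "(\<lambda>n. v n x powr q) \<longlonglongrightarrow> enn2real (H x) powr q"
      using q(1) by (intro tendsto_powr' tendsto_const) (auto simp: v_def S0)
    then show ?thesis using H_fin[of x] by (simp add: ennreal_powr_def tendsto_ennrealI)
  qed
  have step: "(\<integral>\<^sup>+x. ennreal (v n x powr q) \<partial>\<mu>) \<le> ennreal (\<theta> powr (q - 2)) * ?bound + ennreal (\<theta> powr q * m)" for n
  proof -
    have "(\<integral>\<^sup>+x. ennreal (v n x powr q) \<partial>\<mu>)
        \<le> (\<integral>\<^sup>+x. ennreal (\<theta> powr (q - 2)) * ennreal ((v n x)\<^sup>2) + ennreal (\<theta> powr q) \<partial>\<mu>)"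
    proof (rule nn_integral_mono)
      fix x
      show "ennreal (v n x powr q) \<le> ennreal (\<theta> powr (q - 2)) * ennreal ((v n x)\<^sup>2) + ennreal (\<theta> powr q)"
        using ennreal_leI[OF powr_young[OF _ \<theta> q, of "v n x"]] by (simp add: v_def S0 ennreal_mult)
    qed
    also have "\<dots> = (\<integral>\<^sup>+x. ennreal (\<theta> powr (q - 2)) * ennreal ((v n x)\<^sup>2) \<partial>\<mu>) + (\<integral>\<^sup>+x. ennreal (\<theta> powr q) \<partial>\<mu>)"
      by (rule nn_integral_add) measurable
    also have "(\<integral>\<^sup>+x. ennreal (\<theta> powr (q - 2)) * ennreal ((v n x)\<^sup>2) \<partial>\<mu>)
        = ennreal (\<theta> powr (q - 2)) * (\<integral>\<^sup>+x. ennreal ((v n x)\<^sup>2) \<partial>\<mu>)"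
      by (rule nn_integral_cmult) measurable
    also have "(\<integral>\<^sup>+x. ennreal ((v n x)\<^sup>2) \<partial>\<mu>) \<le> ?bound"
      unfolding v_def S_def by (rule average_L2_le[OF f r_meas rge r\<^sub>0(1) \<beta> A s D])
    also have "(\<integral>\<^sup>+x. ennreal (\<theta> powr q) \<partial>\<mu>) = ennreal (\<theta> powr q) * emeasure \<mu> UNIV" by simp
    also have "\<dots> \<le> ennreal (\<theta> powr q) * ennreal m" by (intro mult_left_mono mass) simp
    also have "\<dots> = ennreal (\<theta> powr q * m)" using nonneg by (simp add: ennreal_mult)
    finally show ?thesis by (simp add: add_mono mult_left_mono)
  qed
  have "(\<integral>\<^sup>+x. ennreal_powr (H x) q \<partial>\<mu>) = (\<integral>\<^sup>+x. liminf (\<lambda>n. ennreal (v n x powr q)) \<partial>\<mu>)"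
    by (intro nn_integral_cong lim_imp_Liminf[symmetric] plim) auto
  also have "\<dots> \<le> liminf (\<lambda>n. \<integral>\<^sup>+x. ennreal (v n x powr q) \<partial>\<mu>)"
    by (rule nn_integral_liminf) measurable
  also have "\<dots> \<le> liminf (\<lambda>n::nat. ennreal (\<theta> powr (q - 2)) * ?bound + ennreal (\<theta> powr q * m))"
    by (intro Liminf_mono always_eventually allI step)
  also have "\<dots> = ennreal (\<theta> powr (q - 2)) * ?bound + ennreal (\<theta> powr q * m)"
    by (rule Liminf_const) simp
  finally show ?thesis unfolding H_def S_def .
qed

end

text \<open>The complement of the support is a union of open null sets; by the Lindelof property countably many of
them suffice.\<close>

lemma null_outside_measure_support:
  fixes \<mu> :: "'a::second_countable_topology measure"
  assumes "sets \<mu> = sets borel"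
  shows "- measure_support \<mu> \<in> null_sets \<mu>"
proof -
  define F where "F = {U :: 'a set. open U \<and> emeasure \<mu> U = 0}"
  have eq: "- measure_support \<mu> = \<Union>F"
    by (auto simp: measure_support_def F_def not_gr_zero)
  obtain F' where F': "F' \<subseteq> F" "countable F'" "\<Union>F' = \<Union>F"
    by (rule Lindelof[of F]) (auto simp: F_def)
  have "(\<Union>U\<in>F'. U) \<in> null_sets \<mu>"
    using F' assms by (intro null_sets_UN') (auto simp: F_def null_sets_def)
  then show ?thesis using eq F'(3) by simp
qed

theorem theorem2p1:
  fixes \<alpha> C\<^sub>0 M \<epsilon> q r\<^sub>0 R\<^sub>0 :: real
  assumes "CARD('n::finite) \<ge> 2"
    and "0 < \<alpha>" "\<alpha> < (real CARD('n) - 1) / 2"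
    and "0 < \<epsilon>"
    and "0 < q" "q < 2"
    and "0 < r\<^sub>0" "r\<^sub>0 < R\<^sub>0"
  shows "\<exists>C::real. \<forall>\<mu> :: (real^'n) measure.
    sets \<mu> = sets borel \<longrightarrow>
    compact (measure_support \<mu>) \<longrightarrow>
    measure_support \<mu> \<subseteq> ball 0 M \<longrightarrow>
    (\<forall>x. \<forall>\<delta>>0. emeasure \<mu> (ball x \<delta>) \<le> ennreal (C\<^sub>0 * \<delta> powr \<alpha>)) \<longrightarrow>
    (\<forall>f :: real^'n \<Rightarrow> complex. schwartz f \<longrightarrow>
      ennreal_powr
        (\<integral>\<^sup>+x. ennreal_powr (SUP r\<in>{r\<^sub>0<..<R\<^sub>0}. ennreal (norm (spherical_avg f x r))) q \<partial>\<mu>)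
        (1 / q)
      \<le> ennreal C * sobolev_norm ((1 - \<alpha>) / 2 + \<epsilon>) f)"
proof -
  define \<beta> where "\<beta> = (real CARD('n) - 1) / 2"
  obtain A where A: "0 < A" "\<And>\<eta> :: real^'n. \<bar>sphere_cos \<eta>\<bar> \<le> A * (1 + norm \<eta>) powr (- \<beta>)"
    using sphere_cos_decay[where 'n='n] unfolding \<beta>_def by blast
  have \<alpha>\<beta>: "\<alpha> < \<beta>" using assms(3) by (simp add: \<beta>_def)
  define s where "s = (1 - \<alpha>) / 2 + \<epsilon>"
  define C\<^sub>1 where "C\<^sub>1 = max C\<^sub>0 0"
  define m where "m = C\<^sub>1 * \<bar>M\<bar> powr \<alpha>"
  have m: "0 \<le> m" by (simp add: m_def C\<^sub>1_def)
  \<comment> \<open>The maximum with \<open>1\<close> makes \<open>D\<close> and \<open>C\<close> positive, so that \<open>C * \<infinity> = \<infinity>\<close> if the Sobolev norm is infinite.\<close>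
  define D where "D = max 1 (A ^ 3 * ball_regular_measure.decay_const m C\<^sub>1 \<alpha> \<beta> * r\<^sub>0 powr (- 2 * \<beta>) * 2 powr \<bar>s\<bar> / (2 * \<epsilon>))"
  have D: "0 < D" by (simp add: D_def)
  define C where "C = (D + m) powr (1 / q)"
  have C: "0 < C" using D m by (simp add: C_def)
  have "ennreal_powr
        (\<integral>\<^sup>+x. ennreal_powr (SUP r\<in>{r\<^sub>0<..<R\<^sub>0}. ennreal (norm (spherical_avg f x r))) q \<partial>\<mu>)
        (1 / q)
      \<le> ennreal C * sobolev_norm s f"
    if \<mu>: "sets \<mu> = sets borel" "measure_support \<mu> \<subseteq> ball 0 M"
        "\<And>x \<delta>. 0 < \<delta> \<Longrightarrow> emeasure \<mu> (ball x \<delta>) \<le> ennreal (C\<^sub>0 * \<delta> powr \<alpha>)"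
      and f: "schwartz f"
    for \<mu> :: "(real^'n) measure" and f :: "real^'n \<Rightarrow> complex"
  proof -
    have ball: "emeasure \<mu> (ball x \<delta>) \<le> ennreal (C\<^sub>1 * \<delta> powr \<alpha>)" if "0 < \<delta>" for x \<delta>
      using \<mu>(3)[OF that, of x]
      by (rule order_trans) (auto simp: C\<^sub>1_def intro!: ennreal_leI mult_right_mono)
    have mass: "emeasure \<mu> UNIV \<le> ennreal m"
    proof -
      have "emeasure \<mu> UNIV \<le> emeasure \<mu> (ball 0 M \<union> - measure_support \<mu>)"
        using \<mu> null_outside_measure_support[OF \<mu>(1)] by (intro emeasure_mono) (auto simp: null_sets_def)
      also have "\<dots> = emeasure \<mu> (ball 0 M)"
        using \<mu>(1) by (intro emeasure_Un_null_set null_outside_measure_support) auto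
      also have "\<dots> \<le> ennreal m"
        using ball[of M 0] by (cases "0 < M") (auto simp: m_def ball_empty)
      finally show ?thesis .
    qed
    interpret ball_regular_measure \<mu> m C\<^sub>1 \<alpha>
      by unfold_locales (use \<mu> mass ball m assms in \<open>auto simp: C\<^sub>1_def\<close>)
    obtain B where fr: "continuous_on UNIV f" "\<And>x. norm (f x) \<le> B" "integrable lborel f"
      using schwartz_imp_regular[OF f] by blast
    have fm: "f \<in> borel_measurable borel" using fr(3) by simp
    let ?N = "\<integral>\<^sup>+\<xi>. ennreal ((1 + (norm \<xi>)\<^sup>2) powr s * (norm (fourier_transform f \<xi>))\<^sup>2) \<partial>lborel"
    define I where "I = (\<integral>\<^sup>+x. ennreal_powr (SUP r\<in>{r\<^sub>0<..<R\<^sub>0}. ennreal (norm (spherical_avg f x r))) q \<partial>\<mu>)"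
    have I: "I \<le> ennreal (\<theta> powr (q - 2)) * (ennreal D * ?N) + ennreal (\<theta> powr q * m)" if "0 < \<theta>" for \<theta>
      unfolding I_def spherical_avg_eq_surf[OF fm]
      by (rule maximal_average_le[OF fr assms(7,8) \<beta>_def \<alpha>\<beta> A s_def assms(4) _ D assms(5,6) that])
         (simp add: D_def)
    show ?thesis
    proof (cases ?N)
      case top
      then have "sobolev_norm s f = \<infinity>" by (simp add: sobolev_norm_def ennreal_powr_def)
      then show ?thesis using C by (simp add: ennreal_mult_top)
    next
      case (real n)
      have norm: "sobolev_norm s f = ennreal (n powr (1 / 2))"
        using real by (simp add: sobolev_norm_def ennreal_powr_def)
      have I': "I \<le> ennreal (\<theta> powr (q - 2) * (D * n) + \<theta> powr q * m)" if "0 < \<theta>" for \<theta>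
        using I[OF that] D m real(1) unfolding real(2) by (simp add: ennreal_mult)
      have Ile: "I \<le> ennreal ((n powr (1 / 2)) powr q * (D + m))"
      proof (cases "n = 0")
        case False
        \<comment> \<open>Taking \<open>\<theta>\<close> to be the Sobolev norm makes both terms of the bound homogeneous of degree \<open>q\<close>.\<close>
        define \<theta> where "\<theta> = n powr (1 / 2)"
        have \<theta>: "0 < \<theta>" using False real(1) by (simp add: \<theta>_def)
        have "n = \<theta> powr 2" using real(1) False by (simp add: \<theta>_def powr_powr)
        then have "\<theta> powr (q - 2) * n = \<theta> powr q" by (simp add: powr_add[symmetric])
        then have "\<theta> powr (q - 2) * (D * n) = \<theta> powr q * D" by (metis mult.assoc mult.commute)
        then have "I \<le> ennreal (\<theta> powr q * (D + m))"
          using I'[OF \<theta>] by (simp only: distrib_left)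
        then show ?thesis by (simp only: \<theta>_def)
      next
        case True
        \<comment> \<open>If the Sobolev norm vanishes, let \<open>\<theta>\<close> tend to \<open>0\<close>.\<close>
        have lim: "((\<lambda>t. ennreal (t powr q * m)) \<longlongrightarrow> ennreal (0 powr q * m)) (at_right 0)"
          using assms(5)
          by (intro tendsto_ennrealI tendsto_mult tendsto_powr' tendsto_ident_at tendsto_const)
             (auto intro: eventually_at_right_less eventually_mono[OF eventually_at_right_less])
        have "I \<le> ennreal (0 powr q * m)"
        proof (rule tendsto_lowerbound[OF lim])
          show "\<forall>\<^sub>F t in at_right 0. I \<le> ennreal (t powr q * m)"
            using eventually_at_right_less[of "0::real"] by eventually_elim (use I' True in simp)
        qed simp
        then show ?thesis using True by simp
      qed
      then obtain i where i: "I = ennreal i" "0 \<le> i"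
        by (cases I) (auto simp: top_unique)
      have "i \<le> (n powr (1 / 2)) powr q * (D + m)"
        using Ile D m unfolding i(1) by (subst (asm) ennreal_le_iff) auto
      then have "i powr (1 / q) \<le> ((n powr (1 / 2)) powr q * (D + m)) powr (1 / q)"
        using i(2) assms(5) by (intro powr_mono2) auto
      also have "\<dots> = n powr (1 / 2) * C"
        using D m assms(5) by (simp add: powr_mult powr_powr C_def)
      finally have "ennreal (i powr (1 / q)) \<le> ennreal C * ennreal (n powr (1 / 2))"
        using C by (simp add: ennreal_mult[symmetric] mult.commute ennreal_leI)
      then show ?thesis
        unfolding I_def[symmetric] norm using i by (simp add: ennreal_powr_def)
    qed
  qed
  then show ?thesis unfolding s_def by blast
qed

end
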